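(* Let $u$ be a smooth solution of $$\Box u=\sum_{\alpha,\beta,\gamma=0}^2Q^{\alpha\beta\gamma}\partial^2_{\alpha\beta}u\,\partial_\gamma u\ \text{ in }[0,\infty)\times\mathcal K,\qquad u=0\ \text{ on }[0,\infty)\times\partial\mathcal K,\qquad (u,\partial_tu)(0,\cdot)=(\varepsilon u_0,\varepsilon u_1),$$ where $Q^{\alpha\beta\gamma}=Q^{\beta\alpha\gamma}$ are constants with $\sum_{\alpha,\beta,\gamma}Q^{\alpha\beta\gamma}\xi_\alpha\xi_\beta\xi_\gamma=0$ for all $(\xi_0,\xi_1,\xi_2)\in\{\pm1\}\times\mathbb S^1$. Then for every multi-index $a\in\mathbb N_0^4$ there are constants $C_{abc}^{12,\mu}$ and polynomials $C_{abc}^{0,\mu}(\omega)$ in $\omega=x/|x|$ such that $$\begin{aligned}\Box Z^au=\sum_{b+c\le a}\Big\{&\sum_{\mu,\nu=0}^2|x|^{-1}\big(C(\omega)\partial^2_{\mu\nu}Z^bu\,\Omega Z^cu+C(\omega)\Omega\partial_\mu Z^bu\,\partial_\nu Z^cu\big)\\&+\sum_{\mu=0}^2\big[C_{abc}^{12,\mu}Q_{12}(\partial_\mu Z^bu,Z^cu)+C_{abc}^{0,\mu}(\omega)Q_0(\partial_\mu Z^bu,Z^cu)+C(\omega)\Box Z^bu\,\partial_\mu Z^cu\big]\Big\}.\end{aligned}$$ Define $$V_a:=\tilde Z^au-\frac12\sum_{b+c\le a}\sum_{\mu=0}^2C_{abc}^{0,\mu}(\omega)\chi(x)\,\partial_\mu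 Z^bu\,Z^cu,\qquad \chi:=\chi_{[1/2,1]}.$$ Then $V_a|_{\partial\mathcal K}=0$ and $$\begin{aligned}\Box V_a&=\Box(\tilde Z^a-Z^a)u+\frac12\sum_{b+c\le a}\sum_{\mu=0}^2[\Delta,C_{abc}^{0,\mu}(\omega)\chi(x)](\partial_\mu Z^bu\,Z^cu)\\&\quad+\sum_{b+c\le a}\sum_{\mu=0}^2\Big\{C_{abc}^{12,\mu}Q_{12}(\partial_\mu Z^bu,Z^cu)+C(\omega)(1-\chi(x))Q_0(\partial_\mu Z^bu,Z^cu)\\&\qquad\quad+C(\omega)\Box Z^bu\,\partial_\mu Z^cu+C(\omega)\chi(x)\big(\Box\partial_\mu Z^bu\,Z^cu+\partial_\mu Z^bu\,\Box Z^cu\big)\Big\}\\&\quad+\sum_{b+c\le a}\sum_{\mu,\nu=0}^2|x|^{-1}\big(C(\omega)\partial^2_{\mu\nu}Z^bu\,\Omega Z^cu+C(\omega)\Omega\partial_\mu Z^bu\,\partial_\nu Z^cu\big),\end{aligned}$$ where the commutator satisfies, with an implicit constant independent of $u$, $$\big|[\Delta,C_{abc}^{0,\mu}(\omega)\chi(x)](\partial_\mu Z^bu\,Z^cu)\big|\lesssim|x|^{-2}\big|Z^{\le1}(\partial_\mu Z^bu\,Z^cu)\big|.$$ Moreover, $$\begin{aligned}\Box V_a&=\Box(\tilde Z^a-Z^a)u+\frac12\sum_{b+c\le a}\sum_{\mu=0}^2[\Delta,C_{abc}^{0,\mu}(\omega)\chi(x)](\partial_\mu Z^bu\,Z^cu)\\&\quad+\sum_{b+c\le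 a}\sum_{\mu=0}^2\Big\{C(\omega)(1-\chi(x))Q_0(\partial_\mu Z^bu,Z^cu)+C(\omega)\Box Z^bu\,\partial_\mu Z^cu\\&\qquad\quad+C(\omega)\chi(x)\big(\Box\partial_\mu Z^bu\,Z^cu+\partial_\mu Z^bu\,\Box Z^cu\big)\Big\}\\&\quad+\sum_{b+c\le a}\Big\{\partial_\theta\Big(\frac{C(\omega)\,\partial^2Z^bu\,Z^cu}{|x|}\Big)+\sum_{\mu=0}^2\partial_\mu\Big(\frac{C(\omega)\,Z\partial Z^bu\,Z^cu}{|x|}\Big)+\frac{C(\omega)\,Z\partial Z^bu\,Z^cu}{|x|^2}\Big\}.\end{aligned}$$
   Context: $\mathcal O\subset\mathbb R^2$ is compact, contains the origin and has smooth boundary; $\mathcal K=\mathbb R^2\setminus\mathcal O$, normalized so that $\partial\mathcal K\subset\{c_0<|x|<1/2\}$ for some $c_0>0$. $\partial=(\partial_0,\partial_1,\partial_2)=(\partial_t,\partial_{x_1},\partial_{x_2})$, $\Box=\partial_t^2-\Delta$, $\Delta=\partial_1^2+\partial_2^2$, $\Omega=\partial_\theta=x_1\partial_2-x_2\partial_1$, $\omega=x/|x|$. $\chi_{[1/2,1]}$ is a fixed smooth cutoff with values in $[0,1]$, $\chi_{[1/2,1]}(s)=0$ for $s\le1/2$ and $=1$ for $s\ge1$, and $\chi_{[1/2,1]}(x)$ means $\chi_{[1/2,1]}(|x|)$. $Z=(Z_1,\dots,Z_4)=(\partial_t,\partial_1,\partial_2,\Omega)$; $\tilde Z_1=\partial_t$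 and $\tilde Z_i=\chi_{[1/2,1]}(x)Z_i$ for $i=2,3,4$; $Z^a=Z_1^{a_1}Z_2^{a_2}Z_3^{a_3}Z_4^{a_4}$ and similarly $\tilde Z^a$. $Z^{\le1}f=(f,Zf)$. $Q_0(f,g)=\partial_tf\partial_tg-\sum_{j=1}^2\partial_jf\partial_jg$, $Q_{12}(f,g)=\partial_1f\partial_2g-\partial_2f\partial_1g$. $[X,Y]=XY-YX$. Schematic convention: $C(\omega)$ denotes a generic polynomial in $\omega$ (independent of $u$), possibly different at each occurrence and depending on all indices of the summation; $\partial^2Z^bu$ and $Z\partial Z^bu$ inside such expressions stand for finite linear combinations (with polynomial coefficients in $\omega$) of $\partial^2_{\mu\nu}Z^bu$ and of $Z_j\partial_\nu Z^bu$, respectively. *)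

theory Defs
  imports "HOL-Analysis.Analysis"
begin

section \<open>Smooth functions and domains with smooth boundary\<close>

fun Ck_on :: "nat \<Rightarrow> 'a::real_normed_vector set \<Rightarrow> ('a \<Rightarrow> 'b::real_normed_vector) \<Rightarrow> bool" where
  "Ck_on 0 W f \<longleftrightarrow> continuous_on W f"
| "Ck_on (Suc k) W f \<longleftrightarrow> (\<forall>z\<in>W. f differentiable (at z)) \<and>
     (\<forall>v. Ck_on k W (\<lambda>z. frechet_derivative f (at z) v))"

text \<open>Only meant for open sets: the derivatives are not taken relative to the set.\<close>

definition smooth_on :: "'a::real_normed_vector set \<Rightarrow> ('a \<Rightarrow> 'b::real_normed_vector) \<Rightarrow> bool" where
  "smooth_on W f \<longleftrightarrow> (\<forall>k. Ck_on k W f)"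

definition has_smooth_boundary :: "(real^2) set \<Rightarrow> bool" where
  "has_smooth_boundary S \<longleftrightarrow> (\<forall>p\<in>frontier S. \<exists>U \<rho>. open U \<and> p \<in> U \<and>
     smooth_on U (\<rho> :: real^2 \<Rightarrow> real) \<and>
     (\<forall>x\<in>U. frechet_derivative \<rho> (at x) \<noteq> (\<lambda>_. 0)) \<and>
     S \<inter> U = {x\<in>U. \<rho> x \<le> 0})"

definition is_cutoff :: "(real \<Rightarrow> real) \<Rightarrow> bool" where
  "is_cutoff \<eta> \<longleftrightarrow> smooth_on UNIV \<eta> \<and> (\<forall>s. 0 \<le> \<eta> s \<and> \<eta> s \<le> 1) \<and>
     (\<forall>s\<le>1/2. \<eta> s = 0) \<and> (\<forall>s\<ge>1. \<eta> s = 1)"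


section \<open>Differential operators on space-time\<close>

text \<open>Points of space-time are pairs \<open>(t, x)\<close>; the indices \<open>0, 1, 2\<close> stand for
  \<open>t\<close>, \<open>x\<^sub>1\<close>, \<open>x\<^sub>2\<close>.\<close>

type_synonym spacetime = "real \<times> (real^2)"
type_synonym scalar_field = "spacetime \<Rightarrow> real"

definition dir :: "nat \<Rightarrow> spacetime" where
  "dir \<mu> = (if \<mu> = 0 then (1, 0) else if \<mu> = 1 then (0, axis 1 1) else (0, axis 2 1))"

definition pd :: "nat \<Rightarrow> scalar_field \<Rightarrow> scalar_field" (\<open>\<partial>\<close>) where
  "\<partial> \<mu> f = (\<lambda>z. frechet_derivative f (at z) (dir \<mu>))"

definition \<Delta> :: "scalar_field \<Rightarrow> scalar_field" where
  "\<Delta> f = (\<lambda>z. \<partial> 1 (\<partial> 1 f) z + \<partial> 2 (\<partial> 2 f) z)"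

definition box :: "scalar_field \<Rightarrow> scalar_field" (\<open>\<box>\<close>) where
  "\<box> f = (\<lambda>z. \<partial> 0 (\<partial> 0 f) z - \<Delta> f z)"

definition \<Omega> :: "scalar_field \<Rightarrow> scalar_field" where
  "\<Omega> f = (\<lambda>z. snd z $ 1 * \<partial> 2 f z - snd z $ 2 * \<partial> 1 f z)"

definition rad :: "spacetime \<Rightarrow> real" where
  "rad z = norm (snd z)"

definition ang :: "spacetime \<Rightarrow> real^2" where
  "ang z = snd z /\<^sub>R norm (snd z)"

definition Q0 :: "scalar_field \<Rightarrow> scalar_field \<Rightarrow> scalar_field" where
  "Q0 f g = (\<lambda>z. \<partial> 0 f z * \<partial> 0 g z - (\<Sum>j=1..2. \<partial> j f z * \<partial> j g z))"

definition Q12 :: "scalar_field \<Rightarrow> scalar_field \<Rightarrow> scalar_field" where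
  "Q12 f g = (\<lambda>z. \<partial> 1 f z * \<partial> 2 g z - \<partial> 2 f z * \<partial> 1 g z)"

definition commutator :: "(scalar_field \<Rightarrow> scalar_field) \<Rightarrow> (scalar_field \<Rightarrow> scalar_field) \<Rightarrow> scalar_field \<Rightarrow> scalar_field" where
  "commutator X Y f = (\<lambda>z. X (Y f) z - Y (X f) z)"

definition mult_op :: "scalar_field \<Rightarrow> scalar_field \<Rightarrow> scalar_field" where
  "mult_op h f = (\<lambda>z. h z * f z)"


section \<open>The vector fields and their powers\<close>

text \<open>Only the indices \<open>1, \<dots>, 4\<close> are used.\<close>

definition Z :: "nat \<Rightarrow> scalar_field \<Rightarrow> scalar_field" where
  "Z j = (if j = 1 then \<partial> 0 else if j = 2 then \<partial> 1 else if j = 3 then \<partial> 2 else \<Omega>)"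

definition Zt :: "(real \<Rightarrow> real) \<Rightarrow> nat \<Rightarrow> scalar_field \<Rightarrow> scalar_field" where
  "Zt \<eta> j f = (if j = 1 then \<partial> 0 f else (\<lambda>z. \<eta> (rad z) * Z j f z))"

text \<open>Multi-indices are vectors of type \<^typ>\<open>nat^4\<close>, with componentwise addition and order.\<close>

definition Zpow :: "nat^4 \<Rightarrow> scalar_field \<Rightarrow> scalar_field" where
  "Zpow a f = (Z 1 ^^ (a$1)) ((Z 2 ^^ (a$2)) ((Z 3 ^^ (a$3)) ((Z 4 ^^ (a$4)) f)))"

definition Ztpow :: "(real \<Rightarrow> real) \<Rightarrow> nat^4 \<Rightarrow> scalar_field \<Rightarrow> scalar_field" where
  "Ztpow \<eta> a f = (Zt \<eta> 1 ^^ (a$1)) ((Zt \<eta> 2 ^^ (a$2)) ((Zt \<eta> 3 ^^ (a$3)) ((Zt \<eta> 4 ^^ (a$4)) f)))"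

definition Zle1 :: "scalar_field \<Rightarrow> spacetime \<Rightarrow> real \<times> real \<times> real \<times> real \<times> real" where
  "Zle1 f z = (f z, Z 1 f z, Z 2 f z, Z 3 f z, Z 4 f z)"

definition splits :: "nat^4 \<Rightarrow> ((nat^4) \<times> (nat^4)) set" where
  "splits a = {(b, c). b + c \<le> a}"

text \<open>The sums over \<^term>\<open>splits a\<close> are genuine finite sums.\<close>

lemma finite_splits: "finite (splits a)"
proof -
  have fin: "finite {b :: nat^4. b \<le> a}"
  proof (rule finite_subset)
    show "{b :: nat^4. b \<le> a} \<subseteq> vec_lambda ` (Pi\<^sub>E UNIV (\<lambda>i. {..a$i}))"
    proof
      fix b :: "nat^4" assume "b \<in> {b. b \<le> a}"
      then have "vec_nth b \<in> Pi\<^sub>E UNIV (\<lambda>i. {..a$i})" by (auto simp: less_eq_vec_def)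
      then show "b \<in> vec_lambda ` (Pi\<^sub>E UNIV (\<lambda>i. {..a$i}))"
        by (intro image_eqI[of _ _ "vec_nth b"]) auto
    qed
    show "finite (vec_lambda ` (Pi\<^sub>E UNIV (\<lambda>i. {..a$i})) :: (nat^4) set)"
      by (intro finite_imageI finite_PiE) auto
  qed
  have "splits a \<subseteq> {b. b \<le> a} \<times> {b. b \<le> a}"
    by (auto simp: splits_def less_eq_vec_def intro: add_leD1 add_leD2)
  then show ?thesis using fin by (meson finite_SigmaI finite_subset)
qed


section \<open>The quasilinear exterior problem\<close>

definition null_condition :: "(nat \<Rightarrow> nat \<Rightarrow> nat \<Rightarrow> real) \<Rightarrow> bool" where
  "null_condition Q \<longleftrightarrow> (\<forall>\<xi> :: nat \<Rightarrow> real. \<xi> 0 \<in> {1, -1} \<and> (\<xi> 1)\<^sup>2 + (\<xi> 2)\<^sup>2 = 1 \<longrightarrow>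
     (\<Sum>\<alpha>\<le>2. \<Sum>\<beta>\<le>2. \<Sum>\<gamma>\<le>2. Q \<alpha> \<beta> \<gamma> * \<xi> \<alpha> * \<xi> \<beta> * \<xi> \<gamma>) = 0)"

text \<open>Smoothness of \<open>u\<close> is smoothness up to the boundary of \<open>[0,\<infinity>) \<times> K\<close>, that is, \<open>u\<close> is given
  as a smooth function on some open neighbourhood of \<open>[0,\<infinity>) \<times> closure K\<close>.  The derivatives of \<open>u\<close>
  on this closed set do not depend on the chosen extension, and the equation is only imposed
  on \<open>[0,\<infinity>) \<times> K\<close>.\<close>

definition is_solution ::
  "(real^2) set \<Rightarrow> (nat \<Rightarrow> nat \<Rightarrow> nat \<Rightarrow> real) \<Rightarrow> real \<Rightarrow> (real^2 \<Rightarrow> real) \<Rightarrow> (real^2 \<Rightarrow> real) \<Rightarrow> scalar_field \<Rightarrow> bool"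
  where
  "is_solution K Q \<epsilon> u\<^sub>0 u\<^sub>1 u \<longleftrightarrow>
     (\<exists>W. open W \<and> {0..} \<times> closure K \<subseteq> W \<and> smooth_on W u) \<and>
     (\<forall>z\<in>{0..} \<times> K. \<box> u z =
        (\<Sum>\<alpha>\<le>2. \<Sum>\<beta>\<le>2. \<Sum>\<gamma>\<le>2. Q \<alpha> \<beta> \<gamma> * \<partial> \<alpha> (\<partial> \<beta> u) z * \<partial> \<gamma> u z)) \<and>
     (\<forall>z\<in>{0..} \<times> frontier K. u z = 0) \<and>
     (\<forall>x\<in>K. u (0, x) = \<epsilon> * u\<^sub>0 x \<and> \<partial> 0 u (0, x) = \<epsilon> * u\<^sub>1 x)"

definition V ::
  "(real \<Rightarrow> real) \<Rightarrow> (nat^4 \<Rightarrow> nat^4 \<Rightarrow> nat \<Rightarrow> real^2 \<Rightarrow> real) \<Rightarrow> nat^4 \<Rightarrow> scalar_field \<Rightarrow> scalar_field" where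
  "V \<eta> C0 a u = (\<lambda>z. Ztpow \<eta> a u z - 1/2 * (\<Sum>(b,c)\<in>splits a. \<Sum>\<mu>\<le>2.
     C0 b c \<mu> (ang z) * \<eta> (rad z) * \<partial> \<mu> (Zpow b u) z * Zpow c u z))"

end

theory Submission
  imports Defs
begin

text \<open>All \<open>Z\<close> commute with \<open>\<box>\<close>, the translations preserve null forms with constant coefficients and the
  rotation acts on their coefficients; so \<open>\<box> Z\<^sup>a u\<close> is a sum of null forms in \<open>Z\<^sup>b u\<close> and \<open>Z\<^sup>c u\<close>. The space of
  null forms in \<open>(v, w)\<close> is spanned by \<open>Q\<^sub>0(\<partial>\<^sub>\<mu> v, w)\<close>, \<open>Q\<^sub>1\<^sub>2(\<partial>\<^sub>\<mu> v, w)\<close>, \<open>\<box>v \<partial>\<^sub>\<mu> w\<close> and the two trace-free forms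
  \<open>\<sigma>\<^sub>i\<^sub>j (\<partial>\<^sub>i \<partial>\<^sub>t v \<partial>\<^sub>j w - \<partial>\<^sub>i \<partial>\<^sub>j v \<partial>\<^sub>t w)\<close>. In polar coordinates a trace-free form is
  \<open>\<sigma>(\<omega>,\<omega>) (\<box>v \<partial>\<^sub>t w - Q\<^sub>0(\<partial>\<^sub>t v, w))\<close> plus \<open>|x|\<^sup>-\<^sup>1\<close> times terms with a factor \<open>\<Omega>\<close>. Writing these terms, and
  \<open>Q\<^sub>1\<^sub>2\<close>, as divergences, all remaining terms of the form \<open>|x|\<^sup>-\<^sup>1 \<partial>\<^sup>2v w\<close> and \<open>|x|\<^sup>-\<^sup>1 \<Omega>\<partial>\<^sup>2v w\<close> cancel, and only
  a term of order \<open>|x|\<^sup>-\<^sup>2\<close> is left. The quadratic correction in \<open>V\<close> removes the \<open>Q\<^sub>0\<close> terms since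
  \<open>2 Q\<^sub>0(f, g) = \<box>(f g) - f \<box>g - g \<box>f\<close>.\<close>

subsection \<open>Smooth functions\<close>

text \<open>The coefficients must be the same for all solutions, so the identities are proved for
  arbitrary smooth functions on open sets, with the coefficients fixed before the function. While
  the vector fields are applied, null forms are carried as constant tensors, a class closed under
  every \<open>Z j\<close>. Polynomials in \<omega> and powers of |x| enter only afterwards;
  otherwise the translations would have to differentiate them. The count behind the decomposition:
  second derivatives commute, so a form in (v, w) has 18 coefficients. Cubic forms in three
  variables have dimension 10, and those vanishing on the light cone are its quadratic form times a
  linear form, of dimension 3; so nullity costs 7 equations and leaves dimension 11. The
  constant-coefficient forms built from \<open>Q0\<close>, \<open>Q12\<close> and \<open>box\<close>
  supply nine. The missing two correspond to trace-free symmetric 2x2 matrices, that is, to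
  harmonics of degree two on the circle, and they are the source of the coefficients that depend on
  \<omega>.\<close>

lemma Ck_on_cong:
  assumes "open W" "\<And>z. z \<in> W \<Longrightarrow> f z = g z"
  shows "Ck_on k W f \<longleftrightarrow> Ck_on k W g"
  using assms(2)
proof (induction k arbitrary: f g)
  case 0
  then show ?case by (simp cong: continuous_on_cong)
next
  case (Suc k)
  have fd: "frechet_derivative f (at z) = frechet_derivative g (at z)"
    if "\<And>z. z \<in> W \<Longrightarrow> f z = g z" "z \<in> W" "f differentiable at z" for z and f g :: "'a \<Rightarrow> 'b"
    using frechet_derivative_transform_within_open[OF that(3) assms(1) that(2)] that(1) by metis
  have dd: "g differentiable at z"
    if "\<And>z. z \<in> W \<Longrightarrow> f z = g z" "z \<in> W" "f differentiable at z" for z and f g :: "'a \<Rightarrow> 'b"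
    using that has_derivative_transform_within_open[OF _ assms(1) that(2), of f _ UNIV g]
    unfolding differentiable_def by blast
  have iff: "Ck_on (Suc k) W g"
    if "\<And>z. z \<in> W \<Longrightarrow> f z = g z" "Ck_on (Suc k) W f" for f g :: "'a \<Rightarrow> 'b"
  proof -
    have "Ck_on k W (\<lambda>z. frechet_derivative g (at z) v)" for v
    proof -
      have "Ck_on k W (\<lambda>z. frechet_derivative f (at z) v)" using that(2) by simp
      then show ?thesis
        using Suc.IH[of "\<lambda>z. frechet_derivative f (at z) v" "\<lambda>z. frechet_derivative g (at z) v"]
          fd[OF that(1)] that(2) by simp
    qed
    moreover have "\<forall>z\<in>W. g differentiable at z" using dd[OF that(1)] that(2) by simp
    ultimately show ?thesis by simp
  qed
  show ?case using iff[of f g, OF Suc.prems] iff[of g f, OF Suc.prems[symmetric]] by blast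
qed

lemma Ck_on_Suc_D: "Ck_on (Suc k) W f \<Longrightarrow> Ck_on k W f"
proof (induction k arbitrary: f)
  case 0
  then show ?case
    by (simp add: continuous_at_imp_continuous_on differentiable_imp_continuous_within)
qed auto

lemma Ck_on_SucI:
  assumes "open W" "\<And>z. z \<in> W \<Longrightarrow> (f has_derivative f' z) (at z)"
    "\<And>v. Ck_on k W (\<lambda>z. f' z v)"
  shows "Ck_on (Suc k) W f"
proof -
  have "frechet_derivative f (at z) v = f' z v" if "z \<in> W" for z v
    using frechet_derivative_at[OF assms(2)[OF that]] by simp
  then have "Ck_on k W (\<lambda>z. frechet_derivative f (at z) v)" for v
    using Ck_on_cong[OF assms(1), of "\<lambda>z. frechet_derivative f (at z) v" "\<lambda>z. f' z v"] assms(3) by simp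
  then show ?thesis using assms(2) by (auto intro: differentiableI)
qed

lemma Ck_on_Suc_E:
  assumes "Ck_on (Suc k) W f"
  shows "z \<in> W \<Longrightarrow> (f has_derivative frechet_derivative f (at z)) (at z)"
    "Ck_on k W (\<lambda>z. frechet_derivative f (at z) v)"
  using assms by (auto simp: frechet_derivative_works[symmetric])

lemma Ck_on_subset: "Ck_on k W f \<Longrightarrow> U \<subseteq> W \<Longrightarrow> Ck_on k U f"
  by (induction k arbitrary: f) (auto intro: continuous_on_subset)

lemma frechet_derivative_plus:
  "f differentiable at z \<Longrightarrow> g differentiable at z \<Longrightarrow>
    frechet_derivative (\<lambda>z. f z + g z) (at z) v = frechet_derivative f (at z) v + frechet_derivative g (at z) v"
  using has_derivative_add[of f "frechet_derivative f (at z)" "at z" g "frechet_derivative g (at z)",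
      THEN frechet_derivative_at]
  by (simp add: frechet_derivative_works fun_eq_iff)

lemma frechet_derivative_times:
  fixes f g :: "'a::real_normed_vector \<Rightarrow> real"
  assumes "f differentiable at z" "g differentiable at z"
  shows "frechet_derivative (\<lambda>z. f z * g z) (at z) v =
    f z * frechet_derivative g (at z) v + frechet_derivative f (at z) v * g z"
  using has_derivative_mult[OF assms[unfolded frechet_derivative_works], THEN frechet_derivative_at]
  by (simp add: fun_eq_iff)

lemma frechet_derivative_comp:
  fixes f :: "'a::real_normed_vector \<Rightarrow> real" and \<eta> :: "real \<Rightarrow> real"
  assumes "f differentiable at z" "\<eta> differentiable at (f z)"
  shows "frechet_derivative (\<lambda>z. \<eta> (f z)) (at z) v =
    frechet_derivative f (at z) v * frechet_derivative \<eta> (at (f z)) 1"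
proof -
  have "frechet_derivative (\<lambda>z. \<eta> (f z)) (at z) v =
    frechet_derivative \<eta> (at (f z)) (frechet_derivative f (at z) v *\<^sub>R 1)"
    using frechet_derivative_compose[OF assms] by (simp add: o_def)
  also have "\<dots> = frechet_derivative f (at z) v * frechet_derivative \<eta> (at (f z)) 1"
    by (subst linear_scale[OF linear_frechet_derivative[OF assms(2)]]) simp
  finally show ?thesis .
qed

lemma Ck_on_const: "Ck_on k W (\<lambda>_. c)"
  by (induction k arbitrary: c) auto

lemma Ck_on_linear: "bounded_linear f \<Longrightarrow> Ck_on k W f"
proof (induction k)
  case 0
  then show ?case by (simp add: linear_continuous_on)
next
  case (Suc k)
  have "frechet_derivative f (at z) = f" for z
    using frechet_derivative_at[OF bounded_linear_imp_has_derivative[OF Suc.prems]] by (rule sym)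
  then show ?case by (auto simp: Ck_on_const bounded_linear_imp_differentiable[OF Suc.prems])
qed

lemma Ck_on_add:
  assumes W: "open W" shows "Ck_on k W f \<Longrightarrow> Ck_on k W g \<Longrightarrow> Ck_on k W (\<lambda>z. f z + g z)"
proof (induction k arbitrary: f g)
  case 0
  then show ?case by (simp add: continuous_on_add)
next
  case (Suc k)
  note f = Ck_on_Suc_E[OF Suc.prems(1)] and g = Ck_on_Suc_E[OF Suc.prems(2)]
  show ?case
    by (rule Ck_on_SucI[OF W has_derivative_add[OF f(1) g(1)] Suc.IH[OF f(2) g(2)]])
qed

lemma Ck_on_mult:
  fixes f g :: "'a::real_normed_vector \<Rightarrow> real"
  assumes W: "open W" shows "Ck_on k W f \<Longrightarrow> Ck_on k W g \<Longrightarrow> Ck_on k W (\<lambda>z. f z * g z)"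
proof (induction k arbitrary: f g)
  case 0
  then show ?case by (simp add: continuous_on_mult)
next
  case (Suc k)
  note f = Ck_on_Suc_E[OF Suc.prems(1)] and g = Ck_on_Suc_E[OF Suc.prems(2)]
  show ?case
    by (rule Ck_on_SucI[OF W has_derivative_mult[OF f(1) g(1)]],
        assumption, assumption,
        rule Ck_on_add[OF W Suc.IH[OF Ck_on_Suc_D[OF Suc.prems(1)] g(2)] Suc.IH[OF f(2) Ck_on_Suc_D[OF Suc.prems(2)]]])
qed

lemma Ck_on_inverse:
  fixes f :: "'a::real_normed_vector \<Rightarrow> real"
  assumes W: "open W" and nz: "\<And>z. z \<in> W \<Longrightarrow> f z \<noteq> 0"
  shows "Ck_on k W f \<Longrightarrow> Ck_on k W (\<lambda>z. inverse (f z))"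
proof (induction k)
  case 0
  then show ?case using nz by (simp add: continuous_on_inverse)
next
  case (Suc k)
  note f = Ck_on_Suc_E[OF Suc.prems]
  have inv: "Ck_on k W (\<lambda>z. inverse (f z))" using Suc Ck_on_Suc_D by blast
  have "Ck_on k W (\<lambda>z. - 1 * (inverse (f z) * frechet_derivative f (at z) v * inverse (f z)))" for v
    by (intro Ck_on_mult[OF W] Ck_on_const inv f(2))
  then have "Ck_on k W (\<lambda>z. - (inverse (f z) * frechet_derivative f (at z) v * inverse (f z)))" for v
    by simp
  note inv' = this
  show ?case
    by (rule Ck_on_SucI[OF W Deriv.has_derivative_inverse[OF nz f(1)] inv'])
qed

lemma Ck_on_comp:
  fixes f :: "'a::real_normed_vector \<Rightarrow> real"
  assumes W: "open W"
  shows "Ck_on k UNIV \<eta> \<Longrightarrow> Ck_on k W f \<Longrightarrow> Ck_on k W (\<lambda>z. \<eta> (f z) :: real)"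
proof (induction k arbitrary: \<eta>)
  case 0
  then show ?case using continuous_on_compose2[of UNIV \<eta> W f] by simp
next
  case (Suc k)
  note f = Ck_on_Suc_E[OF Suc.prems(2)] and \<eta> = Ck_on_Suc_E[OF Suc.prems(1)]
  have D: "((\<lambda>z. \<eta> (f z)) has_derivative
      (\<lambda>v. frechet_derivative f (at z) v * frechet_derivative \<eta> (at (f z)) 1)) (at z)" if "z \<in> W" for z
  proof -
    have "frechet_derivative \<eta> (at (f z)) c = c * frechet_derivative \<eta> (at (f z)) 1" for c
      using linear_scale[OF has_derivative_linear[OF \<eta>(1)], of "f z" c 1] by simp
    then have "(\<lambda>v. frechet_derivative \<eta> (at (f z)) (frechet_derivative f (at z) v)) =
        (\<lambda>v. frechet_derivative f (at z) v * frechet_derivative \<eta> (at (f z)) 1)"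
      by (rule ext)
    then show ?thesis
      using has_derivative_compose[OF f(1)[OF that] \<eta>(1)] by (simp only: UNIV_I)
  qed
  show ?case
    by (rule Ck_on_SucI[OF W D Ck_on_mult[OF W f(2) Suc.IH[OF \<eta>(2) Ck_on_Suc_D[OF Suc.prems(2)]]]])
qed

lemma smooth_on_cong:
  "open W \<Longrightarrow> (\<And>z. z \<in> W \<Longrightarrow> f z = g z) \<Longrightarrow> smooth_on W f \<Longrightarrow> smooth_on W g"
  by (metis Ck_on_cong smooth_on_def)

lemma smooth_on_subset: "smooth_on W f \<Longrightarrow> U \<subseteq> W \<Longrightarrow> smooth_on U f"
  by (auto simp: smooth_on_def intro: Ck_on_subset)

lemma smooth_on_differentiable: "smooth_on W f \<Longrightarrow> z \<in> W \<Longrightarrow> f differentiable at z"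
  unfolding smooth_on_def using Ck_on.simps(2) by blast

lemma smooth_on_continuous_on: "smooth_on W f \<Longrightarrow> continuous_on W f"
  unfolding smooth_on_def using Ck_on.simps(1) by blast

lemma smooth_on_frechet_derivative:
  "smooth_on W f \<Longrightarrow> smooth_on W (\<lambda>z. frechet_derivative f (at z) v)"
  unfolding smooth_on_def using Ck_on.simps(2) by blast

lemma smooth_on_const: "smooth_on W (\<lambda>_. c)"
  by (simp add: smooth_on_def Ck_on_const)

lemma smooth_on_linear: "bounded_linear f \<Longrightarrow> smooth_on W f"
  by (simp add: smooth_on_def Ck_on_linear)

lemma smooth_on_add:
  "open W \<Longrightarrow> smooth_on W f \<Longrightarrow> smooth_on W g \<Longrightarrow> smooth_on W (\<lambda>z. f z + g z)"
  by (simp add: smooth_on_def Ck_on_add)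

lemma smooth_on_mult:
  fixes f g :: "'a::real_normed_vector \<Rightarrow> real"
  shows "open W \<Longrightarrow> smooth_on W f \<Longrightarrow> smooth_on W g \<Longrightarrow> smooth_on W (\<lambda>z. f z * g z)"
  by (simp add: smooth_on_def Ck_on_mult)

lemma smooth_on_minus:
  fixes f :: "'a::real_normed_vector \<Rightarrow> real"
  shows "open W \<Longrightarrow> smooth_on W f \<Longrightarrow> smooth_on W (\<lambda>z. - f z)"
  using smooth_on_mult[of W "\<lambda>_. -1" f] by (simp add: smooth_on_const)

lemma smooth_on_diff:
  fixes f g :: "'a::real_normed_vector \<Rightarrow> real"
  shows "open W \<Longrightarrow> smooth_on W f \<Longrightarrow> smooth_on W g \<Longrightarrow> smooth_on W (\<lambda>z. f z - g z)"
  using smooth_on_add[of W f "\<lambda>z. - g z"] by (simp add: smooth_on_minus)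

lemma smooth_on_inverse:
  fixes f :: "'a::real_normed_vector \<Rightarrow> real"
  shows "open W \<Longrightarrow> (\<And>z. z \<in> W \<Longrightarrow> f z \<noteq> 0) \<Longrightarrow> smooth_on W f \<Longrightarrow> smooth_on W (\<lambda>z. inverse (f z))"
  by (simp add: smooth_on_def Ck_on_inverse)

lemma smooth_on_divide:
  fixes f g :: "'a::real_normed_vector \<Rightarrow> real"
  shows "open W \<Longrightarrow> (\<And>z. z \<in> W \<Longrightarrow> g z \<noteq> 0) \<Longrightarrow> smooth_on W f \<Longrightarrow> smooth_on W g \<Longrightarrow>
    smooth_on W (\<lambda>z. f z / g z)"
  using smooth_on_mult[of W f "\<lambda>z. inverse (g z)"] by (simp add: smooth_on_inverse divide_inverse)

lemma smooth_on_power: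
  fixes f :: "'a::real_normed_vector \<Rightarrow> real"
  shows "open W \<Longrightarrow> smooth_on W f \<Longrightarrow> smooth_on W (\<lambda>z. f z ^ n)"
  by (induction n) (auto intro: smooth_on_mult smooth_on_const)

lemma smooth_on_sum:
  assumes "open W" "\<And>i. i \<in> I \<Longrightarrow> smooth_on W (f i)"
  shows "smooth_on W (\<lambda>z. \<Sum>i\<in>I. f i z)"
  using assms(2) by (induction I rule: infinite_finite_induct)
    (auto intro: smooth_on_const smooth_on_add[OF assms(1)])

lemma smooth_on_comp:
  fixes f :: "'a::real_normed_vector \<Rightarrow> real" and \<eta> :: "real \<Rightarrow> real"
  shows "open W \<Longrightarrow> smooth_on UNIV \<eta> \<Longrightarrow> smooth_on W f \<Longrightarrow> smooth_on W (\<lambda>z. \<eta> (f z))"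
  by (simp add: smooth_on_def Ck_on_comp)

text \<open>The derivative f' / (2 sqrt f) contains the root itself, so C^k regularity of the root
  yields C^(k+1). This bootstrap stands in for \<open>smooth_on_comp\<close>, which asks for an
  outer function that is smooth on the whole line.\<close>

lemma smooth_on_sqrt:
  fixes f :: "'a::real_normed_vector \<Rightarrow> real"
  assumes W: "open W" and pos: "\<And>z. z \<in> W \<Longrightarrow> f z > 0" and f: "smooth_on W f"
  shows "smooth_on W (\<lambda>z. sqrt (f z))"
proof -
  have hd: "((\<lambda>z. sqrt (f z)) has_derivative
      (\<lambda>v. frechet_derivative f (at z) v * (inverse (sqrt (f z)) * (1/2)))) (at z)" if "z \<in> W" for z
    using DERIV_compose_FDERIV[OF DERIV_real_sqrt[OF pos[OF that]]
        smooth_on_differentiable[OF f that, unfolded frechet_derivative_works]]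
    by simp
  have "Ck_on k W (\<lambda>z. sqrt (f z))" for k
  proof (induction k)
    case 0
    then show ?case using smooth_on_continuous_on[OF f] by (simp add: continuous_on_real_sqrt)
  next
    case (Suc k)
    have nz: "sqrt (f z) \<noteq> 0" if "z \<in> W" for z using pos[OF that] by simp
    have fd: "Ck_on k W (\<lambda>z. frechet_derivative f (at z) v)" for v
      using smooth_on_frechet_derivative[OF f] by (simp add: smooth_on_def)
    show ?case
      by (rule Ck_on_SucI[OF W hd]) (simp, intro Ck_on_mult[OF W] Ck_on_inverse[OF W] Suc Ck_on_const fd nz)
  qed
  then show ?thesis by (simp add: smooth_on_def)
qed

text \<open>Schwarz's theorem: the second difference of \<open>f\<close> over the parallelogram spanned by \<open>h v\<close> and
  \<open>h w\<close> is symmetric in \<open>v\<close> and \<open>w\<close>, and by the mean value theorem it is \<open>h\<^sup>2\<close> times a mixed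
  second derivative at a nearby point, in either order of differentiation.\<close>

lemma second_difference:
  fixes f :: "'a::real_normed_vector \<Rightarrow> real"
  assumes sm: "smooth_on W f" and h: "h > 0"
    and sub: "\<And>s t. 0 \<le> s \<Longrightarrow> s \<le> h \<Longrightarrow> 0 \<le> t \<Longrightarrow> t \<le> h \<Longrightarrow> z + s *\<^sub>R v + t *\<^sub>R w \<in> W"
  obtains s t where "0 < s" "s < h" "0 < t" "t < h"
    "f (z + h *\<^sub>R v + h *\<^sub>R w) - f (z + h *\<^sub>R v) - f (z + h *\<^sub>R w) + f z =
      h\<^sup>2 * frechet_derivative (\<lambda>y. frechet_derivative f (at y) v) (at (z + s *\<^sub>R v + t *\<^sub>R w)) w"
proof -
  have der: "((\<lambda>s. g (p + s *\<^sub>R e)) has_real_derivative frechet_derivative g (at (p + s *\<^sub>R e)) e) (at s)"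
    if "smooth_on W g" "p + s *\<^sub>R e \<in> W" for g :: "'a \<Rightarrow> real" and p e s
  proof -
    let ?D = "frechet_derivative g (at (p + s *\<^sub>R e))"
    have "(g has_derivative ?D) (at (p + s *\<^sub>R e))"
      using smooth_on_differentiable[OF that] by (simp add: frechet_derivative_works)
    moreover have "((\<lambda>s. p + s *\<^sub>R e) has_derivative (\<lambda>s. s *\<^sub>R e)) (at s)"
      by (auto intro!: derivative_eq_intros)
    ultimately have "((\<lambda>s. g (p + s *\<^sub>R e)) has_derivative (\<lambda>s. ?D (s *\<^sub>R e))) (at s)"
      using has_derivative_compose by blast
    moreover have "(\<lambda>s. ?D (s *\<^sub>R e)) = (*) (?D e)"
      using linear_scale[OF linear_frechet_derivative[OF smooth_on_differentiable[OF that]]]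
      by (auto simp: fun_eq_iff)
    ultimately show ?thesis by (simp add: has_field_derivative_def)
  qed
  let ?g = "\<lambda>s. f ((z + h *\<^sub>R w) + s *\<^sub>R v) - f (z + s *\<^sub>R v)"
  let ?fv = "\<lambda>y. frechet_derivative f (at y) v"
  have "\<exists>s. s > 0 \<and> s < h \<and> ?g h - ?g 0 = (h - 0) *
      (?fv ((z + h *\<^sub>R w) + s *\<^sub>R v) - ?fv (z + s *\<^sub>R v))"
  proof (rule MVT2[OF h])
    fix s assume "0 \<le> s" "s \<le> h"
    then show "(?g has_real_derivative ?fv ((z + h *\<^sub>R w) + s *\<^sub>R v) - ?fv (z + s *\<^sub>R v)) (at s)"
      using sub[of s h] sub[of s 0] h
      by (intro DERIV_diff der[OF sm]) (auto simp: algebra_simps)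
  qed
  then obtain s where s: "0 < s" "s < h"
    and 1: "?g h - ?g 0 = h * (?fv ((z + h *\<^sub>R w) + s *\<^sub>R v) - ?fv (z + s *\<^sub>R v))" by auto
  have "\<exists>t. t > 0 \<and> t < h \<and> ?fv ((z + s *\<^sub>R v) + h *\<^sub>R w) - ?fv ((z + s *\<^sub>R v) + 0 *\<^sub>R w) =
      (h - 0) * frechet_derivative ?fv (at ((z + s *\<^sub>R v) + t *\<^sub>R w)) w"
    using s sub by (intro MVT2[OF h] der[OF smooth_on_frechet_derivative[OF sm]]) auto
  then obtain t where t: "0 < t" "t < h"
    and 2: "?fv ((z + s *\<^sub>R v) + h *\<^sub>R w) - ?fv (z + s *\<^sub>R v) =
      h * frechet_derivative ?fv (at ((z + s *\<^sub>R v) + t *\<^sub>R w)) w" by auto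
  have e: "(z + h *\<^sub>R w) + s *\<^sub>R v = (z + s *\<^sub>R v) + h *\<^sub>R w" for s by simp
  show ?thesis
    using that[OF s t] 1 unfolding e 2 by (simp add: power2_eq_square algebra_simps)
qed

lemma frechet_derivative_commute:
  fixes f :: "'a::real_normed_vector \<Rightarrow> real"
  assumes W: "open W" "z \<in> W" and sm: "smooth_on W f"
  shows "frechet_derivative (\<lambda>y. frechet_derivative f (at y) v) (at z) w =
    frechet_derivative (\<lambda>y. frechet_derivative f (at y) w) (at z) v" (is "?F z = ?G z")
proof -
  have cont: "isCont ?F z" "isCont ?G z"
    using smooth_on_continuous_on[OF smooth_on_frechet_derivative[OF smooth_on_frechet_derivative[OF sm]]] W
    by (auto simp: continuous_on_eq_continuous_at)
  have "dist (?F z) (?G z) \<le> e" if "e > 0" for e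
  proof -
    obtain d where d: "d > 0" "ball z d \<subseteq> W" "\<And>y. dist y z < d \<Longrightarrow> dist (?F y) (?F z) < e/2"
      "\<And>y. dist y z < d \<Longrightarrow> dist (?G y) (?G z) < e/2"
    proof -
      obtain d1 where "d1 > 0" "ball z d1 \<subseteq> W" using W open_contains_ball by blast
      moreover obtain d2 where "d2 > 0" "\<And>y. dist y z < d2 \<Longrightarrow> dist (?F y) (?F z) < e/2"
        using cont(1) \<open>e > 0\<close> half_gt_zero unfolding continuous_at_eps_delta by blast
      moreover obtain d3 where "d3 > 0" "\<And>y. dist y z < d3 \<Longrightarrow> dist (?G y) (?G z) < e/2"
        using cont(2) \<open>e > 0\<close> half_gt_zero unfolding continuous_at_eps_delta by blast
      ultimately show ?thesis using that[of "min d1 (min d2 d3)"] by (auto simp: subset_iff)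
    qed
    \<comment> \<open>With this h the whole parallelogram stays within distance d/2 of z; the
      summand 1 keeps the denominator positive when v and w vanish.\<close>
    define h where "h = d / (2 * (norm v + norm w + 1))"
    have pos: "norm v + norm w + 1 > 0" by (meson add_nonneg_pos norm_ge_zero add_nonneg_nonneg zero_less_one)
    then have h: "h > 0" using d(1) by (simp add: h_def)
    have near: "dist (z + s *\<^sub>R v + t *\<^sub>R w) z < d" if "0 \<le> s" "s \<le> h" "0 \<le> t" "t \<le> h" for s t
    proof -
      have "dist (z + s *\<^sub>R v + t *\<^sub>R w) z = norm (s *\<^sub>R v + t *\<^sub>R w)" by (simp add: dist_norm)
      also have "\<dots> \<le> s * norm v + t * norm w"
        using that norm_triangle_ineq[of "s *\<^sub>R v" "t *\<^sub>R w"] by simp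
      also have "\<dots> \<le> h * norm v + h * norm w"
        using that by (intro add_mono mult_right_mono) auto
      also have "\<dots> \<le> h * (norm v + norm w + 1)" using h by (simp add: algebra_simps)
      also have "\<dots> = d / 2" using pos by (simp add: h_def field_simps)
      also have "\<dots> < d" using d(1) by simp
      finally show ?thesis .
    qed
    have e1: "z + s *\<^sub>R w + t *\<^sub>R v = z + t *\<^sub>R v + s *\<^sub>R w" for s t by simp
    obtain s t where st: "0 < s" "s < h" "0 < t" "t < h" and
      F: "f (z + h *\<^sub>R v + h *\<^sub>R w) - f (z + h *\<^sub>R v) - f (z + h *\<^sub>R w) + f z =
        h\<^sup>2 * ?F (z + s *\<^sub>R v + t *\<^sub>R w)"
    proof (rule second_difference[OF sm h, of z v w])
      show "z + s *\<^sub>R v + t *\<^sub>R w \<in> W" if "0 \<le> s" "s \<le> h" "0 \<le> t" "t \<le> h" for s t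
        using near[OF that] d(2) by (auto simp: dist_commute)
    qed
    obtain s' t' where st': "0 < s'" "s' < h" "0 < t'" "t' < h" and
      G: "f (z + h *\<^sub>R w + h *\<^sub>R v) - f (z + h *\<^sub>R w) - f (z + h *\<^sub>R v) + f z =
        h\<^sup>2 * ?G (z + s' *\<^sub>R w + t' *\<^sub>R v)"
    proof (rule second_difference[OF sm h, of z w v])
      show "z + s *\<^sub>R w + t *\<^sub>R v \<in> W" if "0 \<le> s" "s \<le> h" "0 \<le> t" "t \<le> h" for s t
        unfolding e1 using near[OF that(3,4,1,2)] d(2) by (auto simp: dist_commute)
    qed
    have "?F (z + s *\<^sub>R v + t *\<^sub>R w) = ?G (z + t' *\<^sub>R v + s' *\<^sub>R w)"
    proof -
      have "h\<^sup>2 * ?F (z + s *\<^sub>R v + t *\<^sub>R w) = h\<^sup>2 * ?G (z + t' *\<^sub>R v + s' *\<^sub>R w)"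
        using F G unfolding e1 by linarith
      then show ?thesis using h by simp
    qed
    moreover have "dist (?F (z + s *\<^sub>R v + t *\<^sub>R w)) (?F z) < e/2"
      using d(3) near st by auto
    moreover have "dist (?G (z + t' *\<^sub>R v + s' *\<^sub>R w)) (?G z) < e/2"
      using d(4) near st' by auto
    ultimately show ?thesis
      using dist_triangle[of "?F z" "?G z" "?F (z + s *\<^sub>R v + t *\<^sub>R w)"]
      by (simp add: dist_commute)
  qed
  then have "dist (?F z) (?G z) \<le> 0" by (rule field_le_epsilon) simp
  then show ?thesis by simp
qed

subsection \<open>Partial derivatives\<close>

text \<open>\<open>frechet_derivative\<close> is a choice among all candidates, and near z both
  functions have the same candidates. Hence no differentiability is assumed, and the congruence
  rules for \<partial>, \<Omega> and \<open>Z\<close> hold unconditionally.\<close>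

lemma frechet_derivative_cong_open:
  assumes "open U" "z \<in> U" "\<And>y. y \<in> U \<Longrightarrow> f y = g y"
  shows "frechet_derivative f (at z) = frechet_derivative g (at z)"
proof -
  have "(f has_derivative D) (at z) \<longleftrightarrow> (g has_derivative D) (at z)" for D
    using has_derivative_transform_within_open[OF _ assms(1,2), of f D UNIV g]
      has_derivative_transform_within_open[OF _ assms(1,2), of g D UNIV f] assms(3) by auto
  then show ?thesis by (simp add: frechet_derivative_def)
qed

lemma pd_const [simp]: "\<partial> \<mu> (\<lambda>z. c) = (\<lambda>z. 0)"
  by (simp add: pd_def)

lemma dir_simps: "dir 0 = (1, 0)" "dir 1 = (0, axis 1 1)" "dir (Suc 0) = (0, axis 1 1)" "dir 2 = (0, axis 2 1)"
  by (simp_all add: dir_def)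

lemma axis_2_simps: "axis (1::2) (1::real) $ 1 = 1" "axis (1::2) (1::real) $ 2 = 0"
    "axis (2::2) (1::real) $ 1 = 0" "axis (2::2) (1::real) $ 2 = 1"
  by (simp_all add: axis_def)

lemma Q0_unfold: "Q0 f g z = \<partial> 0 f z * \<partial> 0 g z - (\<partial> 1 f z * \<partial> 1 g z + \<partial> 2 f z * \<partial> 2 g z)"
  by (simp add: Q0_def numeral_2_eq_2 sum.atLeast_Suc_atMost)

lemma pd_nth: "\<partial> \<mu> (\<lambda>z. snd z $ i) z = snd (dir \<mu>) $ i"
proof -
  have "((\<lambda>z::spacetime. snd z $ i) has_derivative (\<lambda>z. snd z $ i)) (at z)"
    by (intro bounded_linear_imp_has_derivative bounded_linear_compose[OF bounded_linear_vec_nth bounded_linear_snd])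
  from frechet_derivative_at[OF this] show ?thesis by (metis pd_def)
qed

context
  fixes U :: "spacetime set"
  assumes open_U: "open U"
begin

lemma pd_cong: "(\<And>y. y \<in> U \<Longrightarrow> f y = g y) \<Longrightarrow> z \<in> U \<Longrightarrow> \<partial> \<mu> f z = \<partial> \<mu> g z"
  unfolding pd_def using frechet_derivative_cong_open[OF open_U] by metis

lemma \<Delta>_cong: "(\<And>y. y \<in> U \<Longrightarrow> f y = g y) \<Longrightarrow> z \<in> U \<Longrightarrow> \<Delta> f z = \<Delta> g z"
  unfolding \<Delta>_def by (intro arg_cong2[where f = "(+)"] pd_cong)

lemma \<Omega>_cong: "(\<And>y. y \<in> U \<Longrightarrow> f y = g y) \<Longrightarrow> z \<in> U \<Longrightarrow> \<Omega> f z = \<Omega> g z"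
  unfolding \<Omega>_def using pd_cong[of f g] by simp

lemma Z_cong: "(\<And>y. y \<in> U \<Longrightarrow> f y = g y) \<Longrightarrow> z \<in> U \<Longrightarrow> Z j f z = Z j g z"
  unfolding Z_def using pd_cong[of f g] \<Omega>_cong[of f g] by simp

lemma funpow_cong_on:
  fixes L :: "scalar_field \<Rightarrow> scalar_field"
  assumes "\<And>f g z. (\<And>y. y \<in> U \<Longrightarrow> f y = g y) \<Longrightarrow> z \<in> U \<Longrightarrow> L f z = L g z"
    and "\<And>y. y \<in> U \<Longrightarrow> f y = g y"
  shows "z \<in> U \<Longrightarrow> (L ^^ n) f z = (L ^^ n) g z"
proof (induction n arbitrary: z)
  case (Suc n)
  then show ?case using assms(1)[of "(L ^^ n) f" "(L ^^ n) g" z] by simp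
qed (simp add: assms(2))

lemma Zpow_cong: "(\<And>y. y \<in> U \<Longrightarrow> f y = g y) \<Longrightarrow> z \<in> U \<Longrightarrow> Zpow a f z = Zpow a g z"
  unfolding Zpow_def by (intro funpow_cong_on Z_cong)

lemma smooth_on_pd: "smooth_on U f \<Longrightarrow> smooth_on U (\<partial> \<mu> f)"
  unfolding pd_def by (rule smooth_on_frechet_derivative)

lemma smooth_on_nth: "smooth_on U (\<lambda>z. snd z $ i)"
  by (intro smooth_on_linear bounded_linear_compose[OF bounded_linear_vec_nth bounded_linear_snd])

lemmas smooth_intros = smooth_on_const smooth_on_pd smooth_on_nth smooth_on_add[OF open_U]
  smooth_on_mult[OF open_U] smooth_on_diff[OF open_U] smooth_on_minus[OF open_U]
  smooth_on_power[OF open_U] smooth_on_sum[OF open_U]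

lemma smooth_on_\<Delta>: "smooth_on U f \<Longrightarrow> smooth_on U (\<Delta> f)"
  unfolding \<Delta>_def by (intro smooth_intros)

lemma smooth_on_box: "smooth_on U f \<Longrightarrow> smooth_on U (\<box> f)"
  unfolding box_def by (intro smooth_intros smooth_on_\<Delta>)

lemma smooth_on_\<Omega>: "smooth_on U f \<Longrightarrow> smooth_on U (\<Omega> f)"
  unfolding \<Omega>_def by (intro smooth_intros)

lemma smooth_on_Z: "smooth_on U f \<Longrightarrow> smooth_on U (Z j f)"
  unfolding Z_def by (auto intro: smooth_on_pd smooth_on_\<Omega>)

lemma smooth_on_funpow:
  fixes L :: "scalar_field \<Rightarrow> scalar_field"
  assumes "\<And>f. smooth_on U f \<Longrightarrow> smooth_on U (L f)"
  shows "smooth_on U f \<Longrightarrow> smooth_on U ((L ^^ n) f)"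
  using assms by (induction n) auto

lemma smooth_on_Zpow: "smooth_on U f \<Longrightarrow> smooth_on U (Zpow a f)"
  unfolding Zpow_def by (intro smooth_on_funpow smooth_on_Z)

lemma pd_add: "smooth_on U f \<Longrightarrow> smooth_on U g \<Longrightarrow> z \<in> U \<Longrightarrow>
    \<partial> \<mu> (\<lambda>z. f z + g z) z = \<partial> \<mu> f z + \<partial> \<mu> g z"
  unfolding pd_def by (intro frechet_derivative_plus smooth_on_differentiable)

lemma pd_mult: "smooth_on U f \<Longrightarrow> smooth_on U g \<Longrightarrow> z \<in> U \<Longrightarrow>
    \<partial> \<mu> (\<lambda>z. f z * g z) z = f z * \<partial> \<mu> g z + \<partial> \<mu> f z * g z"
  unfolding pd_def by (intro frechet_derivative_times smooth_on_differentiable)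

lemma pd_cmult: "smooth_on U f \<Longrightarrow> z \<in> U \<Longrightarrow> \<partial> \<mu> (\<lambda>z. c * f z) z = c * \<partial> \<mu> f z"
  using pd_mult[of "\<lambda>_. c" f z \<mu>] by (simp add: smooth_on_const)

lemma pd_minus: "smooth_on U f \<Longrightarrow> z \<in> U \<Longrightarrow> \<partial> \<mu> (\<lambda>z. - f z) z = - \<partial> \<mu> f z"
  using pd_cmult[of f z \<mu> "-1"] by simp

lemma pd_diff: "smooth_on U f \<Longrightarrow> smooth_on U g \<Longrightarrow> z \<in> U \<Longrightarrow>
    \<partial> \<mu> (\<lambda>z. f z - g z) z = \<partial> \<mu> f z - \<partial> \<mu> g z"
  using pd_add[of f "\<lambda>z. - g z" z \<mu>] pd_minus[of g z \<mu>] by (simp add: smooth_on_minus[OF open_U])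

lemma pd_commute: "smooth_on U f \<Longrightarrow> z \<in> U \<Longrightarrow> \<partial> \<mu> (\<partial> \<nu> f) z = \<partial> \<nu> (\<partial> \<mu> f) z"
  unfolding pd_def by (intro frechet_derivative_commute[OF open_U])

lemma pd_commute': "smooth_on U f \<Longrightarrow> z \<in> U \<Longrightarrow> \<partial> \<kappa> (\<partial> \<mu> (\<partial> \<nu> f)) z = \<partial> \<kappa> (\<partial> \<nu> (\<partial> \<mu> f)) z"
  by (intro pd_cong pd_commute)

lemma pd_commute3: "smooth_on U f \<Longrightarrow> z \<in> U \<Longrightarrow> \<partial> \<kappa> (\<partial> \<mu> (\<partial> \<nu> f)) z = \<partial> \<mu> (\<partial> \<nu> (\<partial> \<kappa> f)) z"
  using pd_commute[OF smooth_on_pd, of f z \<kappa> \<mu> \<nu>] pd_commute'[of f z \<mu> \<kappa> \<nu>] by simp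

lemma pd_pd_add:
  assumes f: "smooth_on U f" and g: "smooth_on U g" and z: "z \<in> U"
  shows "\<partial> \<nu> (\<partial> \<mu> (\<lambda>z. f z + g z)) z = \<partial> \<nu> (\<partial> \<mu> f) z + \<partial> \<nu> (\<partial> \<mu> g) z"
  using pd_cong[OF pd_add[OF f g] z, where \<mu> = \<nu>] pd_add[OF smooth_on_pd[OF f] smooth_on_pd[OF g] z] by simp

lemma pd_pd_mult:
  assumes f: "smooth_on U f" and g: "smooth_on U g" and z: "z \<in> U"
  shows "\<partial> \<nu> (\<partial> \<mu> (\<lambda>z. f z * g z)) z =
    f z * \<partial> \<nu> (\<partial> \<mu> g) z + \<partial> \<nu> f z * \<partial> \<mu> g z + \<partial> \<mu> f z * \<partial> \<nu> g z + \<partial> \<nu> (\<partial> \<mu> f) z * g z"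
  using pd_cong[OF pd_mult[OF f g] z, where \<mu> = \<nu>] f g z
  by (simp add: pd_add pd_mult smooth_intros)

lemma \<Delta>_add: "smooth_on U f \<Longrightarrow> smooth_on U g \<Longrightarrow> z \<in> U \<Longrightarrow> \<Delta> (\<lambda>z. f z + g z) z = \<Delta> f z + \<Delta> g z"
  by (simp add: \<Delta>_def pd_pd_add)

lemma \<Delta>_mult: "smooth_on U f \<Longrightarrow> smooth_on U g \<Longrightarrow> z \<in> U \<Longrightarrow>
    \<Delta> (\<lambda>z. f z * g z) z =
      f z * \<Delta> g z + \<Delta> f z * g z + 2 * (\<partial> 1 f z * \<partial> 1 g z + \<partial> 2 f z * \<partial> 2 g z)"
  by (simp add: \<Delta>_def pd_pd_mult algebra_simps)

lemma box_add: "smooth_on U f \<Longrightarrow> smooth_on U g \<Longrightarrow> z \<in> U \<Longrightarrow> \<box> (\<lambda>z. f z + g z) z = \<box> f z + \<box> g z"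
  by (simp add: box_def pd_pd_add \<Delta>_add)

lemma box_mult: "smooth_on U f \<Longrightarrow> smooth_on U g \<Longrightarrow> z \<in> U \<Longrightarrow>
    \<box> (\<lambda>z. f z * g z) z = f z * \<box> g z + \<box> f z * g z + 2 * Q0 f g z"
  by (simp add: box_def Q0_unfold \<Delta>_mult pd_pd_mult algebra_simps)

lemma box_cmult: "smooth_on U f \<Longrightarrow> z \<in> U \<Longrightarrow> \<box> (\<lambda>z. c * f z) z = c * \<box> f z"
  using box_mult[of "\<lambda>_. c" f z]
  by (simp add: smooth_on_const) (simp add: box_def \<Delta>_def Q0_unfold)

lemma box_diff: "smooth_on U f \<Longrightarrow> smooth_on U g \<Longrightarrow> z \<in> U \<Longrightarrow> \<box> (\<lambda>z. f z - g z) z = \<box> f z - \<box> g z"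
  using box_add[of f "\<lambda>z. -1 * g z" z] box_cmult[of g z "-1"]
  by (simp add: smooth_on_minus[OF open_U])

lemma box_sum:
  assumes "\<And>i. i \<in> I \<Longrightarrow> smooth_on U (f i)" "z \<in> U"
  shows "\<box> (\<lambda>z. \<Sum>i\<in>I. f i z) z = (\<Sum>i\<in>I. \<box> (f i) z)"
  using assms(1)
proof (induction I rule: infinite_finite_induct)
  case (insert i I)
  then show ?case
    using box_add[of "f i" "\<lambda>z. \<Sum>i\<in>I. f i z" z] assms(2)
    by (simp add: smooth_on_sum[OF open_U])
qed (simp_all add: box_def \<Delta>_def)

text \<open>Multiplication by a time-independent h commutes with time derivatives, so only the
  Laplacian contributes a commutator, with the sign it carries in \<open>box\<close>.\<close>

lemma box_mult_commutator:
  assumes h: "smooth_on U h" "\<And>y. y \<in> U \<Longrightarrow> \<partial> 0 h y = 0" and f: "smooth_on U f" and z: "z \<in> U"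
  shows "\<box> (\<lambda>y. h y * f y) z = h z * \<box> f z - commutator \<Delta> (mult_op h) f z"
proof -
  have "\<partial> 0 (\<partial> 0 h) z = 0" using pd_cong[OF h(2) z, where \<mu> = 0] by simp
  then show ?thesis
    using h f z by (simp add: box_def commutator_def mult_op_def pd_pd_mult algebra_simps)
qed

lemma \<Omega>_add: "smooth_on U f \<Longrightarrow> smooth_on U g \<Longrightarrow> z \<in> U \<Longrightarrow> \<Omega> (\<lambda>z. f z + g z) z = \<Omega> f z + \<Omega> g z"
  by (simp add: \<Omega>_def pd_add algebra_simps)

lemma \<Omega>_mult: "smooth_on U f \<Longrightarrow> smooth_on U g \<Longrightarrow> z \<in> U \<Longrightarrow>
    \<Omega> (\<lambda>z. f z * g z) z = f z * \<Omega> g z + \<Omega> f z * g z"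
  by (simp add: \<Omega>_def pd_mult algebra_simps)

lemma Z_add: "smooth_on U f \<Longrightarrow> smooth_on U g \<Longrightarrow> z \<in> U \<Longrightarrow> Z j (\<lambda>z. f z + g z) z = Z j f z + Z j g z"
  by (simp add: Z_def pd_add \<Omega>_add)

lemma Z_mult: "smooth_on U f \<Longrightarrow> smooth_on U g \<Longrightarrow> z \<in> U \<Longrightarrow>
    Z j (\<lambda>z. f z * g z) z = f z * Z j g z + Z j f z * g z"
  by (simp add: Z_def pd_mult \<Omega>_mult)

lemma Z_sum:
  assumes "\<And>i. i \<in> I \<Longrightarrow> smooth_on U (f i)" "z \<in> U"
  shows "Z j (\<lambda>z. \<Sum>i\<in>I. f i z) z = (\<Sum>i\<in>I. Z j (f i) z)"
  using assms(1)
proof (induction I rule: infinite_finite_induct)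
  case (insert i I)
  then show ?case
    using Z_add[of "f i" "\<lambda>z. \<Sum>i\<in>I. f i z" z j] assms(2)
    by (simp add: smooth_on_sum[OF open_U])
qed (simp_all add: Z_def \<Omega>_def)

text \<open>For the indices 0, 1, 2 the factors \<open>snd (dir \<mu>) $ i\<close> are Kronecker
  symbols: the derivatives of the coefficients of \<Omega>. Written this way one formula covers all
  directions.\<close>

lemma pd_\<Omega>:
  assumes f: "smooth_on U f" and z: "z \<in> U"
  shows "\<partial> \<mu> (\<Omega> f) z = \<Omega> (\<partial> \<mu> f) z + snd (dir \<mu>) $ 1 * \<partial> 2 f z - snd (dir \<mu>) $ 2 * \<partial> 1 f z"
  using pd_commute[OF f z, of \<mu> 1] pd_commute[OF f z, of \<mu> 2] f z
  by (simp add: \<Omega>_def pd_diff pd_mult pd_nth smooth_intros algebra_simps)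

lemma box_pd:
  assumes f: "smooth_on U f" and z: "z \<in> U"
  shows "\<box> (\<partial> \<mu> f) z = \<partial> \<mu> (\<box> f) z"
  using f z by (simp add: box_def \<Delta>_def pd_diff pd_add smooth_intros pd_commute3[of _ _ \<mu>])

text \<open>The commutators of \<Omega> with the two pure second derivatives in space are opposite
  multiples of the mixed derivative, so they cancel in the Laplacian.\<close>

lemma box_\<Omega>:
  assumes f: "smooth_on U f" and z: "z \<in> U"
  shows "\<box> (\<Omega> f) z = \<Omega> (\<box> f) z"
proof -
  have 2: "\<partial> \<nu> (\<partial> \<mu> (\<Omega> f)) z = \<Omega> (\<partial> \<nu> (\<partial> \<mu> f)) z
      + snd (dir \<nu>) $ 1 * \<partial> 2 (\<partial> \<mu> f) z - snd (dir \<nu>) $ 2 * \<partial> 1 (\<partial> \<mu> f) z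
      + snd (dir \<mu>) $ 1 * \<partial> \<nu> (\<partial> 2 f) z - snd (dir \<mu>) $ 2 * \<partial> \<nu> (\<partial> 1 f) z" for \<mu> \<nu>
    using pd_cong[OF pd_\<Omega>[OF f] z, where \<mu> = \<nu>] f z
    by (simp add: pd_add pd_diff pd_cmult pd_\<Omega> smooth_intros smooth_on_\<Omega>)
  have "\<Omega> (\<box> f) z = \<Omega> (\<partial> 0 (\<partial> 0 f)) z - (\<Omega> (\<partial> 1 (\<partial> 1 f)) z + \<Omega> (\<partial> 2 (\<partial> 2 f)) z)"
    using f z by (simp add: \<Omega>_def box_def \<Delta>_def pd_diff pd_add smooth_intros algebra_simps)
  then show ?thesis
    using pd_commute[OF f z, of 1 2] by (simp add: box_def \<Delta>_def 2 dir_simps axis_2_simps)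
qed

lemma box_Z: "smooth_on U f \<Longrightarrow> z \<in> U \<Longrightarrow> \<box> (Z j f) z = Z j (\<box> f) z"
  unfolding Z_def by (simp add: box_pd box_\<Omega>)

text \<open>The function g stands for anything that agrees with \<open>box f\<close> on U.
  \<open>Zpow\<close> is a nest of four such powers, and g lets each layer start from the result of
  the layer inside it.\<close>

lemma box_funpow_Z:
  assumes f: "smooth_on U f" and g: "\<And>y. y \<in> U \<Longrightarrow> \<box> f y = g y"
  shows "z \<in> U \<Longrightarrow> \<box> ((Z j ^^ n) f) z = (Z j ^^ n) g z"
proof (induction n arbitrary: z)
  case (Suc n)
  have "\<box> (Z j ((Z j ^^ n) f)) z = Z j (\<box> ((Z j ^^ n) f)) z"
    using f Suc.prems by (intro box_Z smooth_on_funpow smooth_on_Z)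
  also have "\<dots> = Z j ((Z j ^^ n) g) z"
    using Suc by (intro Z_cong) auto
  finally show ?case by simp
qed (simp add: g)

lemma box_Zpow: "smooth_on U f \<Longrightarrow> z \<in> U \<Longrightarrow> \<box> (Zpow a f) z = Zpow a (\<box> f) z"
  unfolding Zpow_def by (intro box_funpow_Z smooth_on_funpow smooth_on_Z refl)

end

subsection \<open>Null forms\<close>

lemma sum_atMost_2: "(\<Sum>i\<le>2. f i) = f 0 + f 1 + f (2::nat)" for f :: "nat \<Rightarrow> 'a::comm_monoid_add"
  by (simp add: numeral_2_eq_2 add.assoc)

definition quad_form :: "(nat \<Rightarrow> nat \<Rightarrow> nat \<Rightarrow> real) \<Rightarrow> scalar_field \<Rightarrow> scalar_field \<Rightarrow> scalar_field" where
  "quad_form q v w = (\<lambda>z. \<Sum>\<alpha>\<le>2. \<Sum>\<beta>\<le>2. \<Sum>\<gamma>\<le>2. q \<alpha> \<beta> \<gamma> * \<partial> \<alpha> (\<partial> \<beta> v) z * \<partial> \<gamma> w z)"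

text \<open>The equations say that the cubic form of \<open>q\<close> is \<open>L \<xi> * (\<xi>\<^sub>0\<^sup>2 - \<xi>\<^sub>1\<^sup>2 - \<xi>\<^sub>2\<^sup>2)\<close> for a linear form \<open>L\<close>.\<close>

definition null_tensor :: "(nat \<Rightarrow> nat \<Rightarrow> nat \<Rightarrow> real) \<Rightarrow> bool" where
  "null_tensor q \<longleftrightarrow>
     q 0 1 1 + q 1 0 1 + q 1 1 0 = - q 0 0 0 \<and>
     q 0 2 2 + q 2 0 2 + q 2 2 0 = - q 0 0 0 \<and>
     q 0 1 2 + q 0 2 1 + q 1 0 2 + q 1 2 0 + q 2 0 1 + q 2 1 0 = 0 \<and>
     q 1 1 1 = - (q 0 0 1 + q 0 1 0 + q 1 0 0) \<and>
     q 1 2 2 + q 2 1 2 + q 2 2 1 = - (q 0 0 1 + q 0 1 0 + q 1 0 0) \<and>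
     q 2 2 2 = - (q 0 0 2 + q 0 2 0 + q 2 0 0) \<and>
     q 1 1 2 + q 1 2 1 + q 2 1 1 = - (q 0 0 2 + q 0 2 0 + q 2 0 0)"

text \<open>On the circle at height 1 a cubic form becomes a trigonometric polynomial of degree at
  most 3, an element of a space of dimension 7. Eight rational points of the circle, the four on the
  axes and (3/5, 4/5) with all signs, therefore determine it, and the seven equations are linear
  combinations of its values there.\<close>

lemma null_condition_imp_null_tensor:
  assumes "null_condition q" shows "null_tensor q"
proof -
  have *: "(\<Sum>\<alpha>\<le>2. \<Sum>\<beta>\<le>2. \<Sum>\<gamma>\<le>2. q \<alpha> \<beta> \<gamma> * \<xi> \<alpha> * \<xi> \<beta> * \<xi> \<gamma>) = 0"
    if "\<xi> = (\<lambda>i. if i = 0 then 1 else if i = 1 then x else y)" "x\<^sup>2 + y\<^sup>2 = 1" for \<xi> :: "nat \<Rightarrow> real" and x y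
    using assms that unfolding null_condition_def by simp
  show ?thesis
    using *[OF refl, of 1 0] *[OF refl, of "-1" 0] *[OF refl, of 0 1] *[OF refl, of 0 "-1"]
      *[OF refl, of "3/5" "4/5"] *[OF refl, of "-3/5" "4/5"] *[OF refl, of "3/5" "-4/5"] *[OF refl, of "-3/5" "-4/5"]
    unfolding null_tensor_def sum_atMost_2
    by (simp add: power2_eq_square del: One_nat_def)
qed

lemma null_tensor_zero: "null_tensor (\<lambda>_ _ _. 0)"
  by (simp add: null_tensor_def)

lemma null_tensor_add: "null_tensor p \<Longrightarrow> null_tensor q \<Longrightarrow> null_tensor (\<lambda>\<alpha> \<beta> \<gamma>. p \<alpha> \<beta> \<gamma> + q \<alpha> \<beta> \<gamma>)"
  unfolding null_tensor_def by linarith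

lemma quad_form_zero: "quad_form (\<lambda>_ _ _. 0) v w z = 0"
  by (simp add: quad_form_def)

lemma quad_form_add:
  "quad_form (\<lambda>\<alpha> \<beta> \<gamma>. p \<alpha> \<beta> \<gamma> + q \<alpha> \<beta> \<gamma>) v w z = quad_form p v w z + quad_form q v w z"
  by (simp add: quad_form_def sum.distrib algebra_simps)

text \<open>The rotation field acts on covectors by \<open>[\<Omega>, \<partial>\<^sub>1] = - \<partial>\<^sub>2\<close> and \<open>[\<Omega>, \<partial>\<^sub>2] = \<partial>\<^sub>1\<close>, and
  \<open>rot_tensor\<close> is the induced action on coefficients.\<close>

definition rot_vec :: "(nat \<Rightarrow> real) \<Rightarrow> nat \<Rightarrow> real" where
  "rot_vec g \<alpha> = (if \<alpha> = 1 then g 2 else if \<alpha> = 2 then - g 1 else 0)"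

definition rot_tensor :: "(nat \<Rightarrow> nat \<Rightarrow> nat \<Rightarrow> real) \<Rightarrow> nat \<Rightarrow> nat \<Rightarrow> nat \<Rightarrow> real" where
  "rot_tensor q \<alpha> \<beta> \<gamma> = rot_vec (\<lambda>\<delta>. q \<delta> \<beta> \<gamma>) \<alpha> + rot_vec (\<lambda>\<delta>. q \<alpha> \<delta> \<gamma>) \<beta> + rot_vec (\<lambda>\<delta>. q \<alpha> \<beta> \<delta>) \<gamma>"

text \<open>Rotations in space preserve the light cone, so their infinitesimal action preserves the
  cubic forms that vanish on it.\<close>

lemma null_tensor_rot: "null_tensor q \<Longrightarrow> null_tensor (rot_tensor q)"
  unfolding null_tensor_def by (simp add: rot_tensor_def rot_vec_def del: One_nat_def)

text \<open>Moves the rotation from the coefficients to the derivatives they multiply. The right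
  side has the Kronecker symbols of \<open>pd_\<Omega>\<close>, so that commutator terms can be
  recognised.\<close>

lemma rot_vec_transpose:
  "(\<Sum>\<alpha>\<le>2. rot_vec g \<alpha> * h \<alpha>) =
    (\<Sum>\<alpha>\<le>2. g \<alpha> * (snd (dir \<alpha>) $ 2 * h 1 - snd (dir \<alpha>) $ 1 * h 2))"
  by (simp add: sum_atMost_2 rot_vec_def dir_simps axis_2_simps)

text \<open>Each of the three index slots is transposed by \<open>rot_vec_transpose\<close>, which
  needs the sum over that slot to be innermost; the exchanges of sums serve this alone. The result
  is what commuting \<Omega> past the three derivatives of a quadratic form leaves behind.\<close>

lemma quad_form_rot:
  "quad_form (rot_tensor q) v w z = (\<Sum>\<alpha>\<le>2. \<Sum>\<beta>\<le>2. \<Sum>\<gamma>\<le>2.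
     q \<alpha> \<beta> \<gamma> * (snd (dir \<alpha>) $ 2 * (\<partial> 1 (\<partial> \<beta> v) z * \<partial> \<gamma> w z) - snd (dir \<alpha>) $ 1 * (\<partial> 2 (\<partial> \<beta> v) z * \<partial> \<gamma> w z)) +
     q \<alpha> \<beta> \<gamma> * (snd (dir \<beta>) $ 2 * (\<partial> \<alpha> (\<partial> 1 v) z * \<partial> \<gamma> w z) - snd (dir \<beta>) $ 1 * (\<partial> \<alpha> (\<partial> 2 v) z * \<partial> \<gamma> w z)) +
     q \<alpha> \<beta> \<gamma> * (snd (dir \<gamma>) $ 2 * (\<partial> \<alpha> (\<partial> \<beta> v) z * \<partial> 1 w z) - snd (dir \<gamma>) $ 1 * (\<partial> \<alpha> (\<partial> \<beta> v) z * \<partial> 2 w z)))"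
proof -
  let ?X = "\<lambda>\<alpha> \<beta> \<gamma>. \<partial> \<alpha> (\<partial> \<beta> v) z * \<partial> \<gamma> w z"
  have "quad_form (rot_tensor q) v w z =
      (\<Sum>\<alpha>\<le>2. \<Sum>\<beta>\<le>2. \<Sum>\<gamma>\<le>2. rot_vec (\<lambda>\<delta>. q \<delta> \<beta> \<gamma>) \<alpha> * ?X \<alpha> \<beta> \<gamma>) +
      (\<Sum>\<alpha>\<le>2. \<Sum>\<beta>\<le>2. \<Sum>\<gamma>\<le>2. rot_vec (\<lambda>\<delta>. q \<alpha> \<delta> \<gamma>) \<beta> * ?X \<alpha> \<beta> \<gamma>) +
      (\<Sum>\<alpha>\<le>2. \<Sum>\<beta>\<le>2. \<Sum>\<gamma>\<le>2. rot_vec (\<lambda>\<delta>. q \<alpha> \<beta> \<delta>) \<gamma> * ?X \<alpha> \<beta> \<gamma>)"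
    by (simp add: quad_form_def rot_tensor_def sum.distrib distrib_right mult.assoc)
  also have "(\<Sum>\<alpha>\<le>2. \<Sum>\<beta>\<le>2. \<Sum>\<gamma>\<le>2. rot_vec (\<lambda>\<delta>. q \<delta> \<beta> \<gamma>) \<alpha> * ?X \<alpha> \<beta> \<gamma>) =
      (\<Sum>\<beta>\<le>2. \<Sum>\<gamma>\<le>2. \<Sum>\<alpha>\<le>2. rot_vec (\<lambda>\<delta>. q \<delta> \<beta> \<gamma>) \<alpha> * ?X \<alpha> \<beta> \<gamma>)"
    by (subst sum.swap, rule sum.cong[OF refl], rule sum.swap)
  also have "\<dots> = (\<Sum>\<beta>\<le>2. \<Sum>\<alpha>\<le>2. \<Sum>\<gamma>\<le>2.
      q \<alpha> \<beta> \<gamma> * (snd (dir \<alpha>) $ 2 * ?X 1 \<beta> \<gamma> - snd (dir \<alpha>) $ 1 * ?X 2 \<beta> \<gamma>))"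
    unfolding rot_vec_transpose by (rule sum.cong[OF refl], rule sum.swap)
  also have "\<dots> = (\<Sum>\<alpha>\<le>2. \<Sum>\<beta>\<le>2. \<Sum>\<gamma>\<le>2.
      q \<alpha> \<beta> \<gamma> * (snd (dir \<alpha>) $ 2 * ?X 1 \<beta> \<gamma> - snd (dir \<alpha>) $ 1 * ?X 2 \<beta> \<gamma>))"
    by (rule sum.swap)
  also have "(\<Sum>\<alpha>\<le>2. \<Sum>\<beta>\<le>2. \<Sum>\<gamma>\<le>2. rot_vec (\<lambda>\<delta>. q \<alpha> \<delta> \<gamma>) \<beta> * ?X \<alpha> \<beta> \<gamma>) =
      (\<Sum>\<alpha>\<le>2. \<Sum>\<gamma>\<le>2. \<Sum>\<beta>\<le>2. rot_vec (\<lambda>\<delta>. q \<alpha> \<delta> \<gamma>) \<beta> * ?X \<alpha> \<beta> \<gamma>)"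
    by (rule sum.cong[OF refl], rule sum.swap)
  also have "\<dots> = (\<Sum>\<alpha>\<le>2. \<Sum>\<beta>\<le>2. \<Sum>\<gamma>\<le>2.
      q \<alpha> \<beta> \<gamma> * (snd (dir \<beta>) $ 2 * ?X \<alpha> 1 \<gamma> - snd (dir \<beta>) $ 1 * ?X \<alpha> 2 \<gamma>))"
    unfolding rot_vec_transpose by (rule sum.cong[OF refl], rule sum.swap)
  finally show ?thesis unfolding rot_vec_transpose by (simp only: sum.distrib)
qed

text \<open>\<open>Z j\<close> is \<Omega> for every j other than 1, 2, 3. The case distinction
  follows it, so that \<open>Z_quad_form\<close> holds for all j.\<close>

definition Z_tensor :: "nat \<Rightarrow> (nat \<Rightarrow> nat \<Rightarrow> nat \<Rightarrow> real) \<Rightarrow> nat \<Rightarrow> nat \<Rightarrow> nat \<Rightarrow> real" where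
  "Z_tensor j q = (if j \<in> {1, 2, 3} then (\<lambda>_ _ _. 0) else rot_tensor q)"

lemma null_tensor_Z_tensor: "null_tensor q \<Longrightarrow> null_tensor (Z_tensor j q)"
  by (simp add: Z_tensor_def null_tensor_zero null_tensor_rot)

context
  fixes U :: "spacetime set"
  assumes open_U: "open U"
begin

lemma smooth_on_quad_form: "smooth_on U v \<Longrightarrow> smooth_on U w \<Longrightarrow> smooth_on U (quad_form q v w)"
  unfolding quad_form_def by (intro smooth_intros[OF open_U])

lemma Z_quad_form_expand:
  assumes v: "smooth_on U v" and w: "smooth_on U w" and z: "z \<in> U"
  shows "Z j (quad_form q v w) z = (\<Sum>\<alpha>\<le>2. \<Sum>\<beta>\<le>2. \<Sum>\<gamma>\<le>2.
    q \<alpha> \<beta> \<gamma> * Z j (\<partial> \<alpha> (\<partial> \<beta> v)) z * \<partial> \<gamma> w z + q \<alpha> \<beta> \<gamma> * \<partial> \<alpha> (\<partial> \<beta> v) z * Z j (\<partial> \<gamma> w) z)"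
proof -
  have c: "Z j (\<lambda>z. c) z = 0" for c by (simp add: Z_def \<Omega>_def)
  have "Z j (\<lambda>z. q \<alpha> \<beta> \<gamma> * \<partial> \<alpha> (\<partial> \<beta> v) z * \<partial> \<gamma> w z) z =
    q \<alpha> \<beta> \<gamma> * Z j (\<partial> \<alpha> (\<partial> \<beta> v)) z * \<partial> \<gamma> w z + q \<alpha> \<beta> \<gamma> * \<partial> \<alpha> (\<partial> \<beta> v) z * Z j (\<partial> \<gamma> w) z" for \<alpha> \<beta> \<gamma>
    using v w z by (simp add: Z_mult[OF open_U] smooth_intros[OF open_U] c)
  then show ?thesis
    unfolding quad_form_def using v w z by (simp add: Z_sum[OF open_U] smooth_intros[OF open_U])
qed

text \<open>Leibniz rule plus commutators. Translations commute with all derivatives, so nothing is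
  added; for \<Omega> the commutators in the three slots add up to the form of the rotated
  tensor.\<close>

lemma Z_quad_form:
  assumes v: "smooth_on U v" and w: "smooth_on U w" and z: "z \<in> U"
  shows "Z j (quad_form q v w) z =
    quad_form q (Z j v) w z + quad_form q v (Z j w) z + quad_form (Z_tensor j q) v w z"
proof (cases "j \<in> {1, 2, 3}")
  case True
  then obtain \<mu> where \<mu>: "Z j = \<partial> \<mu>" by (auto simp: Z_def)
  have "\<partial> \<alpha> (\<partial> \<beta> (\<partial> \<mu> v)) z = \<partial> \<mu> (\<partial> \<alpha> (\<partial> \<beta> v)) z" "\<partial> \<gamma> (\<partial> \<mu> w) z = \<partial> \<mu> (\<partial> \<gamma> w) z" for \<alpha> \<beta> \<gamma>
    using pd_commute3[OF open_U v z] pd_commute[OF open_U w z] by metis+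
  then show ?thesis
    unfolding Z_quad_form_expand[OF v w z] using True
    by (simp add: Z_tensor_def quad_form_zero \<mu>) (simp add: quad_form_def sum.distrib)
next
  case False
  then have \<Omega>: "Z j = \<Omega>" by (auto simp: Z_def)
  let ?d = "\<lambda>\<mu> i. snd (dir \<mu>) $ i"
  have 1: "\<Omega> (\<partial> \<mu> f) z = \<partial> \<mu> (\<Omega> f) z - ?d \<mu> 1 * \<partial> 2 f z + ?d \<mu> 2 * \<partial> 1 f z"
    if "smooth_on U f" "z \<in> U" for f \<mu> z using pd_\<Omega>[OF open_U that, of \<mu>] by simp
  have 2: "\<Omega> (\<partial> \<alpha> (\<partial> \<beta> v)) z = \<partial> \<alpha> (\<partial> \<beta> (\<Omega> v)) z - ?d \<alpha> 1 * \<partial> 2 (\<partial> \<beta> v) z + ?d \<alpha> 2 * \<partial> 1 (\<partial> \<beta> v) z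
      - ?d \<beta> 1 * \<partial> \<alpha> (\<partial> 2 v) z + ?d \<beta> 2 * \<partial> \<alpha> (\<partial> 1 v) z" for \<alpha> \<beta>
  proof -
    have "\<partial> \<alpha> (\<Omega> (\<partial> \<beta> v)) z = \<partial> \<alpha> (\<lambda>y. \<partial> \<beta> (\<Omega> v) y - ?d \<beta> 1 * \<partial> 2 v y + ?d \<beta> 2 * \<partial> 1 v y) z"
      by (intro pd_cong[OF open_U] 1 v z)
    then show ?thesis
      using v z by (simp add: 1 smooth_intros[OF open_U] smooth_on_\<Omega>[OF open_U] pd_add[OF open_U]
          pd_diff[OF open_U] pd_cmult[OF open_U])
  qed
  show ?thesis
    unfolding \<Omega> Z_quad_form_expand[OF v w z, of j, unfolded \<Omega>] 2 1[OF w z] using False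
    by (simp add: Z_tensor_def quad_form_rot)
      (simp add: quad_form_def sum.distrib[symmetric] sum_subtractf[symmetric] algebra_simps)
qed

end


subsection \<open>Commuting the equation with the vector fields\<close>

text \<open>\<open>leading a j i\<close> means that \<open>Z j\<close> is the outermost factor of \<open>Z^(a + axis i 1)\<close>.\<close>

definition leading :: "nat^4 \<Rightarrow> nat \<Rightarrow> 4 \<Rightarrow> bool" where
  "leading a j i \<longleftrightarrow> j = 1 \<and> i = 1 \<or> j = 2 \<and> i = 2 \<and> a$1 = 0 \<or> j = 3 \<and> i = 3 \<and> a$1 = 0 \<and> a$2 = 0 \<or>
     j = 4 \<and> i = 4 \<and> a$1 = 0 \<and> a$2 = 0 \<and> a$3 = 0"

text \<open>The condition on the index only asks entries to vanish, so smaller indices inherit it.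
  This is why the vector fields never have to be commuted with each other: when \<open>Z j\<close>
  is the outermost factor for the index a, it can be put directly in front of \<open>Zpow b\<close>
  and \<open>Zpow c\<close> for all b, c below a.\<close>

lemma leading_mono: "leading a j i \<Longrightarrow> b \<le> a \<Longrightarrow> leading b j i"
  unfolding leading_def less_eq_vec_def by (metis le_zero_eq)

lemma Zpow_leading: "leading a j i \<Longrightarrow> Zpow (a + axis i 1) f = Z j (Zpow a f)"
  by (auto simp: leading_def Zpow_def axis_def)

lemma exists_leading:
  fixes a :: "nat^4"
  assumes "a \<noteq> 0" shows "\<exists>a' j i. leading a' j i \<and> a = a' + axis i 1"
proof -
  have *: "\<exists>a' j i. leading a' j i \<and> a = a' + axis i 1"
    if "a $ i \<noteq> 0" "leading (\<chi> k. if k = i then a $ k - 1 else a $ k) j i" for i j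
    using that by (intro exI[of _ "\<chi> k. if k = i then a $ k - 1 else a $ k"] exI[of _ j] exI[of _ i])
      (auto simp: vec_eq_iff axis_def)
  have "a $ 1 \<noteq> 0 \<or> a $ 2 \<noteq> 0 \<or> a $ 3 \<noteq> 0 \<or> a $ 4 \<noteq> 0"
    using assms by (auto simp: vec_eq_iff forall_4)
  then consider "a $ 1 \<noteq> 0" | "a $ 1 = 0" "a $ 2 \<noteq> 0" | "a $ 1 = 0" "a $ 2 = 0" "a $ 3 \<noteq> 0"
    | "a $ 1 = 0" "a $ 2 = 0" "a $ 3 = 0" "a $ 4 \<noteq> 0" by blast
  then show ?thesis
  proof cases
    case 1 then show ?thesis by (intro *[of 1 1]) (auto simp: leading_def)
  next
    case 2 then show ?thesis by (intro *[of 2 2]) (auto simp: leading_def)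
  next
    case 3 then show ?thesis by (intro *[of 3 3]) (auto simp: leading_def)
  next
    case 4 then show ?thesis by (intro *[of 4 4]) (auto simp: leading_def)
  qed
qed

lemma sum_splits_delta: "(\<Sum>(b,c)\<in>splits a. if b = b' \<and> c = c' then f b c else 0) = (if (b',c') \<in> splits a then f b' c' else 0)"
  for f :: "_ \<Rightarrow> _ \<Rightarrow> real"
proof -
  have "(\<Sum>(b,c)\<in>splits a. if b = b' \<and> c = c' then f b c else 0) =
      (\<Sum>p\<in>splits a. if p = (b', c') then f b' c' else 0)"
    by (rule sum.cong) (auto split: if_splits)
  then show ?thesis using finite_splits by simp
qed

text \<open>The tensors r are quantified before U and u, and u is any smooth function: the expansion
  is an algebraic identity whose coefficients cannot depend on a solution.\<close>

definition null_expansion :: "nat^4 \<Rightarrow> (scalar_field \<Rightarrow> scalar_field) \<Rightarrow> bool" where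
  "null_expansion a F \<longleftrightarrow> (\<exists>r. (\<forall>b c. null_tensor (r b c)) \<and>
     (\<forall>U u. open U \<longrightarrow> smooth_on U u \<longrightarrow>
       (\<forall>z\<in>U. F u z = (\<Sum>(b,c)\<in>splits a. quad_form (r b c) (Zpow b u) (Zpow c u) z))))"

lemma null_expansionE:
  assumes "null_expansion a F"
  obtains r where "\<And>b c. null_tensor (r b c)"
    "\<And>U u z. open U \<Longrightarrow> smooth_on U u \<Longrightarrow> z \<in> U \<Longrightarrow>
      F u z = (\<Sum>(b,c)\<in>splits a. quad_form (r b c) (Zpow b u) (Zpow c u) z)"
  using assms unfolding null_expansion_def by blast

lemma null_expansionI:
  assumes "\<And>b c. null_tensor (r b c)"
    "\<And>U u z. open U \<Longrightarrow> smooth_on U u \<Longrightarrow> z \<in> U \<Longrightarrow>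
      F u z = (\<Sum>(b,c)\<in>splits a. quad_form (r b c) (Zpow b u) (Zpow c u) z)"
  shows "null_expansion a F"
  using assms unfolding null_expansion_def by blast

lemma null_expansion_cong:
  assumes G: "null_expansion a G"
    and F: "\<And>U u z. open U \<Longrightarrow> smooth_on U u \<Longrightarrow> z \<in> U \<Longrightarrow> F u z = G u z"
  shows "null_expansion a F"
  by (rule null_expansionE[OF G]) (rule null_expansionI, assumption, simp add: F)

lemma null_expansion_zero: "null_expansion a (\<lambda>u z. 0)"
  by (rule null_expansionI[where r = "\<lambda>_ _ _ _ _. 0"]) (simp_all add: null_tensor_zero quad_form_zero)

lemma null_expansion_add:
  assumes F: "null_expansion a F" and G: "null_expansion a G"
  shows "null_expansion a (\<lambda>u z. F u z + G u z)"
proof -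
  obtain r where r: "\<And>b c. null_tensor (r b c)"
    "\<And>U u z. open U \<Longrightarrow> smooth_on U u \<Longrightarrow> z \<in> U \<Longrightarrow>
      F u z = (\<Sum>(b,c)\<in>splits a. quad_form (r b c) (Zpow b u) (Zpow c u) z)"
    by (rule null_expansionE[OF F]) blast
  obtain s where s: "\<And>b c. null_tensor (s b c)"
    "\<And>U u z. open U \<Longrightarrow> smooth_on U u \<Longrightarrow> z \<in> U \<Longrightarrow>
      G u z = (\<Sum>(b,c)\<in>splits a. quad_form (s b c) (Zpow b u) (Zpow c u) z)"
    by (rule null_expansionE[OF G]) blast
  show ?thesis
    by (rule null_expansionI[where r = "\<lambda>b c \<alpha> \<beta> \<gamma>. r b c \<alpha> \<beta> \<gamma> + s b c \<alpha> \<beta> \<gamma>"])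
      (simp_all add: r s null_tensor_add quad_form_add split_def sum.distrib)
qed

lemma null_expansion_sum:
  "(\<And>i. i \<in> I \<Longrightarrow> null_expansion a (F i)) \<Longrightarrow> null_expansion a (\<lambda>u z. \<Sum>i\<in>I. F i u z)"
  by (induction I rule: infinite_finite_induct) (simp_all add: null_expansion_zero null_expansion_add)

lemma null_expansion_single:
  assumes "null_tensor q" "b' + c' \<le> a"
  shows "null_expansion a (\<lambda>u. quad_form q (Zpow b' u) (Zpow c' u))"
proof -
  define r where "r b c = (if b = b' \<and> c = c' then q else (\<lambda>_ _ _. 0))" for b c
  have "quad_form (r b c) v w z = (if b = b' \<and> c = c' then quad_form q v w z else 0)" for b c v w z
    by (auto simp: r_def quad_form_zero)
  moreover have "null_tensor (r b c)" for b c by (simp add: r_def assms(1) null_tensor_zero)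
  moreover have "(b', c') \<in> splits a" using assms(2) by (simp add: splits_def)
  ultimately show ?thesis
    by (intro null_expansionI[where r = r]) (simp_all add: sum_splits_delta)
qed

text \<open>By the Leibniz rule \<open>Z j\<close> raises b or c by one unit, or leaves the pair (b,
  c) alone and acts on the tensor. The last possibility is the reason for summing over b + c \<le> a
  rather than b + c = a.\<close>

lemma null_expansion_step:
  assumes lead: "leading a j i" and exp: "null_expansion a (\<lambda>u. Zpow a (quad_form q u u))"
  shows "null_expansion (a + axis i 1) (\<lambda>u. Zpow (a + axis i 1) (quad_form q u u))"
proof -
  obtain r where nr: "\<And>b c. null_tensor (r b c)"
    and r: "\<And>U u z. open U \<Longrightarrow> smooth_on U u \<Longrightarrow> z \<in> U \<Longrightarrow>
      Zpow a (quad_form q u u) z = (\<Sum>(b,c)\<in>splits a. quad_form (r b c) (Zpow b u) (Zpow c u) z)"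
    by (rule null_expansionE[OF exp]) blast
  let ?e = "axis i 1 :: nat^4"
  let ?G = "\<lambda>u z. \<Sum>p\<in>splits a. case p of (b, c) \<Rightarrow>
      (quad_form (r b c) (Zpow (b + ?e) u) (Zpow c u) z + quad_form (r b c) (Zpow b u) (Zpow (c + ?e) u) z)
      + quad_form (Z_tensor j (r b c)) (Zpow b u) (Zpow c u) z"
  have "null_expansion (a + ?e) ?G"
  proof (rule null_expansion_sum)
    fix p assume "p \<in> splits a"
    then obtain b c where p: "p = (b, c)" "b + c \<le> a" by (auto simp: splits_def)
    have "b + ?e + c \<le> a + ?e" "b + (c + ?e) \<le> a + ?e" "b + c \<le> a + ?e"
      using p(2) by (auto simp: less_eq_vec_def add_increasing2 intro: trans_le_add1)
    then show "null_expansion (a + ?e) (\<lambda>u z. case p of (b, c) \<Rightarrow>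
      (quad_form (r b c) (Zpow (b + ?e) u) (Zpow c u) z + quad_form (r b c) (Zpow b u) (Zpow (c + ?e) u) z)
      + quad_form (Z_tensor j (r b c)) (Zpow b u) (Zpow c u) z)"
      unfolding p prod.case
      by (intro null_expansion_add null_expansion_single nr null_tensor_Z_tensor)
  qed
  then show ?thesis
  proof (rule null_expansion_cong)
    fix U :: "spacetime set" and u :: scalar_field and z assume U: "open U" and u: "smooth_on U u" and z: "z \<in> U"
    note sm = smooth_on_Zpow[OF U u]
    have "Zpow (a + ?e) (quad_form q u u) z = Z j (Zpow a (quad_form q u u)) z"
      by (simp only: Zpow_leading[OF lead])
    also have "\<dots> = Z j (\<lambda>z. \<Sum>p\<in>splits a. quad_form (r (fst p) (snd p)) (Zpow (fst p) u) (Zpow (snd p) u) z) z"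
      using r[OF U u] by (intro Z_cong[OF U _ z]) (simp add: split_def)
    also have "\<dots> = (\<Sum>p\<in>splits a. Z j (quad_form (r (fst p) (snd p)) (Zpow (fst p) u) (Zpow (snd p) u)) z)"
      by (intro Z_sum[OF U _ z] smooth_on_quad_form[OF U] sm)
    also have "\<dots> = ?G u z"
    proof (rule sum.cong[OF refl])
      fix p assume "p \<in> splits a"
      then obtain b c where p: "p = (b, c)" "b + c \<le> a" by (auto simp: splits_def)
      have "b \<le> a" "c \<le> a"
        using p(2) unfolding less_eq_vec_def vector_add_component by (meson add_leD1 add_leD2)+
      then have "leading b j i" "leading c j i" by (auto intro: leading_mono[OF lead])
      then show "Z j (quad_form (r (fst p) (snd p)) (Zpow (fst p) u) (Zpow (snd p) u)) z =
        (case p of (b, c) \<Rightarrow>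
          (quad_form (r b c) (Zpow (b + ?e) u) (Zpow c u) z + quad_form (r b c) (Zpow b u) (Zpow (c + ?e) u) z)
          + quad_form (Z_tensor j (r b c)) (Zpow b u) (Zpow c u) z)"
        by (simp add: p Z_quad_form[OF U sm sm z] Zpow_leading del: One_nat_def)
    qed
    finally show "Zpow (a + ?e) (quad_form q u u) z = ?G u z" .
  qed
qed

lemma null_expansion_Zpow:
  assumes q: "null_tensor q" shows "null_expansion a (\<lambda>u. Zpow a (quad_form q u u))"
proof (induction "\<Sum>i\<in>UNIV. a $ i" arbitrary: a rule: less_induct)
  case less
  show ?case
  proof (cases "a = 0")
    case True
    have "Zpow 0 f = f" for f by (simp add: Zpow_def)
    then show ?thesis using null_expansion_single[OF q, of 0 0 a] True by simp
  next
    case False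
    then obtain a' j i where a': "leading a' j i" "a = a' + axis i 1" using exists_leading by blast
    have "(\<Sum>k\<in>UNIV. a' $ k) < (\<Sum>k\<in>UNIV. a $ k)"
      unfolding a'(2) by (rule sum_strict_mono_ex1) (auto simp: axis_def)
    then show ?thesis using less null_expansion_step[OF a'(1)] a'(2) by simp
  qed
qed

subsection \<open>Polar coordinates\<close>

lemma rad_eq: "rad z = sqrt ((snd z $ 1)\<^sup>2 + (snd z $ 2)\<^sup>2)"
  by (simp add: rad_def norm_vec_def L2_set_def sum_2)

lemma rad_mult_self: "rad z * rad z = snd z $ 1 * snd z $ 1 + snd z $ 2 * snd z $ 2"
  by (simp add: rad_eq power2_eq_square)

lemma ang_nth: "ang z $ i = snd z $ i / rad z"
  by (simp add: ang_def rad_def divide_inverse mult.commute)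

definition radial :: "scalar_field \<Rightarrow> scalar_field" where
  "radial f = (\<lambda>z. ang z $ 1 * \<partial> 1 f z + ang z $ 2 * \<partial> 2 f z)"

definition angular :: "scalar_field \<Rightarrow> scalar_field" where
  "angular f = (\<lambda>z. ang z $ 1 * \<partial> 2 f z - ang z $ 2 * \<partial> 1 f z)"

text \<open>\<Omega> acts on the Cartesian derivatives before they are projected, because terms of
  the type \<Omega>\<partial>v with coefficients in \<omega> are wanted. This differs from \<Omega>
  applied to \<open>radial f\<close> by the first-order term in
  \<open>\<Omega>_radial\<close>.\<close>

definition radial_\<Omega> :: "scalar_field \<Rightarrow> scalar_field" where
  "radial_\<Omega> f = (\<lambda>z. ang z $ 1 * \<Omega> (\<partial> 1 f) z + ang z $ 2 * \<Omega> (\<partial> 2 f) z)"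

definition angular_\<Omega> :: "scalar_field \<Rightarrow> scalar_field" where
  "angular_\<Omega> f = (\<lambda>z. ang z $ 1 * \<Omega> (\<partial> 2 f) z - ang z $ 2 * \<Omega> (\<partial> 1 f) z)"

text \<open>For the trace-free symmetric matrix \<open>\<sigma>\<close> with rows \<open>(s\<^sub>1, s\<^sub>2)\<close> and \<open>(s\<^sub>2, -s\<^sub>1)\<close> these are
  \<open>\<sigma>(\<omega>, \<omega>)\<close> and \<open>\<sigma>(\<omega>, \<omega>\<^sup>\<bottom>)\<close>, where \<open>\<omega>\<^sup>\<bottom> = (- \<omega>\<^sub>2, \<omega>\<^sub>1)\<close>.\<close>

definition pol_rr :: "real \<Rightarrow> real \<Rightarrow> real^2 \<Rightarrow> real" where
  "pol_rr s\<^sub>1 s\<^sub>2 x = s\<^sub>1 * (x$1 * x$1 - x$2 * x$2) + 2 * s\<^sub>2 * (x$1 * x$2)"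

definition pol_r\<theta> :: "real \<Rightarrow> real \<Rightarrow> real^2 \<Rightarrow> real" where
  "pol_r\<theta> s\<^sub>1 s\<^sub>2 x = s\<^sub>2 * (x$1 * x$1 - x$2 * x$2) - 2 * s\<^sub>1 * (x$1 * x$2)"

text \<open>The part of a null form that is not a combination of \<open>Q\<^sub>0\<close>, \<open>Q\<^sub>1\<^sub>2\<close> and \<open>\<box>\<close> with constant
  coefficients: \<open>\<sigma>\<^sub>i\<^sub>j (\<partial>\<^sub>i \<partial>\<^sub>t v \<partial>\<^sub>j w - \<partial>\<^sub>i \<partial>\<^sub>j v \<partial>\<^sub>t w)\<close>.\<close>

definition tracefree_form :: "real \<Rightarrow> real \<Rightarrow> scalar_field \<Rightarrow> scalar_field \<Rightarrow> scalar_field" where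
  "tracefree_form s\<^sub>1 s\<^sub>2 v w = (\<lambda>z.
     s\<^sub>1 * (\<partial> 1 (\<partial> 0 v) z * \<partial> 1 w z - \<partial> 2 (\<partial> 0 v) z * \<partial> 2 w z
           - (\<partial> 1 (\<partial> 1 v) z - \<partial> 2 (\<partial> 2 v) z) * \<partial> 0 w z)
   + s\<^sub>2 * (\<partial> 1 (\<partial> 0 v) z * \<partial> 2 w z + \<partial> 2 (\<partial> 0 v) z * \<partial> 1 w z - 2 * \<partial> 1 (\<partial> 2 v) z * \<partial> 0 w z))"

context
  fixes U :: "spacetime set"
  assumes open_U: "open U" and off: "U \<subseteq> {z. snd z \<noteq> 0}"
begin

lemma rad_pos: "z \<in> U \<Longrightarrow> rad z > 0"
  using off by (auto simp: rad_def)

lemma rad_nz: "z \<in> U \<Longrightarrow> rad z \<noteq> 0"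
  using rad_pos by (metis less_irrefl)

lemma ang_times_rad: "z \<in> U \<Longrightarrow> ang z $ i * rad z = snd z $ i"
  by (simp add: ang_nth rad_nz)

lemma ang_unit:
  assumes "z \<in> U" shows "ang z $ 1 * ang z $ 1 + ang z $ 2 * ang z $ 2 = 1"
  using rad_nz[OF assms]
  by (simp add: ang_nth add_divide_distrib[symmetric] rad_mult_self[symmetric])

lemma smooth_on_rad: "smooth_on U rad"
proof -
  have "smooth_on U (\<lambda>z. sqrt (snd z $ 1 * snd z $ 1 + snd z $ 2 * snd z $ 2))"
  proof (rule smooth_on_sqrt[OF open_U])
    show "0 < snd z $ 1 * snd z $ 1 + snd z $ 2 * snd z $ 2" if "z \<in> U" for z
      using rad_pos[OF that] rad_mult_self[of z] by (metis mult_pos_pos)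
  qed (intro smooth_intros[OF open_U])
  then show ?thesis
    by (rule smooth_on_cong[OF open_U, rotated]) (simp add: rad_eq power2_eq_square)
qed

lemma smooth_on_div_rad: "smooth_on U f \<Longrightarrow> smooth_on U (\<lambda>z. f z / rad z)"
  by (intro smooth_on_divide[OF open_U] smooth_on_rad rad_nz)

lemma smooth_on_ang: "smooth_on U (\<lambda>z. ang z $ i)"
  unfolding ang_nth by (intro smooth_on_div_rad smooth_intros[OF open_U])

lemma smooth_on_radial: "smooth_on U f \<Longrightarrow> smooth_on U (radial f)"
  unfolding radial_def by (intro smooth_intros[OF open_U] smooth_on_ang)

lemma smooth_on_angular: "smooth_on U f \<Longrightarrow> smooth_on U (angular f)"
  unfolding angular_def by (intro smooth_intros[OF open_U] smooth_on_ang)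

lemma smooth_on_radial_\<Omega>: "smooth_on U f \<Longrightarrow> smooth_on U (radial_\<Omega> f)"
  unfolding radial_\<Omega>_def by (intro smooth_intros[OF open_U] smooth_on_ang smooth_on_\<Omega>[OF open_U])

lemma smooth_on_angular_\<Omega>: "smooth_on U f \<Longrightarrow> smooth_on U (angular_\<Omega> f)"
  unfolding angular_\<Omega>_def by (intro smooth_intros[OF open_U] smooth_on_ang smooth_on_\<Omega>[OF open_U])

lemma smooth_on_pol: "smooth_on U (\<lambda>z. pol_rr s\<^sub>1 s\<^sub>2 (ang z))" "smooth_on U (\<lambda>z. pol_r\<theta> s\<^sub>1 s\<^sub>2 (ang z))"
  unfolding pol_rr_def pol_r\<theta>_def by (intro smooth_intros[OF open_U] smooth_on_ang)+

lemmas smooth_polar = smooth_intros[OF open_U] smooth_on_\<Omega>[OF open_U] smooth_on_div_rad smooth_on_ang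
  smooth_on_radial smooth_on_angular smooth_on_radial_\<Omega> smooth_on_angular_\<Omega> smooth_on_pol

text \<open>Implicit differentiation of |x|^2 = x_1^2 + x_2^2, so that no derivative of the root has
  to be computed. In the same way \<open>pd_ang\<close> differentiates the product of \<omega> and
  |x|.\<close>

lemma pd_rad:
  assumes z: "z \<in> U"
  shows "\<partial> \<mu> rad z = ang z $ 1 * snd (dir \<mu>) $ 1 + ang z $ 2 * snd (dir \<mu>) $ 2"
proof -
  have "\<partial> \<mu> (\<lambda>y. rad y * rad y) z = \<partial> \<mu> (\<lambda>y. snd y $ 1 * snd y $ 1 + snd y $ 2 * snd y $ 2) z"
    by (simp only: rad_mult_self)
  then have "rad z * \<partial> \<mu> rad z = snd z $ 1 * snd (dir \<mu>) $ 1 + snd z $ 2 * snd (dir \<mu>) $ 2"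
    using z smooth_on_rad
    by (simp add: pd_mult[OF open_U] pd_add[OF open_U] pd_nth smooth_intros[OF open_U])
  then show ?thesis using rad_pos[OF z] by (simp add: ang_nth field_simps)
qed

lemma pd_ang:
  assumes z: "z \<in> U"
  shows "\<partial> \<mu> (\<lambda>y. ang y $ i) z =
    (snd (dir \<mu>) $ i - ang z $ i * (ang z $ 1 * snd (dir \<mu>) $ 1 + ang z $ 2 * snd (dir \<mu>) $ 2)) / rad z"
proof -
  have "\<partial> \<mu> (\<lambda>y. ang y $ i * rad y) z = \<partial> \<mu> (\<lambda>y. snd y $ i) z"
    by (rule pd_cong[OF open_U ang_times_rad z])
  then have "\<partial> \<mu> (\<lambda>y. ang y $ i) z * rad z = snd (dir \<mu>) $ i - ang z $ i * \<partial> \<mu> rad z"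
    using pd_mult[OF open_U smooth_on_ang smooth_on_rad z, of \<mu> i] by (simp add: pd_nth)
  then show ?thesis using rad_pos[OF z] by (simp add: pd_rad[OF z] field_simps)
qed

lemma pd_div_rad:
  assumes f: "smooth_on U f" and z: "z \<in> U"
  shows "\<partial> \<mu> (\<lambda>y. f y / rad y) z = \<partial> \<mu> f z / rad z - f z * \<partial> \<mu> rad z / (rad z)\<^sup>2"
proof -
  have "\<partial> \<mu> (\<lambda>y. f y / rad y * rad y) z = \<partial> \<mu> f z"
    by (intro pd_cong[OF open_U _ z]) (simp add: rad_nz)
  then have "f z / rad z * \<partial> \<mu> rad z + \<partial> \<mu> (\<lambda>y. f y / rad y) z * rad z = \<partial> \<mu> f z"
    using pd_mult[OF open_U smooth_on_div_rad[OF f] smooth_on_rad z, of \<mu>] by simp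
  then show ?thesis using rad_pos[OF z] by (simp add: field_simps power2_eq_square)
qed

lemma pd_0_rad: "z \<in> U \<Longrightarrow> \<partial> 0 rad z = 0"
  by (simp add: pd_rad dir_simps)

lemma pd_0_ang: "z \<in> U \<Longrightarrow> \<partial> 0 (\<lambda>y. ang y $ i) z = 0"
  by (simp add: pd_ang dir_simps)

lemma pd_0_div_rad: "smooth_on U f \<Longrightarrow> z \<in> U \<Longrightarrow> \<partial> 0 (\<lambda>y. f y / rad y) z = \<partial> 0 f z / rad z"
  by (simp add: pd_div_rad pd_0_rad)

lemma \<Omega>_eq_angular: "z \<in> U \<Longrightarrow> \<Omega> f z = rad z * angular f z"
  by (simp add: \<Omega>_def angular_def ang_times_rad[symmetric] algebra_simps)

lemma \<Omega>_rad: "z \<in> U \<Longrightarrow> \<Omega> rad z = 0"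
  by (simp add: \<Omega>_eq_angular angular_def pd_rad dir_simps axis_2_simps)

lemma \<Omega>_ang_1: "z \<in> U \<Longrightarrow> \<Omega> (\<lambda>y. ang y $ 1) z = - ang z $ 2"
  and \<Omega>_ang_2: "z \<in> U \<Longrightarrow> \<Omega> (\<lambda>y. ang y $ 2) z = ang z $ 1"
proof -
  assume z: "z \<in> U"
  have 1: "ang z $ 2 * ang z $ 2 = 1 - ang z $ 1 * ang z $ 1" using ang_unit[OF z] by simp
  show "\<Omega> (\<lambda>y. ang y $ 1) z = - ang z $ 2" "\<Omega> (\<lambda>y. ang y $ 2) z = ang z $ 1"
    using rad_pos[OF z] 1
    by (simp_all add: \<Omega>_eq_angular[OF z] angular_def pd_ang[OF z] dir_simps axis_2_simps field_simps)
qed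

lemma radial_ang: "z \<in> U \<Longrightarrow> radial (\<lambda>y. ang y $ i) z = 0"
proof -
  assume z: "z \<in> U"
  have 1: "ang z $ 2 * ang z $ 2 = 1 - ang z $ 1 * ang z $ 1" using ang_unit[OF z] by simp
  have "radial (\<lambda>y. ang y $ 1) z = 0" "radial (\<lambda>y. ang y $ 2) z = 0"
    unfolding radial_def pd_ang[OF z] dir_simps
    by (simp_all add: axis_2_simps rad_nz[OF z] add_divide_distrib[symmetric] del: One_nat_def) (use 1 in algebra)+
  then show "radial (\<lambda>y. ang y $ i) z = 0" using exhaust_2[of i] by auto
qed

lemma \<Omega>_div_rad: "smooth_on U f \<Longrightarrow> z \<in> U \<Longrightarrow> \<Omega> (\<lambda>y. f y / rad y) z = \<Omega> f z / rad z"
proof -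
  assume f: "smooth_on U f" and z: "z \<in> U"
  have "\<Omega> (\<lambda>y. f y / rad y) z = \<Omega> f z / rad z - f z * \<Omega> rad z / (rad z)\<^sup>2"
    by (simp add: \<Omega>_def pd_div_rad[OF f z] diff_divide_distrib algebra_simps)
  then show ?thesis by (simp add: \<Omega>_rad[OF z])
qed

text \<open>The field \<omega>/|x| is the gradient of log |x|, which is harmonic off the origin in
  two dimensions. So it is divergence free, and only the derivative of H remains.\<close>

lemma div_radial:
  assumes H: "smooth_on U H" and z: "z \<in> U"
  shows "\<partial> 1 (\<lambda>y. ang y $ 1 * H y / rad y) z + \<partial> 2 (\<lambda>y. ang y $ 2 * H y / rad y) z = radial H z / rad z"
proof -
  have 1: "ang z $ 2 * ang z $ 2 = 1 - ang z $ 1 * ang z $ 1" using ang_unit[OF z] by simp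
  show ?thesis
    using H z rad_pos[OF z] 1
    by (simp add: pd_div_rad pd_mult[OF open_U] smooth_polar pd_ang pd_rad dir_simps axis_2_simps radial_def
        field_simps power2_eq_square) algebra
qed

lemma radial_mult: "smooth_on U f \<Longrightarrow> smooth_on U g \<Longrightarrow> z \<in> U \<Longrightarrow>
    radial (\<lambda>y. f y * g y) z = f z * radial g z + radial f z * g z"
  by (simp add: radial_def pd_mult[OF open_U] algebra_simps)

lemma \<Omega>_diff: "smooth_on U f \<Longrightarrow> smooth_on U g \<Longrightarrow> z \<in> U \<Longrightarrow> \<Omega> (\<lambda>z. f z - g z) z = \<Omega> f z - \<Omega> g z"
  by (simp add: \<Omega>_def pd_diff[OF open_U] algebra_simps)

lemma \<Omega>_radial: "smooth_on U f \<Longrightarrow> z \<in> U \<Longrightarrow> \<Omega> (radial f) z = radial_\<Omega> f z + angular f z"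
  unfolding radial_def
  by (simp add: \<Omega>_add[OF open_U] \<Omega>_mult[OF open_U] smooth_polar \<Omega>_ang_1 \<Omega>_ang_2 radial_\<Omega>_def angular_def)

lemma \<Omega>_angular: "smooth_on U f \<Longrightarrow> z \<in> U \<Longrightarrow> \<Omega> (angular f) z = angular_\<Omega> f z - radial f z"
  unfolding angular_def
  by (simp add: \<Omega>_diff \<Omega>_mult[OF open_U] smooth_polar \<Omega>_ang_1 \<Omega>_ang_2 angular_\<Omega>_def radial_def)

text \<open>The coordinate fields of polar coordinates commute.\<close>

lemma radial_of_\<Omega>: "smooth_on U f \<Longrightarrow> z \<in> U \<Longrightarrow> radial (\<Omega> f) z = \<Omega> (radial f) z"
  by (simp add: \<Omega>_radial) (simp add: radial_def radial_\<Omega>_def angular_def pd_\<Omega>[OF open_U] dir_simps axis_2_simps algebra_simps)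

lemma pd_0_\<Omega>_pd: 
  assumes f: "smooth_on U f" and z: "z \<in> U"
  shows "\<partial> 0 (\<Omega> (\<partial> \<mu> f)) z = \<Omega> (\<partial> \<mu> (\<partial> 0 f)) z"
  using pd_\<Omega>[OF open_U smooth_on_pd[OF open_U f] z, of 0 \<mu>] \<Omega>_cong[OF open_U pd_commute[OF open_U f, where \<mu> = 0 and \<nu> = \<mu>] z]
  by (simp add: dir_simps)

lemma pd_0_radial_\<Omega>: "smooth_on U f \<Longrightarrow> z \<in> U \<Longrightarrow> \<partial> 0 (radial_\<Omega> f) z = radial_\<Omega> (\<partial> 0 f) z"
  unfolding radial_\<Omega>_def
  by (simp add: pd_add[OF open_U] pd_mult[OF open_U] smooth_polar pd_0_ang pd_0_\<Omega>_pd)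

lemma pd_0_angular_\<Omega>: "smooth_on U f \<Longrightarrow> z \<in> U \<Longrightarrow> \<partial> 0 (angular_\<Omega> f) z = angular_\<Omega> (\<partial> 0 f) z"
  unfolding angular_\<Omega>_def
  by (simp add: pd_diff[OF open_U] pd_mult[OF open_U] smooth_polar pd_0_ang pd_0_\<Omega>_pd)

lemma pd_0_pol: 
  assumes "z \<in> U"
  shows "\<partial> 0 (\<lambda>y. pol_rr s\<^sub>1 s\<^sub>2 (ang y)) z = 0" "\<partial> 0 (\<lambda>y. pol_r\<theta> s\<^sub>1 s\<^sub>2 (ang y)) z = 0"
  unfolding pol_rr_def pol_r\<theta>_def using assms
  by (simp_all add: pd_add[OF open_U] pd_diff[OF open_U] pd_mult[OF open_U] smooth_polar pd_0_ang)

text \<open>In terms of the angle, \<open>pol_rr\<close> is s_1 cos 2\<theta> + s_2 sin 2\<theta>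
  and \<open>pol_r\<theta>\<close> is s_2 cos 2\<theta> - s_1 sin 2\<theta>, which differentiate
  into each other up to the factors 2 and -2.\<close>

lemma \<Omega>_pol: 
  assumes "z \<in> U"
  shows "\<Omega> (\<lambda>y. pol_rr s\<^sub>1 s\<^sub>2 (ang y)) z = 2 * pol_r\<theta> s\<^sub>1 s\<^sub>2 (ang z)"
    "\<Omega> (\<lambda>y. pol_r\<theta> s\<^sub>1 s\<^sub>2 (ang y)) z = - 2 * pol_rr s\<^sub>1 s\<^sub>2 (ang z)"
proof -
  have c: "\<Omega> (\<lambda>y. c) z = 0" for c by (simp add: \<Omega>_def)
  show "\<Omega> (\<lambda>y. pol_rr s\<^sub>1 s\<^sub>2 (ang y)) z = 2 * pol_r\<theta> s\<^sub>1 s\<^sub>2 (ang z)"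
    "\<Omega> (\<lambda>y. pol_r\<theta> s\<^sub>1 s\<^sub>2 (ang y)) z = - 2 * pol_rr s\<^sub>1 s\<^sub>2 (ang z)"
    unfolding pol_rr_def pol_r\<theta>_def using assms
    by (simp_all add: \<Omega>_add[OF open_U] \<Omega>_diff \<Omega>_mult[OF open_U] smooth_polar \<Omega>_ang_1 \<Omega>_ang_2 c algebra_simps)
qed

lemma radial_pol_r\<theta>: 
  assumes "z \<in> U" shows "radial (\<lambda>y. pol_r\<theta> s\<^sub>1 s\<^sub>2 (ang y)) z = 0"
proof -
  have c: "radial (\<lambda>y. c) z = 0" for c by (simp add: radial_def)
  have d: "radial (\<lambda>y. f y - g y) z = radial f z - radial g z" if "smooth_on U f" "smooth_on U g" for f g
    using that assms by (simp add: radial_def pd_diff[OF open_U] algebra_simps)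
  show ?thesis
    unfolding pol_r\<theta>_def using assms
    by (simp add: radial_mult d smooth_polar c radial_ang)
qed

section \<open>Null forms in polar coordinates and as divergences\<close>

lemma Q12_polar:
  assumes "z \<in> U"
  shows "Q12 f g z = (radial f z * \<Omega> g z - \<Omega> f z * radial g z) / rad z"
proof -
  have "Q12 f g z = (ang z $ 1 * ang z $ 1 + ang z $ 2 * ang z $ 2) * Q12 f g z"
    by (simp add: ang_unit[OF assms])
  also have "\<dots> = radial f z * angular g z - angular f z * radial g z"
    by (simp add: Q12_def radial_def angular_def algebra_simps)
  finally show ?thesis by (simp add: \<Omega>_eq_angular[OF assms] diff_divide_distrib rad_nz[OF assms])
qed

text \<open>Pulling the derivatives off w in \<open>Q12_polar\<close> leaves the second-order terms
  \<Omega> \<partial>_r f and \<partial>_r \<Omega> f, each times w/|x| and with opposite signs;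
  they cancel by \<open>radial_of_\<Omega>\<close>. The weight 1/|x| itself costs nothing, by
  \<open>\<Omega>_div_rad\<close> and \<open>div_radial\<close>.\<close>

lemma Q12_divergence:
  assumes f: "smooth_on U f" and w: "smooth_on U w" and z: "z \<in> U"
  shows "Q12 f w z = \<Omega> (\<lambda>y. radial f y * w y / rad y) z
    - (\<partial> 1 (\<lambda>y. ang y $ 1 * (\<Omega> f y * w y) / rad y) z + \<partial> 2 (\<lambda>y. ang y $ 2 * (\<Omega> f y * w y) / rad y) z)"
  unfolding div_radial[OF smooth_on_mult[OF open_U smooth_on_\<Omega>[OF open_U f] w] z]
  using f w z
  by (simp add: \<Omega>_div_rad \<Omega>_mult[OF open_U] radial_mult smooth_polar radial_of_\<Omega> Q12_polar
      diff_divide_distrib[symmetric] algebra_simps)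

text \<open>Write r and a for the radial and angular directions of the frame, S for
  \<open>pol_rr\<close> and T for \<open>pol_r\<theta>\<close>. The form is S (v_tr w_r - v_ta w_a)
  + T (v_tr w_a + v_ta w_r) - (S (v_rr - v_aa) + 2 T v_ra) w_t. Eliminating v_tr w_r through
  \<open>Q0\<close> and v_rr through \<open>box\<close> leaves only terms with a derivative in the
  direction a, and each such derivative is \<Omega>/|x|.\<close>

lemma tracefree_form_polar:
  assumes v: "smooth_on U v" and z: "z \<in> U"
  shows "tracefree_form s\<^sub>1 s\<^sub>2 v w z =
    - pol_rr s\<^sub>1 s\<^sub>2 (ang z) * Q0 (\<partial> 0 v) w z + pol_rr s\<^sub>1 s\<^sub>2 (ang z) * \<box> v z * \<partial> 0 w z
    + (pol_r\<theta> s\<^sub>1 s\<^sub>2 (ang z) * radial (\<partial> 0 v) z * \<Omega> w z + pol_r\<theta> s\<^sub>1 s\<^sub>2 (ang z) * \<Omega> (\<partial> 0 v) z * radial w z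
       + 2 * (pol_rr s\<^sub>1 s\<^sub>2 (ang z) * angular_\<Omega> v z - pol_r\<theta> s\<^sub>1 s\<^sub>2 (ang z) * radial_\<Omega> v z) * \<partial> 0 w z
       - 2 * pol_rr s\<^sub>1 s\<^sub>2 (ang z) * angular (\<partial> 0 v) z * \<Omega> w z) / rad z"
proof -
  define p q where "p = ang z $ 1" and "q = ang z $ 2"
  have pq: "p * p + q * q = 1" using ang_unit[OF z] by (simp add: p_def q_def)
  have alg: "s\<^sub>1 * (v01 * w1 - v02 * w2 - (v11 - v22) * w0) + s\<^sub>2 * (v01 * w2 + v02 * w1 - 2 * v12 * w0) =
      - S * (v00 * w0 - (v01 * w1 + v02 * w2)) + S * (v00 - (v11 + v22)) * w0
      + (T * (p * v01 + q * v02) * (p * w2 - q * w1) + T * (p * v02 - q * v01) * (p * w1 + q * w2)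
        + 2 * (S * (p * (p * v22 - q * v12) - q * (p * v12 - q * v11))
               - T * (p * (p * v12 - q * v11) + q * (p * v22 - q * v12))) * w0
        - 2 * S * (p * v02 - q * v01) * (p * w2 - q * w1))"
    if S: "S = s\<^sub>1 * (p * p - q * q) + 2 * s\<^sub>2 * (p * q)" and T: "T = s\<^sub>2 * (p * p - q * q) - 2 * s\<^sub>1 * (p * q)"
    for S T v00 v01 v02 v11 v12 v22 w0 w1 w2 :: real
  proof -
    \<comment> \<open>The identity holds only modulo p^2 + q^2 = 1. Multiplying by powers of this
      norm makes both sides homogeneous of degree 4 in (p, q), and then it is an identity of
      polynomials.\<close>
    let ?n = "p * p + q * q"
    have "?n * ?n * (s\<^sub>1 * (v01 * w1 - v02 * w2 - (v11 - v22) * w0) + s\<^sub>2 * (v01 * w2 + v02 * w1 - 2 * v12 * w0)) =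
      ?n * (- S * (v00 * w0 - (v01 * w1 + v02 * w2)) + S * (v00 - (v11 + v22)) * w0)
      + (T * (p * v01 + q * v02) * (p * w2 - q * w1) + T * (p * v02 - q * v01) * (p * w1 + q * w2)
        + 2 * (S * (p * (p * v22 - q * v12) - q * (p * v12 - q * v11))
               - T * (p * (p * v12 - q * v11) + q * (p * v22 - q * v12))) * w0
        - 2 * S * (p * v02 - q * v01) * (p * w2 - q * w1))"
      unfolding S T by algebra
    then show ?thesis unfolding pq by simp
  qed
  have r: "rad z > 0" using rad_pos[OF z] .
  have 1: "\<partial> 2 (\<partial> 1 v) z = \<partial> 1 (\<partial> 2 v) z" "\<partial> 0 (\<partial> 1 v) z = \<partial> 1 (\<partial> 0 v) z" "\<partial> 0 (\<partial> 2 v) z = \<partial> 2 (\<partial> 0 v) z"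
    using pd_commute[OF open_U v z] by auto
  have S: "pol_rr s\<^sub>1 s\<^sub>2 (ang z) = s\<^sub>1 * (p * p - q * q) + 2 * s\<^sub>2 * (p * q)"
    and T: "pol_r\<theta> s\<^sub>1 s\<^sub>2 (ang z) = s\<^sub>2 * (p * p - q * q) - 2 * s\<^sub>1 * (p * q)"
    by (simp_all add: pol_rr_def pol_r\<theta>_def p_def q_def)
  define T' where "T' = pol_r\<theta> s\<^sub>1 s\<^sub>2 (ang z)"
  define S' where "S' = pol_rr s\<^sub>1 s\<^sub>2 (ang z)"
  have ra: "radial_\<Omega> v z = rad z * (p * angular (\<partial> 1 v) z + q * angular (\<partial> 2 v) z)"
    "angular_\<Omega> v z = rad z * (p * angular (\<partial> 2 v) z - q * angular (\<partial> 1 v) z)"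
    by (simp_all add: radial_\<Omega>_def angular_\<Omega>_def \<Omega>_eq_angular[OF z] p_def q_def algebra_simps)
  have "(T' * radial (\<partial> 0 v) z * \<Omega> w z + T' * \<Omega> (\<partial> 0 v) z * radial w z
       + 2 * (S' * angular_\<Omega> v z - T' * radial_\<Omega> v z) * \<partial> 0 w z
       - 2 * S' * angular (\<partial> 0 v) z * \<Omega> w z) / rad z =
    T' * radial (\<partial> 0 v) z * angular w z + T' * angular (\<partial> 0 v) z * radial w z
       + 2 * (S' * (p * angular (\<partial> 2 v) z - q * angular (\<partial> 1 v) z)
              - T' * (p * angular (\<partial> 1 v) z + q * angular (\<partial> 2 v) z)) * \<partial> 0 w z
       - 2 * S' * angular (\<partial> 0 v) z * angular w z"
    using r unfolding ra \<Omega>_eq_angular[OF z] by (simp add: field_simps)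
  then show ?thesis
    unfolding T'_def[symmetric] S'_def[symmetric]
    using alg[OF S T, of "\<partial> 1 (\<partial> 0 v) z" "\<partial> 1 w z" "\<partial> 2 (\<partial> 0 v) z" "\<partial> 2 w z" "\<partial> 1 (\<partial> 1 v) z"
        "\<partial> 2 (\<partial> 2 v) z" "\<partial> 0 w z" "\<partial> 1 (\<partial> 2 v) z" "\<partial> 0 (\<partial> 0 v) z"]
    unfolding T'_def[symmetric] S'_def[symmetric] tracefree_form_def Q0_unfold box_def \<Delta>_def radial_def angular_def
      p_def[symmetric] q_def[symmetric] 1
    by linarith
qed

text \<open>The terms with \<Omega> w, with the radial and with the time derivative of w go into the
  three divergences. With S, T for \<open>pol_rr\<close>, \<open>pol_r\<theta>\<close> and v_t for
  the time derivative, the leftovers with undifferentiated w are: T \<open>radial_\<Omega>\<close>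
  v_t with factor 1 + 1 - 2, S \<open>angular_\<Omega>\<close> v_t with -2 + 2, S
  \<open>radial\<close> v_t with -2 + 2, and T \<open>angular\<close> v_t with 1 - 4 + 1. The last
  one, -2, is compensated by the final summand, since \<Omega> is |x| times
  \<open>angular\<close>.\<close>

lemma tracefree_remainder_divergence:
  assumes v: "smooth_on U v" and w: "smooth_on U w" and z: "z \<in> U"
  shows "(pol_r\<theta> s\<^sub>1 s\<^sub>2 (ang z) * radial (\<partial> 0 v) z * \<Omega> w z + pol_r\<theta> s\<^sub>1 s\<^sub>2 (ang z) * \<Omega> (\<partial> 0 v) z * radial w z
       + 2 * (pol_rr s\<^sub>1 s\<^sub>2 (ang z) * angular_\<Omega> v z - pol_r\<theta> s\<^sub>1 s\<^sub>2 (ang z) * radial_\<Omega> v z) * \<partial> 0 w z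
       - 2 * pol_rr s\<^sub>1 s\<^sub>2 (ang z) * angular (\<partial> 0 v) z * \<Omega> w z) / rad z =
    \<Omega> (\<lambda>y. (pol_r\<theta> s\<^sub>1 s\<^sub>2 (ang y) * radial (\<partial> 0 v) y - 2 * (pol_rr s\<^sub>1 s\<^sub>2 (ang y) * angular (\<partial> 0 v) y)) * w y / rad y) z
    + (\<partial> 1 (\<lambda>y. ang y $ 1 * (pol_r\<theta> s\<^sub>1 s\<^sub>2 (ang y) * \<Omega> (\<partial> 0 v) y * w y) / rad y) z
      + \<partial> 2 (\<lambda>y. ang y $ 2 * (pol_r\<theta> s\<^sub>1 s\<^sub>2 (ang y) * \<Omega> (\<partial> 0 v) y * w y) / rad y) z)
    + \<partial> 0 (\<lambda>y. 2 * (pol_rr s\<^sub>1 s\<^sub>2 (ang y) * angular_\<Omega> v y - pol_r\<theta> s\<^sub>1 s\<^sub>2 (ang y) * radial_\<Omega> v y) * w y / rad y) z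
    + 2 * pol_r\<theta> s\<^sub>1 s\<^sub>2 (ang z) * \<Omega> (\<partial> 0 v) z * w z / (rad z)\<^sup>2" (is "?L = ?A + ?B + ?C + ?D")
proof -
  let ?v = "\<partial> 0 v" and ?S = "pol_rr s\<^sub>1 s\<^sub>2 (ang z)" and ?T = "pol_r\<theta> s\<^sub>1 s\<^sub>2 (ang z)"
  have c: "\<Omega> (\<lambda>y. c) z = 0" for c by (simp add: \<Omega>_def)
  note sm = v w smooth_on_pd[OF open_U v] smooth_polar
  have A: "?A = ((?T * radial ?v z - 2 * (?S * angular ?v z)) * \<Omega> w z +
      (?T * (radial_\<Omega> ?v z + angular ?v z) - 2 * ?S * radial ?v z
       - 2 * (?S * (angular_\<Omega> ?v z - radial ?v z) + 2 * ?T * angular ?v z)) * w z) / rad z"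
    by (simp add: sm z \<Omega>_div_rad \<Omega>_mult[OF open_U] \<Omega>_diff \<Omega>_pol \<Omega>_radial \<Omega>_angular c)
  have B: "?B = (?T * \<Omega> ?v z * radial w z + ?T * (radial_\<Omega> ?v z + angular ?v z) * w z) / rad z"
    by (subst div_radial) (simp_all add: sm z radial_mult radial_pol_r\<theta> radial_of_\<Omega> \<Omega>_radial)
  have C: "?C = (2 * (?S * angular_\<Omega> v z - ?T * radial_\<Omega> v z) * \<partial> 0 w z +
      2 * (?S * angular_\<Omega> ?v z - ?T * radial_\<Omega> ?v z) * w z) / rad z"
    by (simp add: sm z pd_0_div_rad pd_mult[OF open_U] pd_diff[OF open_U] pd_0_pol pd_0_radial_\<Omega> pd_0_angular_\<Omega>)
  have D: "?D = 2 * ?T * angular ?v z * w z / rad z"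
    using rad_pos[OF z] by (simp add: \<Omega>_eq_angular[OF z] power2_eq_square)
  show ?thesis
    unfolding A B C D by (simp add: add_divide_distrib[symmetric]) (rule disjI2, algebra)
qed

end

subsection \<open>Decomposition of null forms\<close>

text \<open>The coefficients solve the linear system obtained by comparing the coefficients of
  \<open>\<partial>\<^sub>\<alpha> \<partial>\<^sub>\<beta> v \<partial>\<^sub>\<gamma> w\<close> in \<open>quad_form_null\<close> below.\<close>

definition coef_box :: "(nat \<Rightarrow> nat \<Rightarrow> nat \<Rightarrow> real) \<Rightarrow> nat \<Rightarrow> real" where
  "coef_box q \<mu> = (if \<mu> = 0 then - (q 1 1 0 + q 2 2 0) / 2 else q 0 0 \<mu>)"

definition coef_Q0 :: "(nat \<Rightarrow> nat \<Rightarrow> nat \<Rightarrow> real) \<Rightarrow> nat \<Rightarrow> real" where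
  "coef_Q0 q \<mu> = (if \<mu> = 0 then q 0 0 0 - coef_box q 0 else q 0 \<mu> 0 + q \<mu> 0 0)"

definition coef_Q12 :: "(nat \<Rightarrow> nat \<Rightarrow> nat \<Rightarrow> real) \<Rightarrow> nat \<Rightarrow> real" where
  "coef_Q12 q \<mu> = (if \<mu> = 0 then (q 0 1 2 + q 1 0 2 - q 0 2 1 - q 2 0 1) / 2
     else if \<mu> = 1 then - (q 1 2 1 + q 2 1 1) - (q 0 2 0 + q 2 0 0)
     else - q 2 2 1 - q 0 0 1)"

definition tf\<^sub>1 :: "(nat \<Rightarrow> nat \<Rightarrow> nat \<Rightarrow> real) \<Rightarrow> real" where
  "tf\<^sub>1 q = (q 2 2 0 - q 1 1 0) / 2"

definition tf\<^sub>2 :: "(nat \<Rightarrow> nat \<Rightarrow> nat \<Rightarrow> real) \<Rightarrow> real" where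
  "tf\<^sub>2 q = - (q 1 2 0 + q 2 1 0) / 2"

lemma quad_form_null:
  assumes U: "open U" and q: "null_tensor q" and v: "smooth_on U v" and z: "z \<in> U"
  shows "quad_form q v w z = (\<Sum>\<mu>\<le>2. coef_Q12 q \<mu> * Q12 (\<partial> \<mu> v) w z + coef_Q0 q \<mu> * Q0 (\<partial> \<mu> v) w z
      + coef_box q \<mu> * \<box> v z * \<partial> \<mu> w z) + tracefree_form (tf\<^sub>1 q) (tf\<^sub>2 q) v w z"
proof -
  have c0: "coef_box q 0 = - (q 1 1 0 + q 2 2 0) / 2" "coef_Q0 q 0 = q 0 0 0 + (q 1 1 0 + q 2 2 0) / 2"
    "coef_Q0 q 1 = q 0 1 0 + q 1 0 0" "coef_Q0 q 2 = q 0 2 0 + q 2 0 0"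
    "coef_box q 1 = q 0 0 1" "coef_box q 2 = q 0 0 2"
    "coef_Q12 q 0 = (q 0 1 2 + q 1 0 2 - q 0 2 1 - q 2 0 1) / 2"
    "coef_Q12 q 1 = - (q 1 2 1 + q 2 1 1) - (q 0 2 0 + q 2 0 0)" "coef_Q12 q 2 = - q 2 2 1 - q 0 0 1"
    by (simp_all add: coef_box_def coef_Q0_def coef_Q12_def field_simps)
  \<comment> \<open>One equation for each of the 18 coefficients that remain once the second
    derivatives are taken symmetric.\<close>
  have e:
    "q 0 0 0 = coef_Q0 q 0 + coef_box q 0"
    "q 0 1 0 + q 1 0 0 = coef_Q0 q 1"
    "q 0 2 0 + q 2 0 0 = coef_Q0 q 2"
    "q 1 1 0 = - coef_box q 0 - tf\<^sub>1 q"
    "q 2 2 0 = - coef_box q 0 + tf\<^sub>1 q"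
    "q 1 2 0 + q 2 1 0 = - 2 * tf\<^sub>2 q"
    "q 0 0 1 = coef_box q 1"
    "q 0 0 2 = coef_box q 2"
    "q 0 1 1 + q 1 0 1 = - coef_Q0 q 0 + tf\<^sub>1 q"
    "q 0 2 2 + q 2 0 2 = - coef_Q0 q 0 - tf\<^sub>1 q"
    "q 0 2 1 + q 2 0 1 = - coef_Q12 q 0 + tf\<^sub>2 q"
    "q 0 1 2 + q 1 0 2 = coef_Q12 q 0 + tf\<^sub>2 q"
    "q 1 1 1 = - coef_Q0 q 1 - coef_box q 1"
    "q 2 2 1 = - coef_box q 1 - coef_Q12 q 2"
    "q 1 2 1 + q 2 1 1 = - coef_Q0 q 2 - coef_Q12 q 1"
    "q 1 1 2 = - coef_box q 2 + coef_Q12 q 1"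
    "q 2 2 2 = - coef_Q0 q 2 - coef_box q 2"
    "q 1 2 2 + q 2 1 2 = - coef_Q0 q 1 + coef_Q12 q 2"
    using q unfolding null_tensor_def c0 tf\<^sub>1_def tf\<^sub>2_def
    by (elim conjE; simp add: diff_divide_distrib add_divide_distrib del: One_nat_def; linarith?)+
  have alg: "(\<Sum>\<alpha>\<le>2. \<Sum>\<beta>\<le>2. \<Sum>\<gamma>\<le>2. q \<alpha> \<beta> \<gamma> * v \<alpha> \<beta> * w \<gamma>) =
      (\<Sum>\<mu>\<le>2. coef_Q12 q \<mu> * (v 1 \<mu> * w 2 - v 2 \<mu> * w 1)
        + coef_Q0 q \<mu> * (v 0 \<mu> * w 0 - (v 1 \<mu> * w 1 + v 2 \<mu> * w 2))
        + coef_box q \<mu> * (v 0 0 - (v 1 1 + v 2 2)) * w \<mu>)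
      + (tf\<^sub>1 q * (v 1 0 * w 1 - v 2 0 * w 2 - (v 1 1 - v 2 2) * w 0)
         + tf\<^sub>2 q * (v 1 0 * w 2 + v 2 0 * w 1 - 2 * v 1 2 * w 0))"
    if c: "v 1 0 = v 0 1" "v 2 0 = v 0 2" "v 2 1 = v 1 2" for v :: "nat \<Rightarrow> nat \<Rightarrow> real" and w :: "nat \<Rightarrow> real"
  proof -
    have "(\<Sum>\<alpha>\<le>2. \<Sum>\<beta>\<le>2. \<Sum>\<gamma>\<le>2. q \<alpha> \<beta> \<gamma> * v \<alpha> \<beta> * w \<gamma>) =
        (q 0 0 0) * (v 0 0 * w 0) + (q 0 1 0 + q 1 0 0) * (v 0 1 * w 0)
        + (q 0 2 0 + q 2 0 0) * (v 0 2 * w 0) + (q 1 1 0) * (v 1 1 * w 0) + (q 2 2 0) * (v 2 2 * w 0)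
        + (q 1 2 0 + q 2 1 0) * (v 1 2 * w 0) + (q 0 0 1) * (v 0 0 * w 1) + (q 0 0 2) * (v 0 0 * w 2)
        + (q 0 1 1 + q 1 0 1) * (v 0 1 * w 1) + (q 0 2 2 + q 2 0 2) * (v 0 2 * w 2)
        + (q 0 2 1 + q 2 0 1) * (v 0 2 * w 1) + (q 0 1 2 + q 1 0 2) * (v 0 1 * w 2)
        + (q 1 1 1) * (v 1 1 * w 1) + (q 2 2 1) * (v 2 2 * w 1) + (q 1 2 1 + q 2 1 1) * (v 1 2 * w 1)
        + (q 1 1 2) * (v 1 1 * w 2) + (q 2 2 2) * (v 2 2 * w 2) + (q 1 2 2 + q 2 1 2) * (v 1 2 * w 2)"
      unfolding sum_atMost_2 c by (simp add: algebra_simps del: One_nat_def)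
    also have "\<dots> = (\<Sum>\<mu>\<le>2. coef_Q12 q \<mu> * (v 1 \<mu> * w 2 - v 2 \<mu> * w 1)
        + coef_Q0 q \<mu> * (v 0 \<mu> * w 0 - (v 1 \<mu> * w 1 + v 2 \<mu> * w 2))
        + coef_box q \<mu> * (v 0 0 - (v 1 1 + v 2 2)) * w \<mu>)
      + (tf\<^sub>1 q * (v 1 0 * w 1 - v 2 0 * w 2 - (v 1 1 - v 2 2) * w 0)
         + tf\<^sub>2 q * (v 1 0 * w 2 + v 2 0 * w 1 - 2 * v 1 2 * w 0))"
      unfolding e sum_atMost_2 c by (simp add: algebra_simps del: One_nat_def)
    finally show ?thesis .
  qed
  show ?thesis
    unfolding quad_form_def Q12_def Q0_unfold box_def \<Delta>_def tracefree_form_def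
    by (rule alg) (rule pd_commute[OF U v z])+
qed

text \<open>The case distinctions in these coefficients are written as constant factors 0 or 1, so
  that each coefficient is visibly a polynomial in x for any values of the indices.\<close>

definition pol_Q0 :: "(nat \<Rightarrow> nat \<Rightarrow> nat \<Rightarrow> real) \<Rightarrow> nat \<Rightarrow> real^2 \<Rightarrow> real" where
  "pol_Q0 q \<mu> x = coef_Q0 q \<mu> - (if \<mu> = 0 then 1 else 0) * pol_rr (tf\<^sub>1 q) (tf\<^sub>2 q) x"

definition pol_box :: "(nat \<Rightarrow> nat \<Rightarrow> nat \<Rightarrow> real) \<Rightarrow> nat \<Rightarrow> real^2 \<Rightarrow> real" where
  "pol_box q \<mu> x = coef_box q \<mu> + (if \<mu> = 0 then 1 else 0) * pol_rr (tf\<^sub>1 q) (tf\<^sub>2 q) x"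

definition pol_A :: "(nat \<Rightarrow> nat \<Rightarrow> nat \<Rightarrow> real) \<Rightarrow> nat \<Rightarrow> nat \<Rightarrow> real^2 \<Rightarrow> real" where
  "pol_A q \<mu> \<nu> x = (if \<nu> = 0 then 1 else 0) *
     ((if \<mu> = 1 then 1 else 0) * (pol_r\<theta> (tf\<^sub>1 q) (tf\<^sub>2 q) x * x$1 + 2 * pol_rr (tf\<^sub>1 q) (tf\<^sub>2 q) x * x$2) +
      (if \<mu> = 2 then 1 else 0) * (pol_r\<theta> (tf\<^sub>1 q) (tf\<^sub>2 q) x * x$2 - 2 * pol_rr (tf\<^sub>1 q) (tf\<^sub>2 q) x * x$1))"

definition pol_B :: "(nat \<Rightarrow> nat \<Rightarrow> nat \<Rightarrow> real) \<Rightarrow> nat \<Rightarrow> nat \<Rightarrow> real^2 \<Rightarrow> real" where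
  "pol_B q \<mu> \<nu> x =
     (if \<mu> = 0 \<and> \<nu> = 1 then 1 else 0) * (pol_r\<theta> (tf\<^sub>1 q) (tf\<^sub>2 q) x * x$1) +
     (if \<mu> = 0 \<and> \<nu> = 2 then 1 else 0) * (pol_r\<theta> (tf\<^sub>1 q) (tf\<^sub>2 q) x * x$2) -
     (if \<mu> = 1 \<and> \<nu> = 0 then 1 else 0) * (2 * (pol_rr (tf\<^sub>1 q) (tf\<^sub>2 q) x * x$2 + pol_r\<theta> (tf\<^sub>1 q) (tf\<^sub>2 q) x * x$1)) +
     (if \<mu> = 2 \<and> \<nu> = 0 then 1 else 0) * (2 * (pol_rr (tf\<^sub>1 q) (tf\<^sub>2 q) x * x$1 - pol_r\<theta> (tf\<^sub>1 q) (tf\<^sub>2 q) x * x$2))"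

definition pol_P :: "(nat \<Rightarrow> nat \<Rightarrow> nat \<Rightarrow> real) \<Rightarrow> nat \<Rightarrow> nat \<Rightarrow> real^2 \<Rightarrow> real" where
  "pol_P q \<mu> \<nu> x = coef_Q12 q \<nu> * ((if \<mu> = 1 then 1 else 0) * x$1 + (if \<mu> = 2 then 1 else 0) * x$2) + pol_A q \<mu> \<nu> x"

text \<open>Every first-order field needed under the divergence is \<Omega>, so only j = 4
  contributes. The time component collects the terms \<Omega>\<partial>v \<partial>_t w, whose
  coefficients are those of \<open>pol_B\<close>; the space components are radial.\<close>

definition pol_R :: "(nat \<Rightarrow> nat \<Rightarrow> nat \<Rightarrow> real) \<Rightarrow> nat \<Rightarrow> nat \<Rightarrow> nat \<Rightarrow> real^2 \<Rightarrow> real" where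
  "pol_R q \<mu> j \<nu> x = (if j = 4 then 1 else 0) * (
     (if \<mu> = 0 then 1 else 0) * pol_B q \<nu> 0 x +
     ((if \<nu> = 0 then 1 else 0) * pol_r\<theta> (tf\<^sub>1 q) (tf\<^sub>2 q) x - coef_Q12 q \<nu>) *
     ((if \<mu> = 1 then 1 else 0) * x$1 + (if \<mu> = 2 then 1 else 0) * x$2))"

definition pol_S :: "(nat \<Rightarrow> nat \<Rightarrow> nat \<Rightarrow> real) \<Rightarrow> nat \<Rightarrow> nat \<Rightarrow> real^2 \<Rightarrow> real" where
  "pol_S q j \<nu> x = (if j = 4 \<and> \<nu> = 0 then 2 else 0) * pol_r\<theta> (tf\<^sub>1 q) (tf\<^sub>2 q) x"

lemma real_polynomial_function_nth: "real_polynomial_function (\<lambda>x::real^2. x $ i)"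
  by (intro real_polynomial_function.intros(1) bounded_linear_vec_nth)

lemmas polynomial_intros = real_polynomial_function.intros(2) real_polynomial_function_nth
  real_polynomial_function.intros(3,4) real_polynomial_function_diff

lemma real_polynomial_function_coefficients:
  "real_polynomial_function (pol_Q0 q \<mu>)" "real_polynomial_function (pol_box q \<mu>)"
  "real_polynomial_function (pol_A q \<mu> \<nu>)" "real_polynomial_function (pol_B q \<mu> \<nu>)"
  "real_polynomial_function (pol_P q \<mu> \<nu>)" "real_polynomial_function (pol_R q \<mu> j \<nu>)"
  "real_polynomial_function (pol_S q j \<nu>)"
  unfolding pol_Q0_def[abs_def] pol_box_def[abs_def] pol_A_def[abs_def] pol_B_def[abs_def] pol_P_def[abs_def]
    pol_R_def[abs_def] pol_S_def[abs_def] pol_rr_def pol_r\<theta>_def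
  by (intro polynomial_intros)+

lemma sum_1_4: "(\<Sum>j = 1..4. f j) = f 1 + f 2 + f 3 + f (4::nat)" for f :: "nat \<Rightarrow> 'a::comm_monoid_add"
  by (simp add: numeral_eq_Suc sum.atLeast_Suc_atMost add.assoc)

context
  fixes U :: "spacetime set"
  assumes open_U: "open U" and off: "U \<subseteq> {z. snd z \<noteq> 0}"
begin

lemma quad_form_polar:
  assumes q: "null_tensor q" and v: "smooth_on U v" and z: "z \<in> U"
  shows "quad_form q v w z =
    (\<Sum>\<mu>\<le>2. \<Sum>\<nu>\<le>2. 1 / rad z *
       (pol_A q \<mu> \<nu> (ang z) * \<partial> \<mu> (\<partial> \<nu> v) z * \<Omega> w z + pol_B q \<mu> \<nu> (ang z) * \<Omega> (\<partial> \<mu> v) z * \<partial> \<nu> w z))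
    + (\<Sum>\<mu>\<le>2. coef_Q12 q \<mu> * Q12 (\<partial> \<mu> v) w z + pol_Q0 q \<mu> (ang z) * Q0 (\<partial> \<mu> v) w z
        + pol_box q \<mu> (ang z) * \<box> v z * \<partial> \<mu> w z)"
  unfolding quad_form_null[OF open_U q v z] tracefree_form_polar[OF open_U off v z]
    sum_atMost_2 radial_def angular_def radial_\<Omega>_def angular_\<Omega>_def pol_A_def pol_B_def pol_Q0_def pol_box_def
  by (simp add: add_divide_distrib diff_divide_distrib algebra_simps)

lemma quad_form_divergence:
  assumes q: "null_tensor q" and v: "smooth_on U v" and w: "smooth_on U w" and z: "z \<in> U"
  shows "quad_form q v w z =
    (\<Sum>\<mu>\<le>2. pol_Q0 q \<mu> (ang z) * Q0 (\<partial> \<mu> v) w z + pol_box q \<mu> (ang z) * \<box> v z * \<partial> \<mu> w z)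
    + (\<Omega> (\<lambda>y. (\<Sum>\<mu>\<le>2. \<Sum>\<nu>\<le>2. pol_P q \<mu> \<nu> (ang y) * \<partial> \<mu> (\<partial> \<nu> v) y) * w y / rad y) z
    + (\<Sum>\<mu>\<le>2. \<partial> \<mu> (\<lambda>y. (\<Sum>j=1..4. \<Sum>\<nu>\<le>2. pol_R q \<mu> j \<nu> (ang y) * Z j (\<partial> \<nu> v) y) * w y / rad y) z)
    + (\<Sum>j=1..4. \<Sum>\<nu>\<le>2. pol_S q j \<nu> (ang z) * Z j (\<partial> \<nu> v) z) * w z / (rad z)\<^sup>2)"
proof -
  let ?s1 = "tf\<^sub>1 q" and ?s2 = "tf\<^sub>2 q" and ?m = "coef_Q12 q"
  let ?S = "\<lambda>y. pol_rr ?s1 ?s2 (ang y)" and ?T = "\<lambda>y. pol_r\<theta> ?s1 ?s2 (ang y)"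
  have Z4: "Z 4 = \<Omega>" by (simp add: Z_def)
  let ?r = "\<lambda>\<mu> y. radial (\<partial> \<mu> v) y * w y / rad y"
  let ?f = "\<lambda>y. (?T y * radial (\<partial> 0 v) y - 2 * (?S y * angular (\<partial> 0 v) y)) * w y / rad y"
  let ?g = "\<lambda>i y. ang y $ i * (?T y * \<Omega> (\<partial> 0 v) y * w y) / rad y"
  let ?o = "\<lambda>i \<mu> y. ang y $ i * (\<Omega> (\<partial> \<mu> v) y * w y) / rad y"
  have sm: "smooth_on U (?r \<mu>)" "smooth_on U ?f" "smooth_on U (?g i)" "smooth_on U (?o i \<mu>)" for \<mu> i
    using v w by (intro smooth_polar[OF open_U off]; simp)+
  have pd_lin: "\<partial> \<mu> (\<lambda>y. f y - (a * g y + b * h y + c * k y)) z =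
      \<partial> \<mu> f z - (a * \<partial> \<mu> g z + b * \<partial> \<mu> h z + c * \<partial> \<mu> k z)"
    if "smooth_on U f" "smooth_on U g" "smooth_on U h" "smooth_on U k" for \<mu> a b c f g h k
    using that z by (simp add: pd_diff[OF open_U] pd_add[OF open_U] pd_cmult[OF open_U] smooth_intros[OF open_U])
  have \<Omega>_lin: "\<Omega> (\<lambda>y. f y - (a * g y + b * h y + c * k y)) z =
      \<Omega> f z - (a * \<Omega> g z + b * \<Omega> h z + c * \<Omega> k z)"
    if "smooth_on U f" "smooth_on U g" "smooth_on U h" "smooth_on U k" for a b c f g h k
    unfolding \<Omega>_def pd_lin[OF that] by (simp add: algebra_simps)
  have P_eq: "(\<lambda>y. (\<Sum>\<mu>\<le>2. \<Sum>\<nu>\<le>2. pol_P q \<mu> \<nu> (ang y) * \<partial> \<mu> (\<partial> \<nu> v) y) * w y / rad y) =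
      (\<lambda>y. ?f y - (- ?m 0 * ?r 0 y + - ?m 1 * ?r 1 y + - ?m 2 * ?r 2 y))"
    by (rule ext) (simp add: sum_atMost_2 pol_P_def pol_A_def radial_def angular_def
        add_divide_distrib diff_divide_distrib algebra_simps)
  have P: "\<Omega> (\<lambda>y. (\<Sum>\<mu>\<le>2. \<Sum>\<nu>\<le>2. pol_P q \<mu> \<nu> (ang y) * \<partial> \<mu> (\<partial> \<nu> v) y) * w y / rad y) z =
      \<Omega> ?f z - (- ?m 0 * \<Omega> (?r 0) z + - ?m 1 * \<Omega> (?r 1) z + - ?m 2 * \<Omega> (?r 2) z)"
    unfolding P_eq by (rule \<Omega>_lin[OF sm(2) sm(1) sm(1) sm(1)])
  have R0: "(\<lambda>y. (\<Sum>j=1..4. \<Sum>\<nu>\<le>2. pol_R q 0 j \<nu> (ang y) * Z j (\<partial> \<nu> v) y) * w y / rad y) =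
      (\<lambda>y. 2 * (?S y * angular_\<Omega> v y - ?T y * radial_\<Omega> v y) * w y / rad y)"
    unfolding sum_1_4 sum_atMost_2
    by (rule ext) (simp add: Z4 pol_R_def pol_B_def radial_\<Omega>_def angular_\<Omega>_def
        algebra_simps)
  \<comment> \<open>Coordinates are indexed by the type 2 and directions by natural numbers; the
    conditional translates one into the other.\<close>
  have R_eq: "(\<lambda>y. (\<Sum>j=1..4. \<Sum>\<nu>\<le>2. pol_R q (if i = 1 then 1 else 2) j \<nu> (ang y) * Z j (\<partial> \<nu> v) y) * w y / rad y) =
      (\<lambda>y. ?g i y - (?m 0 * ?o i 0 y + ?m 1 * ?o i 1 y + ?m 2 * ?o i 2 y))" for i :: 2
    using exhaust_2[of i] unfolding sum_1_4 sum_atMost_2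
    by (intro ext, elim disjE) (simp_all add: Z4 pol_R_def
        add_divide_distrib diff_divide_distrib algebra_simps)
  have Ri: "\<partial> \<mu> (\<lambda>y. (\<Sum>j=1..4. \<Sum>\<nu>\<le>2. pol_R q (if i = 1 then 1 else 2) j \<nu> (ang y) * Z j (\<partial> \<nu> v) y) * w y / rad y) z =
      \<partial> \<mu> (?g i) z - (?m 0 * \<partial> \<mu> (?o i 0) z + ?m 1 * \<partial> \<mu> (?o i 1) z + ?m 2 * \<partial> \<mu> (?o i 2) z)" for i \<mu>
    unfolding R_eq by (rule pd_lin[OF sm(3) sm(4) sm(4) sm(4)])
  have S: "(\<Sum>j=1..4. \<Sum>\<nu>\<le>2. pol_S q j \<nu> (ang z) * Z j (\<partial> \<nu> v) z) * w z / (rad z)\<^sup>2 =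
      2 * ?T z * \<Omega> (\<partial> 0 v) z * w z / (rad z)\<^sup>2"
    unfolding sum_1_4 sum_atMost_2 by (simp add: Z4 pol_S_def)
  have Q12: "Q12 (\<partial> \<mu> v) w z = \<Omega> (?r \<mu>) z - (\<partial> 1 (?o 1 \<mu>) z + \<partial> 2 (?o 2 \<mu>) z)" for \<mu>
    by (rule Q12_divergence[OF open_U off smooth_on_pd[OF open_U v] w z])
  have tf: "tracefree_form ?s1 ?s2 v w z = - ?S z * Q0 (\<partial> 0 v) w z + ?S z * \<box> v z * \<partial> 0 w z
      + (\<Omega> ?f z + (\<partial> 1 (?g 1) z + \<partial> 2 (?g 2) z)
         + \<partial> 0 (\<lambda>y. 2 * (?S y * angular_\<Omega> v y - ?T y * radial_\<Omega> v y) * w y / rad y) z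
         + 2 * ?T z * \<Omega> (\<partial> 0 v) z * w z / (rad z)\<^sup>2)"
    unfolding tracefree_form_polar[OF open_U off v z]
      tracefree_remainder_divergence[OF open_U off v w z] by simp
  let ?R = "\<lambda>\<mu> y. (\<Sum>j=1..4. \<Sum>\<nu>\<le>2. pol_R q \<mu> j \<nu> (ang y) * Z j (\<partial> \<nu> v) y) * w y / rad y"
  have ne: "((2::2) = 1) = False" by simp
  have R1: "\<partial> 1 (?R 1) z = \<partial> 1 (?g 1) z
      - (?m 0 * \<partial> 1 (?o 1 0) z + ?m 1 * \<partial> 1 (?o 1 1) z + ?m 2 * \<partial> 1 (?o 1 2) z)"
    using Ri[of 1 1] by (simp only: simp_thms if_True)
  have R2: "\<partial> 2 (?R 2) z = \<partial> 2 (?g 2) z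
      - (?m 0 * \<partial> 2 (?o 2 0) z + ?m 1 * \<partial> 2 (?o 2 1) z + ?m 2 * \<partial> 2 (?o 2 2) z)"
    using Ri[of 2 2] by (simp only: ne if_False)
  have R: "(\<Sum>\<mu>\<le>2. \<partial> \<mu> (?R \<mu>) z) = \<partial> 0 (?R 0) z + \<partial> 1 (?R 1) z + \<partial> 2 (?R 2) z"
    by (rule sum_atMost_2)
  \<comment> \<open>The polynomial \<open>pol_rr\<close> contained in \<open>pol_Q0\<close> and
    \<open>pol_box\<close> is split off; it will cancel the first two terms of the trace-free
    form.\<close>
  have Q: "(\<Sum>\<mu>\<le>2. coef_Q12 q \<mu> * Q12 (\<partial> \<mu> v) w z + coef_Q0 q \<mu> * Q0 (\<partial> \<mu> v) w z + coef_box q \<mu> * \<box> v z * \<partial> \<mu> w z) =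
      (\<Sum>\<mu>\<le>2. pol_Q0 q \<mu> (ang z) * Q0 (\<partial> \<mu> v) w z + pol_box q \<mu> (ang z) * \<box> v z * \<partial> \<mu> w z)
      + ?S z * Q0 (\<partial> 0 v) w z - ?S z * \<box> v z * \<partial> 0 w z
      + (?m 0 * Q12 (\<partial> 0 v) w z + ?m 1 * Q12 (\<partial> 1 v) w z + ?m 2 * Q12 (\<partial> 2 v) w z)"
    unfolding sum_atMost_2 pol_Q0_def pol_box_def by (simp add: algebra_simps)
  have fin: "X + a - b + (m0 * (r0 - (p0 + q0)) + m1 * (r1 - (p1 + q1)) + m2 * (r2 - (p2 + q2)))
      + (a' + b + (F + (g1 + g2) + k + e)) =
      X + (F - (- m0 * r0 + - m1 * r1 + - m2 * r2)
        + (k + (g1 - (m0 * p0 + m1 * p1 + m2 * p2)) + (g2 - (m0 * q0 + m1 * q1 + m2 * q2))) + e)"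
    if "a' = - a" for X a a' b m0 m1 m2 r0 r1 r2 p0 p1 p2 q0 q1 q2 F g1 g2 k e :: real
    using that by (simp add: algebra_simps)
  show ?thesis
    unfolding quad_form_null[OF open_U q v z] tf Q
    unfolding P R R0 R1 R2 S Q12
    by (rule fin) simp
qed

end

subsection \<open>The commutator estimate\<close>

lemma bounded_linear_coordinates:
  fixes f :: "real^2 \<Rightarrow> real"
  assumes "bounded_linear f" shows "f x = f (axis 1 1) * x $ 1 + f (axis 2 1) * x $ 2"
proof -
  have "x = x $ 1 *\<^sub>R axis 1 1 + x $ 2 *\<^sub>R axis 2 1"
    by (simp add: vec_eq_iff forall_2 axis_def)
  then have "f x = f (x $ 1 *\<^sub>R axis 1 1 + x $ 2 *\<^sub>R axis 2 1)" by simp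
  also have "\<dots> = f (axis 1 1) * x $ 1 + f (axis 2 1) * x $ 2"
    using assms by (simp add: linear_simps)
  finally show ?thesis .
qed

abbreviation (input) off_axis :: "spacetime set" where
  "off_axis \<equiv> {z. snd z \<noteq> 0}"

lemma open_off_axis: "open off_axis"
  by (intro open_Collect_neq continuous_intros)

lemma smooth_on_polynomial_ang:
  assumes U: "open U" "U \<subseteq> off_axis" and p: "real_polynomial_function p"
  shows "smooth_on U (\<lambda>z. p (ang z))"
  using p
proof induction
  case (linear f)
  show ?case
    by (subst bounded_linear_coordinates[OF linear]) (intro smooth_intros[OF U(1)] smooth_on_ang[OF U])
qed (intro smooth_intros[OF U(1)]; simp)+

lemma pd_comp_rad:
  assumes U: "open U" "U \<subseteq> off_axis" and \<eta>: "smooth_on UNIV \<eta>" and z: "z \<in> U"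
  shows "\<partial> \<mu> (\<lambda>y. \<eta> (rad y)) z = \<partial> \<mu> rad z * frechet_derivative \<eta> (at (rad z)) 1"
  unfolding pd_def
  by (intro frechet_derivative_comp smooth_on_differentiable[OF smooth_on_rad[OF U] z]
      smooth_on_differentiable[OF \<eta>] UNIV_I)

text \<open>Multiplication operators by such functions have a commutator with the Laplacian that is
  \<open>O(|x|\<^sup>-\<^sup>2)\<close>. The two bounds on the radial derivative make the condition stable under products,
  uniformly as \<open>x\<close> tends to the origin.\<close>

definition tame :: "scalar_field \<Rightarrow> real \<Rightarrow> bool" where
  "tame h M \<longleftrightarrow> smooth_on off_axis h \<and> (\<forall>z. snd z \<noteq> 0 \<longrightarrow> \<partial> 0 h z = 0) \<and>
     (\<forall>z. snd z \<noteq> 0 \<longrightarrow> \<bar>h z\<bar> \<le> M \<and> \<bar>radial h z\<bar> * rad z \<le> M \<and> \<bar>radial h z\<bar> * (rad z)\<^sup>2 \<le> M \<and>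
       \<bar>\<Omega> h z\<bar> \<le> M \<and> \<bar>\<Delta> h z\<bar> * (rad z)\<^sup>2 \<le> M)"

lemma gradient_product:
  assumes "snd z \<noteq> 0"
  shows "\<partial> 1 f z * \<partial> 1 g z + \<partial> 2 f z * \<partial> 2 g z = radial f z * radial g z + \<Omega> f z * \<Omega> g z / (rad z)\<^sup>2"
proof -
  have z: "z \<in> off_axis" using assms by simp
  have "\<partial> 1 f z * \<partial> 1 g z + \<partial> 2 f z * \<partial> 2 g z =
      (ang z $ 1 * ang z $ 1 + ang z $ 2 * ang z $ 2) * (\<partial> 1 f z * \<partial> 1 g z + \<partial> 2 f z * \<partial> 2 g z)"
    using ang_unit[OF open_off_axis subset_refl z] by simp
  also have "\<dots> = radial f z * radial g z + angular f z * angular g z"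
    by (simp add: radial_def angular_def algebra_simps)
  finally show ?thesis
    using rad_nz[OF open_off_axis subset_refl z] by (simp add: \<Omega>_eq_angular[OF open_off_axis subset_refl z] power2_eq_square)
qed

lemma tame_smooth: "tame h M \<Longrightarrow> smooth_on off_axis h"
  by (simp add: tame_def)

lemma tame_bounds:
  assumes "tame h M" "snd z \<noteq> 0"
  shows "\<partial> 0 h z = 0" "\<bar>h z\<bar> \<le> M" "\<bar>radial h z\<bar> * rad z \<le> M" "\<bar>radial h z\<bar> * (rad z)\<^sup>2 \<le> M"
    "\<bar>\<Omega> h z\<bar> \<le> M" "\<bar>\<Delta> h z\<bar> * (rad z)\<^sup>2 \<le> M" "0 \<le> M"
proof -
  show b: "\<partial> 0 h z = 0" "\<bar>h z\<bar> \<le> M" "\<bar>radial h z\<bar> * rad z \<le> M" "\<bar>radial h z\<bar> * (rad z)\<^sup>2 \<le> M"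
    "\<bar>\<Omega> h z\<bar> \<le> M" "\<bar>\<Delta> h z\<bar> * (rad z)\<^sup>2 \<le> M"
    using assms unfolding tame_def by blast+
  show "0 \<le> M" using b(2) by (rule order_trans[OF abs_ge_zero])
qed

lemma tame_const: "tame (\<lambda>_. c) \<bar>c\<bar>"
  by (simp add: tame_def smooth_on_const radial_def \<Omega>_def \<Delta>_def)

lemma tame_add:
  assumes h: "tame h M" and k: "tame k N" shows "tame (\<lambda>z. h z + k z) (M + N)"
proof -
  note sm = tame_smooth[OF h] tame_smooth[OF k]
  have "\<bar>a + b\<bar> * c \<le> M + N" if "\<bar>a\<bar> * c \<le> M" "\<bar>b\<bar> * c \<le> N" "0 \<le> c" for a b c
    using that mult_right_mono[OF abs_triangle_ineq[of a b], of c] by (simp add: algebra_simps)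
  note le = this this[where c = 1, simplified]
  show ?thesis
    unfolding tame_def
  proof (intro conjI allI impI smooth_on_add[OF open_off_axis] sm)
    fix z :: spacetime assume z: "snd z \<noteq> 0"
    note hz = tame_bounds[OF h z] and kz = tame_bounds[OF k z]
    have z': "z \<in> off_axis" using z by simp
    show "\<partial> 0 (\<lambda>z. h z + k z) z = 0" using hz(1) kz(1) by (simp add: pd_add[OF open_off_axis sm z'])
    have r: "radial (\<lambda>z. h z + k z) z = radial h z + radial k z"
      by (simp add: radial_def pd_add[OF open_off_axis sm z'] algebra_simps)
    have r0: "rad z \<ge> 0" "(rad z)\<^sup>2 \<ge> 0" by (simp_all add: rad_def)
    show "\<bar>h z + k z\<bar> \<le> M + N" by (rule le(2)[OF hz(2) kz(2)])
    show "\<bar>radial (\<lambda>z. h z + k z) z\<bar> * rad z \<le> M + N" "\<bar>radial (\<lambda>z. h z + k z) z\<bar> * (rad z)\<^sup>2 \<le> M + N"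
      unfolding r by (rule le(1)[OF hz(3) kz(3) r0(1)], rule le(1)[OF hz(4) kz(4) r0(2)])
    show "\<bar>\<Omega> (\<lambda>z. h z + k z) z\<bar> \<le> M + N" unfolding \<Omega>_add[OF open_off_axis sm z'] by (rule le(2)[OF hz(5) kz(5)])
    show "\<bar>\<Delta> (\<lambda>z. h z + k z) z\<bar> * (rad z)\<^sup>2 \<le> M + N"
      unfolding \<Delta>_add[OF open_off_axis sm z'] by (rule le(1)[OF hz(6) kz(6) r0(2)])
  qed
qed

text \<open>The factor 6 comes from the Laplacian: 2MN for the two terms with a Laplacian on one
  factor, and twice 2MN for the product of the gradients.\<close>

lemma tame_mult:
  assumes h: "tame h M" and k: "tame k N" shows "tame (\<lambda>z. h z * k z) (6 * (M * N))"
proof -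
  note sm = tame_smooth[OF h] tame_smooth[OF k]
  show ?thesis
    unfolding tame_def
  proof (intro conjI allI impI smooth_on_mult[OF open_off_axis] sm)
    fix z :: spacetime assume z: "snd z \<noteq> 0"
    note hz = tame_bounds[OF h z] and kz = tame_bounds[OF k z]
    have z': "z \<in> off_axis" using z by simp
    have MN: "0 \<le> M * N" using hz(7) kz(7) by simp
    have rz: "0 < rad z" using z by (simp add: rad_def)
    have le: "\<bar>a * b' + a' * b\<bar> * c \<le> 2 * (M * N)"
      if "\<bar>a\<bar> \<le> M" "\<bar>b\<bar> \<le> N" "\<bar>a'\<bar> * c \<le> M" "\<bar>b'\<bar> * c \<le> N" "0 \<le> c" for a b a' b' c
    proof -
      have "\<bar>a * b' + a' * b\<bar> * c \<le> (\<bar>a\<bar> * \<bar>b'\<bar> + \<bar>a'\<bar> * \<bar>b\<bar>) * c"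
        using that(5) by (intro mult_right_mono) (metis abs_mult abs_triangle_ineq)
      also have "\<dots> = \<bar>a\<bar> * (\<bar>b'\<bar> * c) + (\<bar>a'\<bar> * c) * \<bar>b\<bar>" by (simp add: algebra_simps)
      also have "\<dots> \<le> M * N + M * N"
        using that hz(7) kz(7) by (intro add_mono mult_mono) auto
      finally show ?thesis by simp
    qed
    have MN6: "2 * (M * N) \<le> 6 * (M * N)" using mult_right_mono[OF _ MN, of 2 6] by simp
    have r0: "rad z \<ge> 0" "(rad z)\<^sup>2 \<ge> 0" by (simp_all add: rad_def)
    show "\<partial> 0 (\<lambda>z. h z * k z) z = 0" using hz(1) kz(1) by (simp add: pd_mult[OF open_off_axis sm z'])
    have "\<bar>h z * k z\<bar> \<le> M * N" unfolding abs_mult using hz(2,7) kz(2) by (intro mult_mono) auto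
    then show "\<bar>h z * k z\<bar> \<le> 6 * (M * N)" using MN by linarith
    have r: "radial (\<lambda>z. h z * k z) z = h z * radial k z + radial h z * k z"
      by (rule radial_mult[OF open_off_axis subset_refl sm z'])
    show "\<bar>radial (\<lambda>z. h z * k z) z\<bar> * rad z \<le> 6 * (M * N)"
      unfolding r by (rule order_trans[OF le[OF hz(2) kz(2) hz(3) kz(3) r0(1)] MN6])
    show "\<bar>radial (\<lambda>z. h z * k z) z\<bar> * (rad z)\<^sup>2 \<le> 6 * (M * N)"
      unfolding r by (rule order_trans[OF le[OF hz(2) kz(2) hz(4) kz(4) r0(2)] MN6])
    show "\<bar>\<Omega> (\<lambda>z. h z * k z) z\<bar> \<le> 6 * (M * N)"
      unfolding \<Omega>_mult[OF open_off_axis sm z']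
      by (rule order_trans[OF le[where c = 1, simplified, OF hz(2) kz(2) hz(5) kz(5)] MN6])
    \<comment> \<open>Here the weight |x|^2 is shared between the two radial derivatives, which is
      the use of the bound with weight |x|; in the angular part it is absorbed by the
      denominator.\<close>
    have g: "\<bar>radial h z * radial k z + \<Omega> h z * \<Omega> k z / (rad z)\<^sup>2\<bar> * (rad z)\<^sup>2 \<le> 2 * (M * N)"
    proof -
      have "\<bar>radial h z * radial k z + \<Omega> h z * \<Omega> k z / (rad z)\<^sup>2\<bar> * (rad z)\<^sup>2 =
          \<bar>(radial h z * rad z) * (radial k z * rad z) + \<Omega> h z * \<Omega> k z\<bar>"
        using rz unfolding abs_mult_pos[OF zero_le_power2, symmetric]
        by (simp add: field_simps power2_eq_square)
      also have "\<dots> \<le> (\<bar>radial h z\<bar> * rad z) * (\<bar>radial k z\<bar> * rad z) + \<bar>\<Omega> h z\<bar> * \<bar>\<Omega> k z\<bar>"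
        using rz by (intro order_trans[OF abs_triangle_ineq]) (simp add: abs_mult)
      also have "\<dots> \<le> M * N + M * N"
        using hz(3,5,7) kz(3,5) rz by (intro add_mono mult_mono) auto
      finally show ?thesis by simp
    qed
    have "\<bar>\<Delta> (\<lambda>z. h z * k z) z\<bar> * (rad z)\<^sup>2 \<le>
        \<bar>h z * \<Delta> k z + \<Delta> h z * k z\<bar> * (rad z)\<^sup>2
        + 2 * (\<bar>radial h z * radial k z + \<Omega> h z * \<Omega> k z / (rad z)\<^sup>2\<bar> * (rad z)\<^sup>2)"
    proof -
      have "\<bar>a + 2 * b\<bar> * c \<le> \<bar>a\<bar> * c + 2 * (\<bar>b\<bar> * c)" if "0 \<le> c" for a b c :: real
        using mult_right_mono[OF abs_triangle_ineq[of a "2 * b"] that] by (simp add: abs_mult algebra_simps)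
      then show ?thesis
        unfolding \<Delta>_mult[OF open_off_axis sm z'] gradient_product[OF z] using r0(2) by blast
    qed
    also have "\<dots> \<le> 2 * (M * N) + 2 * (2 * (M * N))"
      by (rule add_mono[OF le[OF hz(2) kz(2) hz(6) kz(6) r0(2)] mult_left_mono[OF g]]) simp
    finally show "\<bar>\<Delta> (\<lambda>z. h z * k z) z\<bar> * (rad z)\<^sup>2 \<le> 6 * (M * N)" by simp
  qed
qed

lemma divergence_ang:
  assumes "snd z \<noteq> 0"
  shows "\<partial> 1 (\<lambda>y. ang y $ 1) z + \<partial> 2 (\<lambda>y. ang y $ 2) z = 1 / rad z"
proof -
  have z: "z \<in> off_axis" using assms by simp
  show ?thesis
    using ang_unit[OF open_off_axis subset_refl z] unfolding pd_ang[OF open_off_axis subset_refl z] dir_simps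
    by (simp add: axis_2_simps add_divide_distrib[symmetric])
qed

text \<open>The coordinates \<open>\<omega>\<^sub>i |x|\<close> are harmonic, and \<open>\<nabla>|x| = \<omega>\<close> is orthogonal to \<open>\<nabla>\<omega>\<^sub>i\<close>; so
  \<open>|x| \<Delta> \<omega>\<^sub>i = - \<omega>\<^sub>i \<Delta> |x|\<close>.\<close>

lemma \<Delta>_ang:
  assumes "snd z \<noteq> 0"
  shows "\<Delta> (\<lambda>y. ang y $ i) z = - ang z $ i / (rad z)\<^sup>2"
proof -
  have z: "z \<in> off_axis" using assms by simp
  note off = open_off_axis
  have sm: "smooth_on off_axis (\<lambda>y. ang y $ i)" "smooth_on off_axis rad"
    by (intro smooth_on_ang[OF off subset_refl] smooth_on_rad[OF off subset_refl])+
  have pr: "\<partial> 1 rad y = ang y $ 1" "\<partial> 2 rad y = ang y $ 2" if "y \<in> off_axis" for y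
    using pd_rad[OF off subset_refl that] by (simp_all add: dir_simps axis_2_simps)
  have "\<Delta> rad z = 1 / rad z"
    unfolding \<Delta>_def divergence_ang[OF assms, symmetric]
    using pd_cong[OF off pr(1) z] pd_cong[OF off pr(2) z] by simp
  moreover have "\<Delta> (\<lambda>y. ang y $ i * rad y) z = \<Delta> (\<lambda>y. snd y $ i) z"
    by (rule \<Delta>_cong[OF off ang_times_rad[OF off subset_refl] z])
  moreover have "\<Delta> (\<lambda>y. snd y $ i) z = 0" by (simp add: \<Delta>_def pd_nth[abs_def])
  moreover have "\<partial> 1 (\<lambda>y. ang y $ i) z * \<partial> 1 rad z + \<partial> 2 (\<lambda>y. ang y $ i) z * \<partial> 2 rad z = 0"
    using radial_ang[OF off subset_refl z, of i] unfolding radial_def pr[OF z] by (simp add: mult.commute)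
  ultimately have "ang z $ i / rad z + \<Delta> (\<lambda>y. ang y $ i) z * rad z = 0"
    using \<Delta>_mult[OF off sm z] by simp
  then show ?thesis using rad_nz[OF off subset_refl z] by (simp add: field_simps power2_eq_square)
qed

lemma tame_ang: "tame (\<lambda>z. ang z $ i) 1"
  unfolding tame_def
proof (intro conjI allI impI smooth_on_ang[OF open_off_axis subset_refl])
  fix z :: spacetime assume "snd z \<noteq> 0"
  then have z: "z \<in> off_axis" by simp
  note off = open_off_axis
  have a: "\<bar>ang z $ j\<bar> \<le> 1" for j
    using component_le_norm_cart[of "ang z" j] \<open>snd z \<noteq> 0\<close> by (simp add: ang_def)
  show "\<partial> 0 (\<lambda>z. ang z $ i) z = 0" by (rule pd_0_ang[OF off subset_refl z])
  show "\<bar>ang z $ i\<bar> \<le> 1" by (rule a)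
  have r: "radial (\<lambda>z. ang z $ i) z = 0" by (rule radial_ang[OF off subset_refl z])
  show "\<bar>radial (\<lambda>z. ang z $ i) z\<bar> * rad z \<le> 1" "\<bar>radial (\<lambda>z. ang z $ i) z\<bar> * (rad z)\<^sup>2 \<le> 1"
    by (simp_all add: r)
  show "\<bar>\<Omega> (\<lambda>z. ang z $ i) z\<bar> \<le> 1"
    using exhaust_2[of i] \<Omega>_ang_1[OF off subset_refl z] \<Omega>_ang_2[OF off subset_refl z] a by auto
  show "\<bar>\<Delta> (\<lambda>z. ang z $ i) z\<bar> * (rad z)\<^sup>2 \<le> 1"
    using a rad_nz[OF off subset_refl z] by (simp add: \<Delta>_ang[OF \<open>snd z \<noteq> 0\<close>] abs_divide)
qed

lemma tame_polynomial_ang: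
  assumes "real_polynomial_function p" shows "\<exists>M. tame (\<lambda>z. p (ang z)) M"
  using assms
proof induction
  case (linear f)
  have "\<exists>M. tame (\<lambda>z. f (axis 1 1) * ang z $ 1 + f (axis 2 1) * ang z $ 2) M"
    using tame_add[OF tame_mult[OF tame_const tame_ang] tame_mult[OF tame_const tame_ang]] by blast
  then show ?case by (subst bounded_linear_coordinates[OF linear])
next
  case (const c)
  show ?case using tame_const by blast
next
  case (add f g)
  then show ?case using tame_add by blast
next
  case (mult f g)
  then show ?case using tame_mult by blast
qed

text \<open>The weights s and s^2 cost nothing, because they are at most 1 where g can be nonzero.
  It is applied to the first two derivatives of the cutoff.\<close>

lemma bounded_of_support:
  fixes g :: "real \<Rightarrow> real"
  assumes g: "continuous_on UNIV g" and 0: "\<And>s. s < 1/2 \<Longrightarrow> g s = 0" "\<And>s. s > 1 \<Longrightarrow> g s = 0"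
  obtains M where "M \<ge> 0" "\<And>s. \<bar>g s\<bar> \<le> M" "\<And>s. 0 \<le> s \<Longrightarrow> \<bar>g s\<bar> * s \<le> M" "\<And>s. 0 \<le> s \<Longrightarrow> \<bar>g s\<bar> * s\<^sup>2 \<le> M"
proof -
  have "compact (g ` {1/2..1})"
    using g by (intro compact_continuous_image) (auto intro: continuous_on_subset)
  then have "bounded (g ` {1/2..1})" by (rule compact_imp_bounded)
  then obtain M where "\<forall>s\<in>{1/2..1}. \<bar>g s\<bar> \<le> M"
    unfolding bounded_iff by auto
  then have M: "\<bar>g s\<bar> \<le> M" if "s \<in> {1/2..1}" for s using that by blast
  have M0: "M \<ge> 0" using M[of 1] by (auto intro: order_trans[OF abs_ge_zero])
  have b: "\<bar>g s\<bar> \<le> M" for s using M[of s] 0[of s] M0 by (cases "s \<in> {1/2..1}") auto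
  have c: "\<bar>g s\<bar> * t \<le> M" if "s \<le> 1 \<Longrightarrow> t \<le> 1" "0 \<le> t" for s t
  proof (cases "s \<le> 1")
    case True
    then show ?thesis using mult_mono[OF b[of s] that(1)[OF True] M0 that(2)] by simp
  qed (use 0 M0 in auto)
  show ?thesis
    using M0 b by (rule that) (auto intro!: c power_le_one)
qed

text \<open>For a radial function the Laplacian is \<eta>'' + \<eta>'/|x|, and the radial derivative
  is \<eta>'. The three parts of the bound, 1, M and N, belong to \<eta>, \<eta>' and
  \<eta>''.\<close>

lemma tame_cutoff:
  assumes "is_cutoff \<eta>" shows "\<exists>M. tame (\<lambda>z. \<eta> (rad z)) M"
proof -
  note off = open_off_axis
  have \<eta>: "smooth_on UNIV \<eta>" and bd: "\<And>s. \<bar>\<eta> s\<bar> \<le> 1" and low: "\<And>s. s \<le> 1/2 \<Longrightarrow> \<eta> s = 0"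
    and high: "\<And>s. s \<ge> 1 \<Longrightarrow> \<eta> s = 1"
    using assms by (auto simp: is_cutoff_def)
  define d where "d s = frechet_derivative \<eta> (at s) 1" for s
  define d2 where "d2 s = frechet_derivative d (at s) 1" for s
  have sd: "smooth_on UNIV d" "smooth_on UNIV d2"
    unfolding d2_def[abs_def] d_def[abs_def] by (intro smooth_on_frechet_derivative \<eta>)+
  have supp: "frechet_derivative g (at s) 1 = 0"
    if "\<And>s. s < 1/2 \<Longrightarrow> g s = 0" "\<And>s. s > 1 \<Longrightarrow> g s = c" "s < 1/2 \<or> s > 1" for g :: "real \<Rightarrow> real" and c s
    using that(3)
  proof
    assume "s < 1/2"
    then show ?thesis using frechet_derivative_cong_open[of "{..<1/2}" s g "\<lambda>_. 0"] that(1) by simp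
  next
    assume "s > 1"
    then show ?thesis using frechet_derivative_cong_open[of "{1<..}" s g "\<lambda>_. c"] that(2) by simp
  qed
  have d0: "d s = 0" if "s < 1/2 \<or> s > 1" for s
    unfolding d_def by (rule supp[OF _ _ that, where c = 1]) (auto simp: low high)
  have d20: "d2 s = 0" if "s < 1/2 \<or> s > 1" for s
    unfolding d2_def by (rule supp[OF _ _ that, where c = 0]) (auto simp: d0)
  obtain M where M: "M \<ge> 0" "\<And>s. \<bar>d s\<bar> \<le> M" "\<And>s. 0 \<le> s \<Longrightarrow> \<bar>d s\<bar> * s \<le> M" "\<And>s. 0 \<le> s \<Longrightarrow> \<bar>d s\<bar> * s\<^sup>2 \<le> M"
    using bounded_of_support[OF smooth_on_continuous_on[OF sd(1)]] d0 by metis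
  obtain N where N: "N \<ge> 0" "\<And>s. \<bar>d2 s\<bar> \<le> N" "\<And>s. 0 \<le> s \<Longrightarrow> \<bar>d2 s\<bar> * s \<le> N" "\<And>s. 0 \<le> s \<Longrightarrow> \<bar>d2 s\<bar> * s\<^sup>2 \<le> N"
    using bounded_of_support[OF smooth_on_continuous_on[OF sd(2)]] d20 by metis
  have pr: "\<partial> 1 rad y = ang y $ 1" "\<partial> 2 rad y = ang y $ 2" "\<partial> 0 rad y = 0" if "y \<in> off_axis" for y
    using pd_rad[OF off subset_refl that] by (simp_all add: dir_simps axis_2_simps)
  have sm: "smooth_on off_axis (\<lambda>z. g (rad z))" if "smooth_on UNIV g" for g :: "real \<Rightarrow> real"
    by (rule smooth_on_comp[OF off that smooth_on_rad[OF off subset_refl]])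
  have pe: "\<partial> \<mu> (\<lambda>y. \<eta> (rad y)) z = d (rad z) * \<partial> \<mu> rad z" "\<partial> \<mu> (\<lambda>y. d (rad y)) z = d2 (rad z) * \<partial> \<mu> rad z"
    if "z \<in> off_axis" for \<mu> z
    using pd_comp_rad[OF off subset_refl \<eta> that] pd_comp_rad[OF off subset_refl sd(1) that] by (simp_all add: d_def d2_def)
  show ?thesis
  proof (intro exI)
    show "tame (\<lambda>z. \<eta> (rad z)) (1 + M + N)"
      unfolding tame_def
    proof (intro conjI allI impI sm \<eta>)
      fix z :: spacetime assume nz: "snd z \<noteq> 0"
      then have z: "z \<in> off_axis" by simp
      have u: "ang z $ 1 * ang z $ 1 + ang z $ 2 * ang z $ 2 = 1" by (rule ang_unit[OF off subset_refl z])
      have r0: "rad z \<ge> 0" "rad z \<noteq> 0" using nz by (simp_all add: rad_def)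
      show "\<partial> 0 (\<lambda>z. \<eta> (rad z)) z = 0" by (simp add: pe[OF z] pr[OF z])
      show "\<bar>\<eta> (rad z)\<bar> \<le> 1 + M + N" using bd[of "rad z"] M(1) N(1) by linarith
      have "radial (\<lambda>z. \<eta> (rad z)) z = d (rad z) * (ang z $ 1 * ang z $ 1 + ang z $ 2 * ang z $ 2)"
        unfolding radial_def pe[OF z] pr[OF z] by (simp add: algebra_simps)
      then have r: "radial (\<lambda>z. \<eta> (rad z)) z = d (rad z)" unfolding u by simp
      show "\<bar>radial (\<lambda>z. \<eta> (rad z)) z\<bar> * rad z \<le> 1 + M + N" "\<bar>radial (\<lambda>z. \<eta> (rad z)) z\<bar> * (rad z)\<^sup>2 \<le> 1 + M + N"
        unfolding r using M(3)[OF r0(1)] M(4)[OF r0(1)] N(1) by linarith+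
      have "\<Omega> (\<lambda>z. \<eta> (rad z)) z = d (rad z) * \<Omega> rad z"
        unfolding \<Omega>_def pe[OF z] by (simp add: algebra_simps)
      then show "\<bar>\<Omega> (\<lambda>z. \<eta> (rad z)) z\<bar> \<le> 1 + M + N"
        using \<Omega>_rad[OF off subset_refl z] M(1) N(1) by simp
      have "\<partial> 1 (\<partial> 1 (\<lambda>y. \<eta> (rad y))) z = \<partial> 1 (\<lambda>y. d (rad y) * ang y $ 1) z"
        "\<partial> 2 (\<partial> 2 (\<lambda>y. \<eta> (rad y))) z = \<partial> 2 (\<lambda>y. d (rad y) * ang y $ 2) z"
        by (intro pd_cong[OF off _ z], simp only: pe pr)+
      then have "\<Delta> (\<lambda>z. \<eta> (rad z)) z = d (rad z) * (\<partial> 1 (\<lambda>y. ang y $ 1) z + \<partial> 2 (\<lambda>y. ang y $ 2) z)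
          + d2 (rad z) * (ang z $ 1 * ang z $ 1 + ang z $ 2 * ang z $ 2)"
        unfolding \<Delta>_def pd_mult[OF off sm[OF sd(1)] smooth_on_ang[OF off subset_refl] z] pe[OF z] pr[OF z]
        by (simp add: algebra_simps)
      also have "\<dots> = d (rad z) / rad z + d2 (rad z)"
        unfolding u divergence_ang[OF nz] by simp
      finally have "\<Delta> (\<lambda>z. \<eta> (rad z)) z * (rad z)\<^sup>2 = d (rad z) * rad z + d2 (rad z) * (rad z)\<^sup>2"
        using r0 by (simp add: field_simps power2_eq_square)
      then have "\<bar>\<Delta> (\<lambda>z. \<eta> (rad z)) z\<bar> * (rad z)\<^sup>2 = \<bar>d (rad z) * rad z + d2 (rad z) * (rad z)\<^sup>2\<bar>"
        by (metis abs_mult abs_power2)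
      also have "\<dots> \<le> \<bar>d (rad z)\<bar> * rad z + \<bar>d2 (rad z)\<bar> * (rad z)\<^sup>2"
        using r0 by (intro order_trans[OF abs_triangle_ineq]) (simp add: abs_mult)
      finally show "\<bar>\<Delta> (\<lambda>z. \<eta> (rad z)) z\<bar> * (rad z)\<^sup>2 \<le> 1 + M + N"
        using M(3)[OF r0(1)] N(4)[OF r0(1)] by linarith
    qed
  qed
qed

text \<open>The cross term of the Laplacian splits into a radial and an angular part. The angular
  part has the weight |x|^(-2) built in. The radial derivative of f is estimated by Cartesian
  derivatives without any gain, so there the decay must come from h; this is the use of the bound
  with weight |x|^2. The constant is 7 = 1 + 2 (2 + 1), where the inner 2 counts the two Cartesian
  derivatives.\<close>

lemma commutator_tame_bound:
  assumes h: "tame h M" and U: "open U" and z: "z \<in> U" "snd z \<noteq> 0" and f: "smooth_on U f"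
  shows "\<bar>commutator \<Delta> (mult_op h) f z\<bar> \<le> 7 * M * (1 / (rad z)\<^sup>2) * norm (Zle1 f z)"
proof -
  let ?U = "U \<inter> off_axis"
  have U': "open ?U" and z': "z \<in> ?U" using U z open_off_axis by auto
  have sm: "smooth_on ?U h" "smooth_on ?U f"
    using tame_smooth[OF h] f by (auto intro: smooth_on_subset)
  note hz = tame_bounds[OF h z(2)]
  have rz: "0 < rad z" using z(2) by (simp add: rad_def)
  have comp: "\<bar>f z\<bar> \<le> norm (Zle1 f z)" "\<bar>\<partial> 1 f z\<bar> \<le> norm (Zle1 f z)" "\<bar>\<partial> 2 f z\<bar> \<le> norm (Zle1 f z)"
    "\<bar>\<Omega> f z\<bar> \<le> norm (Zle1 f z)"
  proof -
    have 1: "\<bar>a\<bar> \<le> norm (a, x)" "norm x \<le> norm (a, x)" for a :: real and x :: "'a::real_normed_vector"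
      using norm_fst_le[of a x] norm_snd_le[of x a] by auto
    show "\<bar>f z\<bar> \<le> norm (Zle1 f z)" unfolding Zle1_def by (rule 1)
    show "\<bar>\<partial> 1 f z\<bar> \<le> norm (Zle1 f z)"
      unfolding Zle1_def by (rule order_trans[OF _ 1(2)], rule order_trans[OF _ 1(2)])
        (use 1(1)[of "Z 2 f z"] in \<open>simp add: Z_def\<close>)
    show "\<bar>\<partial> 2 f z\<bar> \<le> norm (Zle1 f z)"
      unfolding Zle1_def by (rule order_trans[OF _ 1(2)], rule order_trans[OF _ 1(2)], rule order_trans[OF _ 1(2)])
        (use 1(1)[of "Z 3 f z"] in \<open>simp add: Z_def\<close>)
    show "\<bar>\<Omega> f z\<bar> \<le> norm (Zle1 f z)"
      unfolding Zle1_def by (rule order_trans[OF _ 1(2)], rule order_trans[OF _ 1(2)], rule order_trans[OF _ 1(2)])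
        (use 1(2)[of "Z 4 f z" "Z 3 f z"] in \<open>simp add: Z_def\<close>)
  qed
  have "\<bar>radial f z\<bar> \<le> \<bar>ang z $ 1\<bar> * \<bar>\<partial> 1 f z\<bar> + \<bar>ang z $ 2\<bar> * \<bar>\<partial> 2 f z\<bar>"
    unfolding radial_def by (rule order_trans[OF abs_triangle_ineq]) (simp add: abs_mult)
  also have "\<dots> \<le> 1 * norm (Zle1 f z) + 1 * norm (Zle1 f z)"
    using comp tame_bounds(2)[OF tame_ang z(2)] by (intro add_mono mult_mono) auto
  finally have rad: "\<bar>radial f z\<bar> \<le> 2 * norm (Zle1 f z)" by simp
  have "commutator \<Delta> (mult_op h) f z * (rad z)\<^sup>2 =
      (\<Delta> h z * (rad z)\<^sup>2) * f z + 2 * ((radial h z * (rad z)\<^sup>2) * radial f z + \<Omega> h z * \<Omega> f z)"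
    unfolding commutator_def mult_op_def \<Delta>_mult[OF U' sm z'] gradient_product[OF z(2)]
    using rz by (simp add: field_simps)
  then have "\<bar>commutator \<Delta> (mult_op h) f z\<bar> * (rad z)\<^sup>2 =
      \<bar>(\<Delta> h z * (rad z)\<^sup>2) * f z + 2 * ((radial h z * (rad z)\<^sup>2) * radial f z + \<Omega> h z * \<Omega> f z)\<bar>"
    by (metis abs_mult abs_power2)
  also have "\<dots> \<le> (\<bar>\<Delta> h z\<bar> * (rad z)\<^sup>2) * \<bar>f z\<bar>
      + 2 * ((\<bar>radial h z\<bar> * (rad z)\<^sup>2) * \<bar>radial f z\<bar> + \<bar>\<Omega> h z\<bar> * \<bar>\<Omega> f z\<bar>)"
  proof -
    have "\<bar>a + 2 * (b + c)\<bar> \<le> \<bar>a\<bar> + 2 * (\<bar>b\<bar> + \<bar>c\<bar>)" for a b c :: real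
      by (simp add: abs_if)
    from this[of "(\<Delta> h z * (rad z)\<^sup>2) * f z" "(radial h z * (rad z)\<^sup>2) * radial f z" "\<Omega> h z * \<Omega> f z"]
    show ?thesis by (simp add: abs_mult)
  qed
  also have "\<dots> \<le> M * norm (Zle1 f z) + 2 * (M * (2 * norm (Zle1 f z)) + M * norm (Zle1 f z))"
    using mult_mono[OF hz(6) comp(1) hz(7) abs_ge_zero] mult_mono[OF hz(4) rad hz(7) abs_ge_zero]
      mult_mono[OF hz(5) comp(4) hz(7) abs_ge_zero] by (intro add_mono mult_left_mono) simp_all
  finally have "\<bar>commutator \<Delta> (mult_op h) f z\<bar> * (rad z)\<^sup>2 \<le> 7 * M * norm (Zle1 f z)" by simp
  then show ?thesis using rz by (simp add: field_simps)
qed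

subsection \<open>The modified unknown\<close>

lemma smooth_on_Ztpow:
  assumes U: "open U" "U \<subseteq> off_axis" and \<eta>: "smooth_on UNIV \<eta>" and u: "smooth_on U u"
  shows "smooth_on U (Ztpow \<eta> a u)"
proof -
  have \<eta>r: "smooth_on U (\<lambda>z. \<eta> (rad z))"
    by (rule smooth_on_comp[OF U(1) \<eta> smooth_on_rad[OF U]])
  have "smooth_on U (Zt \<eta> j f)" if "smooth_on U f" for j f
  proof (cases "j = 1")
    case True
    then show ?thesis using smooth_on_pd[OF U(1) that] by (simp add: Zt_def)
  next
    case False
    then have "Zt \<eta> j f = (\<lambda>z. \<eta> (rad z) * Z j f z)" by (simp add: Zt_def)
    then show ?thesis using smooth_on_mult[OF U(1) \<eta>r smooth_on_Z[OF U(1) that]] by simp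
  qed
  then show ?thesis
    unfolding Ztpow_def by (intro smooth_on_funpow[OF U(1)] u)
qed

text \<open>No equation for u is used: \<open>box\<close> of \<open>Zpow a u\<close> is added and
  subtracted, and stays unexpanded. The powers with cutoffs do not commute with \<open>box\<close>,
  so their difference from \<open>Zpow\<close> is kept as a separate term.\<close>

lemma box_V:
  assumes U: "open U" "U \<subseteq> off_axis" and \<eta>: "smooth_on UNIV \<eta>"
    and C0: "\<And>b c \<mu>. real_polynomial_function (C0 b c \<mu>)"
    and u: "smooth_on U u" and z: "z \<in> U"
  shows "\<box> (V \<eta> C0 a u) z = \<box> (\<lambda>y. Ztpow \<eta> a u y - Zpow a u y) z + (\<box> (Zpow a u) z
    + (\<Sum>(b,c)\<in>splits a. \<Sum>\<mu>\<le>2.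
        1/2 * commutator \<Delta> (mult_op (\<lambda>y. C0 b c \<mu> (ang y) * \<eta> (rad y)))
          (\<lambda>y. \<partial> \<mu> (Zpow b u) y * Zpow c u y) z
        - 1/2 * C0 b c \<mu> (ang z) * \<eta> (rad z) *
            (\<box> (\<partial> \<mu> (Zpow b u)) z * Zpow c u z + \<partial> \<mu> (Zpow b u) z * \<box> (Zpow c u) z)
        - C0 b c \<mu> (ang z) * \<eta> (rad z) * Q0 (\<partial> \<mu> (Zpow b u)) (Zpow c u) z))"
proof -
  let ?h = "\<lambda>b c \<mu> y. C0 b c \<mu> (ang y) * \<eta> (rad y)"
  let ?w = "\<lambda>b c \<mu> y. \<partial> \<mu> (Zpow b u) y * Zpow c u y"
  note o = U(1)
  note smZ = smooth_on_Zpow[OF o u]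
  note smT = smooth_on_Ztpow[OF U \<eta> u]
  have smh: "smooth_on U (?h b c \<mu>)" for b c \<mu>
    by (intro smooth_on_mult[OF o] smooth_on_polynomial_ang[OF U C0] smooth_on_comp[OF o \<eta> smooth_on_rad[OF U]])
  have smw: "smooth_on U (?w b c \<mu>)" for b c \<mu>
    by (intro smooth_on_mult[OF o] smooth_on_pd[OF o] smZ)
  have smhw: "smooth_on U (\<lambda>y. ?h b c \<mu> y * ?w b c \<mu> y)" for b c \<mu>
    by (intro smooth_on_mult[OF o] smh smw)
  have h0: "\<partial> 0 (?h b c \<mu>) y = 0" if "y \<in> U" for b c \<mu> y
  proof -
    have y: "snd y \<noteq> 0" using U(2) that by auto
    obtain M where M: "tame (\<lambda>z. C0 b c \<mu> (ang z)) M" using tame_polynomial_ang[OF C0] by blast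
    have "\<partial> 0 (\<lambda>z. \<eta> (rad z)) y = 0"
      by (simp add: pd_comp_rad[OF U \<eta> that] pd_0_rad[OF U that])
    then show ?thesis
      using tame_bounds(1)[OF M y]
      by (subst pd_mult[OF o _ _ that])
        (simp_all add: smooth_on_polynomial_ang[OF U C0] smooth_on_comp[OF o \<eta> smooth_on_rad[OF U]])
  qed
  have prod: "\<box> (\<lambda>y. ?h b c \<mu> y * ?w b c \<mu> y) z =
      ?h b c \<mu> z * (\<box> (\<partial> \<mu> (Zpow b u)) z * Zpow c u z + \<partial> \<mu> (Zpow b u) z * \<box> (Zpow c u) z
        + 2 * Q0 (\<partial> \<mu> (Zpow b u)) (Zpow c u) z) - commutator \<Delta> (mult_op (?h b c \<mu>)) (?w b c \<mu>) z" for b c \<mu>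
  proof -
    have "\<box> (\<lambda>y. ?h b c \<mu> y * ?w b c \<mu> y) z =
        ?h b c \<mu> z * \<box> (?w b c \<mu>) z - commutator \<Delta> (mult_op (?h b c \<mu>)) (?w b c \<mu>) z"
      by (rule box_mult_commutator[OF o smh h0 smw z])
    then show ?thesis
      unfolding box_mult[OF o smooth_on_pd[OF o smZ] smZ z] by (simp only: add.commute)
  qed
  have V_eq: "V \<eta> C0 a u = (\<lambda>y. Ztpow \<eta> a u y - 1/2 * (\<Sum>p\<in>splits a. \<Sum>\<mu>\<le>2.
      ?h (fst p) (snd p) \<mu> y * ?w (fst p) (snd p) \<mu> y))"
    unfolding V_def split_def by (simp only: mult.assoc)
  have sms: "smooth_on U (\<lambda>y. \<Sum>\<mu>\<le>2. ?h (fst p) (snd p) \<mu> y * ?w (fst p) (snd p) \<mu> y)" for p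
    by (intro smooth_on_sum[OF o] smhw)
  have "\<box> (V \<eta> C0 a u) z = \<box> (Ztpow \<eta> a u) z - 1/2 * (\<Sum>p\<in>splits a. \<Sum>\<mu>\<le>2.
      \<box> (\<lambda>y. ?h (fst p) (snd p) \<mu> y * ?w (fst p) (snd p) \<mu> y) z)"
  proof -
    have G: "smooth_on U (\<lambda>y. \<Sum>p\<in>splits a. \<Sum>\<mu>\<le>2. ?h (fst p) (snd p) \<mu> y * ?w (fst p) (snd p) \<mu> y)"
      by (intro smooth_on_sum[OF o] sms)
    show ?thesis
      unfolding V_eq box_diff[OF o smT smooth_on_mult[OF o smooth_on_const G] z] box_cmult[OF o G z]
        box_sum[OF o sms z] box_sum[OF o smhw z] ..
  qed
  moreover have "\<box> (\<lambda>y. Ztpow \<eta> a u y - Zpow a u y) z = \<box> (Ztpow \<eta> a u) z - \<box> (Zpow a u) z"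
    by (rule box_diff[OF o smT smZ z])
  moreover have "T - 1/2 * (\<Sum>p\<in>S. \<Sum>\<mu>\<le>2. c p \<mu> * e * (m p \<mu> + 2 * q p \<mu>) - k p \<mu>) =
      D + (P + (\<Sum>p\<in>S. \<Sum>\<mu>\<le>2. 1/2 * k p \<mu> - 1/2 * c p \<mu> * e * m p \<mu> - c p \<mu> * e * q p \<mu>))"
    if "D = T - P" for T D P e :: real and S :: "((nat^4) \<times> (nat^4)) set" and c m q k :: "_ \<Rightarrow> nat \<Rightarrow> real"
  proof -
    have "(\<Sum>p\<in>S. \<Sum>\<mu>\<le>2. 1/2 * k p \<mu> - 1/2 * c p \<mu> * e * m p \<mu> - c p \<mu> * e * q p \<mu>) =
        (\<Sum>p\<in>S. \<Sum>\<mu>\<le>2. (- 1/2) * (c p \<mu> * e * (m p \<mu> + 2 * q p \<mu>) - k p \<mu>))"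
      by (rule sum.cong[OF refl], rule sum.cong[OF refl]) (simp add: algebra_simps)
    also have "\<dots> = (- 1/2) * (\<Sum>p\<in>S. \<Sum>\<mu>\<le>2. c p \<mu> * e * (m p \<mu> + 2 * q p \<mu>) - k p \<mu>)"
      by (simp only: sum_distrib_left)
    finally show ?thesis using that by simp
  qed
  ultimately show ?thesis
    unfolding prod split_def by (simp only:)
qed

section \<open>Vanishing of the modified unknown on the boundary\<close>

text \<open>At s = 0 the values for negative times are those of an extension and need not vanish.
  The derivative exists in a full neighbourhood, however, and so it is determined by the difference
  quotients from the right.\<close>

lemma pd_0_zero_on_half_line:
  assumes f: "smooth_on W f" and W: "\<And>s. 0 \<le> s \<Longrightarrow> (s, x) \<in> W" and f0: "\<And>s. 0 \<le> s \<Longrightarrow> f (s, x) = 0"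
    and s: "0 \<le> s"
  shows "\<partial> 0 f (s, x) = 0"
proof -
  let ?D = "frechet_derivative f (at (s, x))"
  have D: "(f has_derivative ?D) (at (s, x))"
    using smooth_on_differentiable[OF f W[OF s]] by (simp add: frechet_derivative_works)
  have "((\<lambda>r. (r, x)) has_derivative (\<lambda>h. (h, 0))) (at s within {s..s+1})"
    by (auto intro!: derivative_eq_intros)
  from has_derivative_compose[OF this D]
  have "((\<lambda>r. f (r, x)) has_derivative (\<lambda>h. ?D (h, 0))) (at s within {s..s+1})" .
  moreover have "(\<lambda>h. ?D (h, 0)) = (\<lambda>h. h *\<^sub>R ?D (1, 0))"
  proof
    fix h :: real
    have "?D (h *\<^sub>R (1, 0)) = h *\<^sub>R ?D (1, 0)"
      using linear_scale[OF has_derivative_linear[OF D]] .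
    then show "?D (h, 0) = h *\<^sub>R ?D (1, 0)" by simp
  qed
  ultimately have "((\<lambda>r. f (r, x)) has_vector_derivative ?D (1, 0)) (at s within {s..s+1})"
    by (simp add: has_vector_derivative_def)
  moreover have "((\<lambda>r. f (r, x)) has_vector_derivative 0) (at s within {s..s+1})"
    by (rule has_vector_derivative_transform[OF _ _ has_vector_derivative_const[of 0]]) (use s f0 in auto)
  moreover have "at s within {s..s+1} \<noteq> bot"
    by (simp add: at_within_Icc_at_right)
  ultimately have "?D (1, 0) = 0"
    using vector_derivative_unique_within by blast
  then show ?thesis by (simp add: pd_def dir_simps)
qed

text \<open>If only time derivatives occur, they are tangential to the boundary, where u vanishes.
  Otherwise some factor carries the cutoff, which is zero on a whole neighbourhood of the
  point.\<close>

lemma Ztpow_zero_on_boundary: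
  assumes \<eta>: "\<And>s. s \<le> 1/2 \<Longrightarrow> \<eta> s = 0"
    and W: "open W" "smooth_on W u" "\<And>s. 0 \<le> s \<Longrightarrow> (s, x) \<in> W"
    and u0: "\<And>s. 0 \<le> s \<Longrightarrow> u (s, x) = 0" and x: "norm x < 1/2" and t: "0 \<le> t"
  shows "Ztpow \<eta> a u (t, x) = 0"
proof -
  let ?B = "{z :: spacetime. rad z < 1/2}"
  have B: "open ?B"
    unfolding rad_def by (intro open_Collect_less continuous_intros)
  have Zt1: "Zt \<eta> 1 = \<partial> 0" by (simp add: Zt_def fun_eq_iff)
  \<comment> \<open>Vanishing is propagated on the open set rather than at the single point, so that
    it survives the time derivatives applied outside.\<close>
  have zero: "(Zt \<eta> j ^^ n) f z = 0" if "j \<noteq> 1 \<and> 0 < n \<or> (\<forall>y\<in>?B. f y = 0)" "z \<in> ?B" for j n f z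
    using that
  proof (induction n arbitrary: z)
    case (Suc n)
    show ?case
    proof (cases "j = 1")
      case True
      then have "\<And>y. y \<in> ?B \<Longrightarrow> (Zt \<eta> j ^^ n) f y = (\<lambda>_. 0) y" using Suc by blast
      then have "\<partial> 0 ((Zt \<eta> j ^^ n) f) z = \<partial> 0 (\<lambda>_. 0) z" by (rule pd_cong[OF B _ Suc.prems(2)])
      then show ?thesis using True by (simp add: Zt1 del: One_nat_def)
    next
      case False
      then show ?thesis using \<eta>[of "rad z"] Suc.prems(2) by (simp add: Zt_def)
    qed
  qed auto
  have tx: "(t, x) \<in> ?B" using x by (simp add: rad_def)
  show ?thesis
  proof (cases "a $ 2 = 0 \<and> a $ 3 = 0 \<and> a $ 4 = 0")
    case True
    have "\<forall>s\<ge>0. (\<partial> 0 ^^ n) u (s, x) = 0" for n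
    proof (induction n)
      case (Suc n)
      then show ?case
        using pd_0_zero_on_half_line[OF smooth_on_funpow[OF W(1) smooth_on_pd[OF W(1)] W(2)] W(3)] by simp
    qed (simp add: u0)
    then show ?thesis using True t by (simp add: Ztpow_def Zt1 del: One_nat_def)
  next
    case False
    have "(Zt \<eta> 2 ^^ (a$2)) ((Zt \<eta> 3 ^^ (a$3)) ((Zt \<eta> 4 ^^ (a$4)) u)) y = 0" if "y \<in> ?B" for y
    proof -
      have 4: "\<forall>y\<in>?B. (Zt \<eta> 4 ^^ (a$4)) u y = 0" if "a $ 4 \<noteq> 0" using that by (intro ballI zero) auto
      have 3: "\<forall>y\<in>?B. (Zt \<eta> 3 ^^ (a$3)) ((Zt \<eta> 4 ^^ (a$4)) u) y = 0" if "a $ 3 \<noteq> 0 \<or> a $ 4 \<noteq> 0"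
        using that 4 by (intro ballI zero) auto
      show ?thesis using False 3 by (intro zero that) auto
    qed
    then show ?thesis unfolding Ztpow_def by (intro zero tx) auto
  qed
qed

section \<open>The expansions for solutions\<close>

text \<open>As 0 is not in K, removing the axis x = 0 from the domain of the extension loses no
  point over K, and |x| and \<omega> are smooth on what remains.\<close>

lemma solution_neighbourhood:
  assumes "is_solution K Q \<epsilon> u\<^sub>0 u\<^sub>1 u" "0 \<notin> K"
  obtains U where "open U" "U \<subseteq> off_axis" "{0..} \<times> K \<subseteq> U" "smooth_on U u"
proof -
  obtain W where W: "open W" "{0..} \<times> closure K \<subseteq> W" "smooth_on W u"
    using assms(1) unfolding is_solution_def by blast
  show ?thesis
  proof (rule that[of "W \<inter> off_axis"])
    show "{0..} \<times> K \<subseteq> W \<inter> off_axis" using W(2) assms(2) closure_subset[of K] by force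
  qed (use W open_off_axis in \<open>auto intro: smooth_on_subset\<close>)
qed

text \<open>The equation can be differentiated in the open set \<open>t > 0\<close>; at \<open>t = 0\<close> use continuity.\<close>

lemma solution_Zpow_box:
  assumes sol: "is_solution K Q \<epsilon> u\<^sub>0 u\<^sub>1 u" and K: "open K" "0 \<notin> K" and z: "z \<in> {0..} \<times> K"
  shows "Zpow a (\<box> u) z = Zpow a (quad_form Q u u) z"
proof -
  obtain U where U: "open U" "{0..} \<times> K \<subseteq> U" "smooth_on U u"
    using solution_neighbourhood[OF sol K(2)] by metis
  obtain t x where tx: "z = (t, x)" "0 \<le> t" "x \<in> K" using z by auto
  let ?F = "\<lambda>y. Zpow a (\<box> u) y - Zpow a (quad_form Q u u) y"
  have eq: "\<box> u y = quad_form Q u u y" if "y \<in> {0<..} \<times> K" for y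
  proof -
    have "y \<in> {0..} \<times> K" using that by auto
    then show ?thesis using sol unfolding is_solution_def quad_form_def by blast
  qed
  have F0: "?F (s, x) = 0" if "0 < s" for s
    using Zpow_cong[OF open_Times[OF open_greaterThan K(1)] eq, where z = "(s, x)" and a = a] that tx(3) by simp
  have "smooth_on U ?F"
    by (intro smooth_on_diff[OF U(1)] smooth_on_Zpow[OF U(1)] smooth_on_box[OF U(1)] smooth_on_quad_form[OF U(1)] U(3))
  then have "isCont ?F z"
    using smooth_on_continuous_on U(1,2) z continuous_on_eq_continuous_at by blast
  moreover have "(\<lambda>n. (t + 1 / real (Suc n), x)) \<longlonglongrightarrow> z"
    unfolding tx(1) using tendsto_add[OF tendsto_const[of t] LIMSEQ_Suc[OF lim_1_over_n]]
    by (intro tendsto_Pair tendsto_const) simp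
  ultimately have "(\<lambda>n. ?F (t + 1 / real (Suc n), x)) \<longlonglongrightarrow> ?F z"
    by (rule isCont_tendsto_compose)
  moreover have "(\<lambda>n. ?F (t + 1 / real (Suc n), x)) = (\<lambda>n. 0)"
    using F0 tx(2) by (intro ext F0) (simp add: add_nonneg_pos)
  ultimately have "(\<lambda>n::nat. 0) \<longlonglongrightarrow> ?F z" by simp
  then have "?F z = 0" using LIMSEQ_unique tendsto_const by blast
  then show ?thesis by simp
qed

text \<open>Pairs the summands of \<open>box\<close> of \<open>Zpow a u\<close> with those of the
  quadratic correction, so that the regrouping has to be checked for a single pair (b, c)
  only.\<close>

lemma sum_splits_decompose:
  fixes f :: "_ \<Rightarrow> _ \<Rightarrow> real"
  assumes "\<And>b c. X b c + f b c = 1/2 * g b c + h b c + k b c"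
  shows "(\<Sum>(b,c)\<in>S. X b c) + (\<Sum>(b,c)\<in>S. f b c) =
    1/2 * (\<Sum>(b,c)\<in>S. g b c) + (\<Sum>(b,c)\<in>S. h b c) + (\<Sum>(b,c)\<in>S. k b c)"
  unfolding split_def sum_distrib_left sum.distrib[symmetric] assms ..


text \<open>This is \<open>null_expansion\<close> with its witness exposed: the function V and all
  the expansions must be built from the same tensors r.\<close>

definition null_coefficients ::
  "(nat \<Rightarrow> nat \<Rightarrow> nat \<Rightarrow> real) \<Rightarrow> nat^4 \<Rightarrow> (nat^4 \<Rightarrow> nat^4 \<Rightarrow> nat \<Rightarrow> nat \<Rightarrow> nat \<Rightarrow> real) \<Rightarrow> bool" where
  "null_coefficients Q a r \<longleftrightarrow> (\<forall>b c. null_tensor (r b c)) \<and>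
     (\<forall>U u. open U \<longrightarrow> smooth_on U u \<longrightarrow> (\<forall>z\<in>U. Zpow a (quad_form Q u u) z =
       (\<Sum>(b,c)\<in>splits a. quad_form (r b c) (Zpow b u) (Zpow c u) z)))"

context
  fixes K :: "(real^2) set" and Q :: "nat \<Rightarrow> nat \<Rightarrow> nat \<Rightarrow> real" and \<eta> :: "real \<Rightarrow> real"
    and a :: "nat^4" and r :: "nat^4 \<Rightarrow> nat^4 \<Rightarrow> nat \<Rightarrow> nat \<Rightarrow> nat \<Rightarrow> real"
  assumes K: "open K" "0 \<notin> K" and cutoff: "is_cutoff \<eta>" and r: "null_coefficients Q a r"
begin

lemma smooth_\<eta>: "smooth_on UNIV \<eta>"
  using cutoff by (simp add: is_cutoff_def)

lemma null_r: "null_tensor (r b c)"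
  using r by (simp add: null_coefficients_def)

lemma box_Zpow_solution:
  assumes sol: "is_solution K Q \<epsilon> u\<^sub>0 u\<^sub>1 u" and z: "z \<in> {0..} \<times> K"
  shows "\<box> (Zpow a u) z = (\<Sum>(b,c)\<in>splits a. quad_form (r b c) (Zpow b u) (Zpow c u) z)"
proof -
  obtain U where U: "open U" "{0..} \<times> K \<subseteq> U" "smooth_on U u"
    using solution_neighbourhood[OF sol K(2)] by metis
  have zU: "z \<in> U" using z U(2) by blast
  have "Zpow a (quad_form Q u u) z = (\<Sum>(b,c)\<in>splits a. quad_form (r b c) (Zpow b u) (Zpow c u) z)"
    using r U zU unfolding null_coefficients_def by blast
  then show ?thesis
    using box_Zpow[OF U(1,3) zU] solution_Zpow_box[OF sol K z] by simp
qed

lemma box_Zpow_expansion: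
  assumes sol: "is_solution K Q \<epsilon> u\<^sub>0 u\<^sub>1 u" and z: "z \<in> {0..} \<times> K"
  shows "\<box> (Zpow a u) z = (\<Sum>(b,c)\<in>splits a.
      (\<Sum>\<mu>\<le>2. \<Sum>\<nu>\<le>2. 1 / rad z *
         (pol_A (r b c) \<mu> \<nu> (ang z) * \<partial> \<mu> (\<partial> \<nu> (Zpow b u)) z * \<Omega> (Zpow c u) z
          + pol_B (r b c) \<mu> \<nu> (ang z) * \<Omega> (\<partial> \<mu> (Zpow b u)) z * \<partial> \<nu> (Zpow c u) z))
      + (\<Sum>\<mu>\<le>2. coef_Q12 (r b c) \<mu> * Q12 (\<partial> \<mu> (Zpow b u)) (Zpow c u) z
          + pol_Q0 (r b c) \<mu> (ang z) * Q0 (\<partial> \<mu> (Zpow b u)) (Zpow c u) z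
          + pol_box (r b c) \<mu> (ang z) * \<box> (Zpow b u) z * \<partial> \<mu> (Zpow c u) z))"
proof -
  obtain U where U: "open U" "U \<subseteq> off_axis" "{0..} \<times> K \<subseteq> U" "smooth_on U u"
    by (rule solution_neighbourhood[OF sol K(2)])
  have zU: "z \<in> U" using z U(3) by blast
  show ?thesis
    unfolding box_Zpow_solution[OF sol z]
      quad_form_polar[OF U(1,2) null_r smooth_on_Zpow[OF U(1,4)] zU] ..
qed

lemma V_zero_on_boundary:
  assumes sol: "is_solution K Q \<epsilon> u\<^sub>0 u\<^sub>1 u" and fr: "frontier K \<subseteq> {x. norm x < 1/2}"
    and z: "z \<in> {0..} \<times> frontier K"
  shows "V \<eta> C0 a u z = 0"
proof -
  obtain t x where tx: "z = (t, x)" "0 \<le> t" "x \<in> frontier K" using z by auto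
  obtain W where W: "open W" "{0..} \<times> closure K \<subseteq> W" "smooth_on W u"
    using sol unfolding is_solution_def by blast
  have \<eta>: "\<eta> s = 0" if "s \<le> 1/2" for s using cutoff that by (simp add: is_cutoff_def)
  have x: "norm x < 1/2" using fr tx(3) by auto
  have u0: "u (s, x) = 0" if "0 \<le> s" for s
  proof -
    have "(s, x) \<in> {0..} \<times> frontier K" using that tx(3) by simp
    then show ?thesis using sol unfolding is_solution_def by blast
  qed
  have sW: "(s, x) \<in> W" if "0 \<le> s" for s using W(2) that tx(3) by (auto simp: frontier_def)
  have "Ztpow \<eta> a u (t, x) = 0"
    by (rule Ztpow_zero_on_boundary[OF \<eta> W(1,3) sW u0 x tx(2)])
  moreover have "\<eta> (rad (t, x)) = 0" using x by (intro \<eta>) (simp add: rad_def)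
  ultimately show ?thesis by (simp add: V_def tx(1))
qed

lemma box_V_solution:
  assumes sol: "is_solution K Q \<epsilon> u\<^sub>0 u\<^sub>1 u" and z: "z \<in> {0..} \<times> K"
  shows "\<box> (V \<eta> (\<lambda>b c. pol_Q0 (r b c)) a u) z = \<box> (\<lambda>y. Ztpow \<eta> a u y - Zpow a u y) z
    + ((\<Sum>(b,c)\<in>splits a. quad_form (r b c) (Zpow b u) (Zpow c u) z)
       + (\<Sum>(b,c)\<in>splits a. \<Sum>\<mu>\<le>2.
          1/2 * commutator \<Delta> (mult_op (\<lambda>y. pol_Q0 (r b c) \<mu> (ang y) * \<eta> (rad y)))
            (\<lambda>y. \<partial> \<mu> (Zpow b u) y * Zpow c u y) z
          - 1/2 * pol_Q0 (r b c) \<mu> (ang z) * \<eta> (rad z) *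
              (\<box> (\<partial> \<mu> (Zpow b u)) z * Zpow c u z + \<partial> \<mu> (Zpow b u) z * \<box> (Zpow c u) z)
          - pol_Q0 (r b c) \<mu> (ang z) * \<eta> (rad z) * Q0 (\<partial> \<mu> (Zpow b u)) (Zpow c u) z))"
proof -
  obtain U where U: "open U" "U \<subseteq> off_axis" "{0..} \<times> K \<subseteq> U" "smooth_on U u"
    by (rule solution_neighbourhood[OF sol K(2)])
  have zU: "z \<in> U" using z U(3) by blast
  show ?thesis
    unfolding box_Zpow_solution[OF sol z, symmetric]
    by (rule box_V[OF U(1,2) smooth_\<eta> real_polynomial_function_coefficients(1) U(4) zU])
qed

text \<open>The form \<open>Q0\<close> occurs with C0 in \<open>box\<close> of
  \<open>Zpow a u\<close> and with -C0 \<chi> in the correction, so only C0 (1 - \<chi>) survives,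
  supported where |x| \<le> 1. The terms in which \<open>box\<close> falls on one factor of the
  correction keep the coefficient -C0/2.\<close>

lemma box_V_expansion:
  assumes sol: "is_solution K Q \<epsilon> u\<^sub>0 u\<^sub>1 u" and z: "z \<in> {0..} \<times> K"
  shows "\<box> (V \<eta> (\<lambda>b c. pol_Q0 (r b c)) a u) z =
    \<box> (\<lambda>y. Ztpow \<eta> a u y - Zpow a u y) z
    + 1/2 * (\<Sum>(b,c)\<in>splits a. \<Sum>\<mu>\<le>2.
        commutator \<Delta> (mult_op (\<lambda>y. pol_Q0 (r b c) \<mu> (ang y) * \<eta> (rad y)))
          (\<lambda>y. \<partial> \<mu> (Zpow b u) y * Zpow c u y) z)
    + (\<Sum>(b,c)\<in>splits a. \<Sum>\<mu>\<le>2.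
        coef_Q12 (r b c) \<mu> * Q12 (\<partial> \<mu> (Zpow b u)) (Zpow c u) z
        + pol_Q0 (r b c) \<mu> (ang z) * (1 - \<eta> (rad z)) * Q0 (\<partial> \<mu> (Zpow b u)) (Zpow c u) z
        + pol_box (r b c) \<mu> (ang z) * \<box> (Zpow b u) z * \<partial> \<mu> (Zpow c u) z
        + (- 1/2 * pol_Q0 (r b c) \<mu> (ang z)) * \<eta> (rad z) *
            (\<box> (\<partial> \<mu> (Zpow b u)) z * Zpow c u z + \<partial> \<mu> (Zpow b u) z * \<box> (Zpow c u) z))
    + (\<Sum>(b,c)\<in>splits a. \<Sum>\<mu>\<le>2. \<Sum>\<nu>\<le>2. 1 / rad z *
        (pol_A (r b c) \<mu> \<nu> (ang z) * \<partial> \<mu> (\<partial> \<nu> (Zpow b u)) z * \<Omega> (Zpow c u) z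
         + pol_B (r b c) \<mu> \<nu> (ang z) * \<Omega> (\<partial> \<mu> (Zpow b u)) z * \<partial> \<nu> (Zpow c u) z))"
proof -
  obtain U where U: "open U" "U \<subseteq> off_axis" "{0..} \<times> K \<subseteq> U" "smooth_on U u"
    by (rule solution_neighbourhood[OF sol K(2)])
  have zU: "z \<in> U" using z U(3) by blast
  have alg: "(X + (\<Sum>\<mu>\<le>2. p \<mu> + c \<mu> * q \<mu> + d \<mu>)) + (\<Sum>\<mu>\<le>2. 1/2 * k \<mu> - 1/2 * c \<mu> * e * m \<mu> - c \<mu> * e * q \<mu>) =
      1/2 * (\<Sum>\<mu>\<le>2. k \<mu>) + (\<Sum>\<mu>\<le>2. p \<mu> + c \<mu> * (1 - e) * q \<mu> + d \<mu> + (- 1/2 * c \<mu>) * e * m \<mu>) + X"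
    for X e :: real and p c q d k m :: "nat \<Rightarrow> real"
    by (simp add: sum_atMost_2 algebra_simps)
  show ?thesis
    unfolding box_V_solution[OF sol z] quad_form_polar[OF U(1,2) null_r smooth_on_Zpow[OF U(1,4)] zU]
    by (subst sum_splits_decompose[OF alg]) (simp only: add.assoc)
qed

lemma box_V_divergence:
  assumes sol: "is_solution K Q \<epsilon> u\<^sub>0 u\<^sub>1 u" and z: "z \<in> {0..} \<times> K"
  shows "\<box> (V \<eta> (\<lambda>b c. pol_Q0 (r b c)) a u) z =
    \<box> (\<lambda>y. Ztpow \<eta> a u y - Zpow a u y) z
    + 1/2 * (\<Sum>(b,c)\<in>splits a. \<Sum>\<mu>\<le>2.
        commutator \<Delta> (mult_op (\<lambda>y. pol_Q0 (r b c) \<mu> (ang y) * \<eta> (rad y)))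
          (\<lambda>y. \<partial> \<mu> (Zpow b u) y * Zpow c u y) z)
    + (\<Sum>(b,c)\<in>splits a. \<Sum>\<mu>\<le>2.
        pol_Q0 (r b c) \<mu> (ang z) * (1 - \<eta> (rad z)) * Q0 (\<partial> \<mu> (Zpow b u)) (Zpow c u) z
        + pol_box (r b c) \<mu> (ang z) * \<box> (Zpow b u) z * \<partial> \<mu> (Zpow c u) z
        + (- 1/2 * pol_Q0 (r b c) \<mu> (ang z)) * \<eta> (rad z) *
            (\<box> (\<partial> \<mu> (Zpow b u)) z * Zpow c u z + \<partial> \<mu> (Zpow b u) z * \<box> (Zpow c u) z))
    + (\<Sum>(b,c)\<in>splits a.
        \<Omega> (\<lambda>y. (\<Sum>\<mu>\<le>2. \<Sum>\<nu>\<le>2. pol_P (r b c) \<mu> \<nu> (ang y) * \<partial> \<mu> (\<partial> \<nu> (Zpow b u)) y)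
                  * Zpow c u y / rad y) z
        + (\<Sum>\<mu>\<le>2. \<partial> \<mu> (\<lambda>y. (\<Sum>j=1..4. \<Sum>\<nu>\<le>2. pol_R (r b c) \<mu> j \<nu> (ang y) * Z j (\<partial> \<nu> (Zpow b u)) y)
                  * Zpow c u y / rad y) z)
        + (\<Sum>j=1..4. \<Sum>\<nu>\<le>2. pol_S (r b c) j \<nu> (ang z) * Z j (\<partial> \<nu> (Zpow b u)) z)
            * Zpow c u z / (rad z)\<^sup>2)"
proof -
  obtain U where U: "open U" "U \<subseteq> off_axis" "{0..} \<times> K \<subseteq> U" "smooth_on U u"
    by (rule solution_neighbourhood[OF sol K(2)])
  have zU: "z \<in> U" using z U(3) by blast
  have alg: "((\<Sum>\<mu>\<le>2. c \<mu> * q \<mu> + d \<mu>) + X) + (\<Sum>\<mu>\<le>2. 1/2 * k \<mu> - 1/2 * c \<mu> * e * m \<mu> - c \<mu> * e * q \<mu>) =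
      1/2 * (\<Sum>\<mu>\<le>2. k \<mu>) + (\<Sum>\<mu>\<le>2. c \<mu> * (1 - e) * q \<mu> + d \<mu> + (- 1/2 * c \<mu>) * e * m \<mu>) + X"
    for X e :: real and c q d k m :: "nat \<Rightarrow> real"
    by (simp add: sum_atMost_2 algebra_simps)
  show ?thesis
    unfolding box_V_solution[OF sol z]
      quad_form_divergence[OF U(1,2) null_r smooth_on_Zpow[OF U(1,4)] smooth_on_Zpow[OF U(1,4)] zU]
    by (subst sum_splits_decompose[OF alg]) (simp only: add.assoc)
qed

text \<open>Only finitely many multipliers occur for b + c \<le> a and \<mu> \<le> 2. Their
  constants are nonnegative and chosen before u, and their sum dominates each of them.\<close>

lemma commutator_bound:
  "\<exists>M. \<forall>b c. b + c \<le> a \<longrightarrow> (\<forall>\<mu>\<le>2. \<forall>\<epsilon> u\<^sub>0 u\<^sub>1 u. is_solution K Q \<epsilon> u\<^sub>0 u\<^sub>1 u \<longrightarrow>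
    (\<forall>z\<in>{0..} \<times> K.
      \<bar>commutator \<Delta> (mult_op (\<lambda>y. pol_Q0 (r b c) \<mu> (ang y) * \<eta> (rad y)))
          (\<lambda>y. \<partial> \<mu> (Zpow b u) y * Zpow c u y) z\<bar>
        \<le> M * (1 / (rad z)\<^sup>2) * norm (Zle1 (\<lambda>y. \<partial> \<mu> (Zpow b u) y * Zpow c u y) z)))"
proof -
  let ?h = "\<lambda>b c \<mu> y. pol_Q0 (r b c) \<mu> (ang y) * \<eta> (rad y)"
  have "\<exists>M. tame (?h b c \<mu>) M" for b c \<mu>
    using tame_mult tame_cutoff[OF cutoff] tame_polynomial_ang[OF real_polynomial_function_coefficients(1)] by blast
  then obtain N where N: "\<And>b c \<mu>. tame (?h b c \<mu>) (N b c \<mu>)" by metis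
  define M where "M = (\<Sum>p\<in>splits a. \<Sum>\<mu>\<le>2. N (fst p) (snd p) \<mu>)"
  \<comment> \<open>A tame constant is nonnegative because it bounds an absolute value at some point
    off the axis; (0, axis 1 1) serves as that point.\<close>
  have N0: "0 \<le> N b c \<mu>" for b c \<mu>
    by (rule tame_bounds(7)[OF N, of "(0, axis 1 1)"]) (simp add: axis_eq_0_iff)
  have NM: "N b c \<mu> \<le> M" if "b + c \<le> a" "\<mu> \<le> 2" for b c \<mu>
  proof -
    have "N b c \<mu> \<le> (\<Sum>\<mu>\<le>2. N b c \<mu>)"
      using that(2) by (intro member_le_sum N0) auto
    also have "\<dots> \<le> M"
      unfolding M_def using that(1)
      by (intro member_le_sum[of "(b, c)" "splits a" "\<lambda>p. \<Sum>\<mu>\<le>2. N (fst p) (snd p) \<mu>", simplified])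
        (auto simp: splits_def[symmetric] finite_splits intro!: sum_nonneg N0, simp add: splits_def)
    finally show ?thesis .
  qed
  show ?thesis
  proof (intro exI[of _ "7 * M"] allI impI ballI)
    fix b c :: "nat^4" and \<mu> :: nat and \<epsilon> u\<^sub>0 u\<^sub>1 u and z :: spacetime
    assume bc: "b + c \<le> a" "\<mu> \<le> 2" and sol: "is_solution K Q \<epsilon> u\<^sub>0 u\<^sub>1 u" and z: "z \<in> {0..} \<times> K"
    obtain U where U: "open U" "U \<subseteq> off_axis" "{0..} \<times> K \<subseteq> U" "smooth_on U u"
      by (rule solution_neighbourhood[OF sol K(2)])
    have zU: "z \<in> U" "snd z \<noteq> 0" using z U(2,3) by auto
    let ?w = "\<lambda>y. \<partial> \<mu> (Zpow b u) y * Zpow c u y"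
    have w: "smooth_on U ?w"
      by (intro smooth_on_mult[OF U(1)] smooth_on_pd[OF U(1)] smooth_on_Zpow[OF U(1,4)])
    have "\<bar>commutator \<Delta> (mult_op (?h b c \<mu>)) ?w z\<bar> \<le> 7 * N b c \<mu> * (1 / (rad z)\<^sup>2) * norm (Zle1 ?w z)"
      by (rule commutator_tame_bound[OF N U(1) zU w])
    also have "\<dots> \<le> 7 * M * (1 / (rad z)\<^sup>2) * norm (Zle1 ?w z)"
      using NM[OF bc] by (intro mult_right_mono) auto
    finally show "\<bar>commutator \<Delta> (mult_op (?h b c \<mu>)) ?w z\<bar> \<le> 7 * M * (1 / (rad z)\<^sup>2) * norm (Zle1 ?w z)" .
  qed
qed

end

theorem lemma2p4:
  fixes Obs K :: "(real^2) set" and c\<^sub>0 :: real and \<eta> :: "real \<Rightarrow> real"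
    and Q :: "nat \<Rightarrow> nat \<Rightarrow> nat \<Rightarrow> real"
  assumes "compact Obs" and "0 \<in> Obs" and "has_smooth_boundary Obs"
    and K_def: "K = UNIV - Obs"
    and "c\<^sub>0 > 0" and "frontier K \<subseteq> {x. c\<^sub>0 < norm x \<and> norm x < 1/2}"
    and "is_cutoff \<eta>"
    and Q_sym: "\<forall>\<alpha>\<le>2. \<forall>\<beta>\<le>2. \<forall>\<gamma>\<le>2. Q \<alpha> \<beta> \<gamma> = Q \<beta> \<alpha> \<gamma>"
    and "null_condition Q"
  shows "\<forall>a :: nat^4.
    \<exists>(C12 :: nat^4 \<Rightarrow> nat^4 \<Rightarrow> nat \<Rightarrow> real) (C0 :: nat^4 \<Rightarrow> nat^4 \<Rightarrow> nat \<Rightarrow> real^2 \<Rightarrow> real).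
      (\<forall>b c \<mu>. real_polynomial_function (C0 b c \<mu>)) \<and>

      (\<exists>A B D.
        (\<forall>b c \<mu> \<nu>. real_polynomial_function (A b c \<mu> \<nu>)) \<and>
        (\<forall>b c \<mu> \<nu>. real_polynomial_function (B b c \<mu> \<nu>)) \<and>
        (\<forall>b c \<mu>. real_polynomial_function (D b c \<mu>)) \<and>
        (\<forall>\<epsilon> u\<^sub>0 u\<^sub>1 u. is_solution K Q \<epsilon> u\<^sub>0 u\<^sub>1 u \<longrightarrow> (\<forall>z\<in>{0..} \<times> K.
          \<box> (Zpow a u) z = (\<Sum>(b,c)\<in>splits a.
            (\<Sum>\<mu>\<le>2. \<Sum>\<nu>\<le>2. 1 / rad z *
               (A b c \<mu> \<nu> (ang z) * \<partial> \<mu> (\<partial> \<nu> (Zpow b u)) z * \<Omega> (Zpow c u) z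
                + B b c \<mu> \<nu> (ang z) * \<Omega> (\<partial> \<mu> (Zpow b u)) z * \<partial> \<nu> (Zpow c u) z))
            + (\<Sum>\<mu>\<le>2. C12 b c \<mu> * Q12 (\<partial> \<mu> (Zpow b u)) (Zpow c u) z
                + C0 b c \<mu> (ang z) * Q0 (\<partial> \<mu> (Zpow b u)) (Zpow c u) z
                + D b c \<mu> (ang z) * \<box> (Zpow b u) z * \<partial> \<mu> (Zpow c u) z))))) \<and>

      (\<forall>\<epsilon> u\<^sub>0 u\<^sub>1 u. is_solution K Q \<epsilon> u\<^sub>0 u\<^sub>1 u \<longrightarrow>
        (\<forall>z\<in>{0..} \<times> frontier K. V \<eta> C0 a u z = 0)) \<and>

      (\<exists>A B D E F.
        (\<forall>b c \<mu> \<nu>. real_polynomial_function (A b c \<mu> \<nu>)) \<and>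
        (\<forall>b c \<mu> \<nu>. real_polynomial_function (B b c \<mu> \<nu>)) \<and>
        (\<forall>b c \<mu>. real_polynomial_function (D b c \<mu>)) \<and>
        (\<forall>b c \<mu>. real_polynomial_function (E b c \<mu>)) \<and>
        (\<forall>b c \<mu>. real_polynomial_function (F b c \<mu>)) \<and>
        (\<forall>\<epsilon> u\<^sub>0 u\<^sub>1 u. is_solution K Q \<epsilon> u\<^sub>0 u\<^sub>1 u \<longrightarrow> (\<forall>z\<in>{0..} \<times> K.
          \<box> (V \<eta> C0 a u) z =
            \<box> (\<lambda>y. Ztpow \<eta> a u y - Zpow a u y) z
            + 1/2 * (\<Sum>(b,c)\<in>splits a. \<Sum>\<mu>\<le>2.
                commutator \<Delta> (mult_op (\<lambda>y. C0 b c \<mu> (ang y) * \<eta> (rad y)))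
                  (\<lambda>y. \<partial> \<mu> (Zpow b u) y * Zpow c u y) z)
            + (\<Sum>(b,c)\<in>splits a. \<Sum>\<mu>\<le>2.
                C12 b c \<mu> * Q12 (\<partial> \<mu> (Zpow b u)) (Zpow c u) z
                + E b c \<mu> (ang z) * (1 - \<eta> (rad z)) * Q0 (\<partial> \<mu> (Zpow b u)) (Zpow c u) z
                + D b c \<mu> (ang z) * \<box> (Zpow b u) z * \<partial> \<mu> (Zpow c u) z
                + F b c \<mu> (ang z) * \<eta> (rad z) *
                    (\<box> (\<partial> \<mu> (Zpow b u)) z * Zpow c u z + \<partial> \<mu> (Zpow b u) z * \<box> (Zpow c u) z))
            + (\<Sum>(b,c)\<in>splits a. \<Sum>\<mu>\<le>2. \<Sum>\<nu>\<le>2. 1 / rad z *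
                (A b c \<mu> \<nu> (ang z) * \<partial> \<mu> (\<partial> \<nu> (Zpow b u)) z * \<Omega> (Zpow c u) z
                 + B b c \<mu> \<nu> (ang z) * \<Omega> (\<partial> \<mu> (Zpow b u)) z * \<partial> \<nu> (Zpow c u) z))))) \<and>

      (\<exists>M. \<forall>b c. b + c \<le> a \<longrightarrow> (\<forall>\<mu>\<le>2. \<forall>\<epsilon> u\<^sub>0 u\<^sub>1 u. is_solution K Q \<epsilon> u\<^sub>0 u\<^sub>1 u \<longrightarrow>
        (\<forall>z\<in>{0..} \<times> K.
          \<bar>commutator \<Delta> (mult_op (\<lambda>y. C0 b c \<mu> (ang y) * \<eta> (rad y)))
              (\<lambda>y. \<partial> \<mu> (Zpow b u) y * Zpow c u y) z\<bar>
            \<le> M * (1 / (rad z)\<^sup>2) * norm (Zle1 (\<lambda>y. \<partial> \<mu> (Zpow b u) y * Zpow c u y) z)))) \<and>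

      (\<exists>D E F P R S.
        (\<forall>b c \<mu>. real_polynomial_function (D b c \<mu>)) \<and>
        (\<forall>b c \<mu>. real_polynomial_function (E b c \<mu>)) \<and>
        (\<forall>b c \<mu>. real_polynomial_function (F b c \<mu>)) \<and>
        (\<forall>b c \<mu> \<nu>. real_polynomial_function (P b c \<mu> \<nu>)) \<and>
        (\<forall>b c \<mu> j \<nu>. real_polynomial_function (R b c \<mu> j \<nu>)) \<and>
        (\<forall>b c j \<nu>. real_polynomial_function (S b c j \<nu>)) \<and>
        (\<forall>\<epsilon> u\<^sub>0 u\<^sub>1 u. is_solution K Q \<epsilon> u\<^sub>0 u\<^sub>1 u \<longrightarrow> (\<forall>z\<in>{0..} \<times> K.
          \<box> (V \<eta> C0 a u) z =
            \<box> (\<lambda>y. Ztpow \<eta> a u y - Zpow a u y) z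
            + 1/2 * (\<Sum>(b,c)\<in>splits a. \<Sum>\<mu>\<le>2.
                commutator \<Delta> (mult_op (\<lambda>y. C0 b c \<mu> (ang y) * \<eta> (rad y)))
                  (\<lambda>y. \<partial> \<mu> (Zpow b u) y * Zpow c u y) z)
            + (\<Sum>(b,c)\<in>splits a. \<Sum>\<mu>\<le>2.
                E b c \<mu> (ang z) * (1 - \<eta> (rad z)) * Q0 (\<partial> \<mu> (Zpow b u)) (Zpow c u) z
                + D b c \<mu> (ang z) * \<box> (Zpow b u) z * \<partial> \<mu> (Zpow c u) z
                + F b c \<mu> (ang z) * \<eta> (rad z) *
                    (\<box> (\<partial> \<mu> (Zpow b u)) z * Zpow c u z + \<partial> \<mu> (Zpow b u) z * \<box> (Zpow c u) z))
            + (\<Sum>(b,c)\<in>splits a.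
                \<Omega> (\<lambda>y. (\<Sum>\<mu>\<le>2. \<Sum>\<nu>\<le>2. P b c \<mu> \<nu> (ang y) * \<partial> \<mu> (\<partial> \<nu> (Zpow b u)) y)
                          * Zpow c u y / rad y) z
                + (\<Sum>\<mu>\<le>2. \<partial> \<mu> (\<lambda>y. (\<Sum>j=1..4. \<Sum>\<nu>\<le>2. R b c \<mu> j \<nu> (ang y) * Z j (\<partial> \<nu> (Zpow b u)) y)
                          * Zpow c u y / rad y) z)
                + (\<Sum>j=1..4. \<Sum>\<nu>\<le>2. S b c j \<nu> (ang z) * Z j (\<partial> \<nu> (Zpow b u)) z)
                    * Zpow c u z / (rad z)\<^sup>2))))"
proof -
  have K: "open K" "0 \<notin> K"
    using compact_imp_closed[OF \<open>compact Obs\<close>] \<open>0 \<in> Obs\<close> by (auto simp: K_def open_closed Compl_eq_Diff_UNIV[symmetric])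
  have fr: "frontier K \<subseteq> {x. norm x < 1/2}"
    using \<open>frontier K \<subseteq> {x. c\<^sub>0 < norm x \<and> norm x < 1/2}\<close> by auto
  note pol = real_polynomial_function_coefficients
  have polF: "real_polynomial_function (\<lambda>x. - 1/2 * pol_Q0 q \<mu> x)" for q \<mu>
    by (intro polynomial_intros pol)
  have "\<forall>a. \<exists>r. null_coefficients Q a r"
    using null_expansion_Zpow[OF null_condition_imp_null_tensor[OF \<open>null_condition Q\<close>]]
    unfolding null_expansion_def null_coefficients_def by blast
  then obtain r where r: "\<And>a. null_coefficients Q a (r a)" by metis
  note ctx = K \<open>is_cutoff \<eta>\<close> r
  show ?thesis
    apply (rule allI)
    subgoal for a
      apply (rule exI[of _ "\<lambda>b c. coef_Q12 (r a b c)"], rule exI[of _ "\<lambda>b c. pol_Q0 (r a b c)"])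
      apply (intro conjI)
      subgoal by (intro allI pol)
      subgoal
        by (rule exI[of _ "\<lambda>b c. pol_A (r a b c)"], rule exI[of _ "\<lambda>b c. pol_B (r a b c)"],
            rule exI[of _ "\<lambda>b c. pol_box (r a b c)"], intro conjI allI impI ballI pol,
            rule box_Zpow_expansion[OF ctx])
      subgoal by (intro allI impI ballI, rule V_zero_on_boundary[OF ctx _ fr])
      subgoal
        by (rule exI[of _ "\<lambda>b c. pol_A (r a b c)"], rule exI[of _ "\<lambda>b c. pol_B (r a b c)"],
            rule exI[of _ "\<lambda>b c. pol_box (r a b c)"], rule exI[of _ "\<lambda>b c. pol_Q0 (r a b c)"],
            rule exI[of _ "\<lambda>b c \<mu> x. - 1/2 * pol_Q0 (r a b c) \<mu> x"], intro conjI allI impI ballI pol polF,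
            rule box_V_expansion[OF ctx])
      subgoal by (rule commutator_bound[OF ctx])
      subgoal
        by (rule exI[of _ "\<lambda>b c. pol_box (r a b c)"], rule exI[of _ "\<lambda>b c. pol_Q0 (r a b c)"],
            rule exI[of _ "\<lambda>b c \<mu> x. - 1/2 * pol_Q0 (r a b c) \<mu> x"], rule exI[of _ "\<lambda>b c. pol_P (r a b c)"],
            rule exI[of _ "\<lambda>b c. pol_R (r a b c)"], rule exI[of _ "\<lambda>b c. pol_S (r a b c)"],
            intro conjI allI impI ballI pol polF, rule box_V_divergence[OF ctx])
      done
    done
qed

end
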